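(* Let $H$ be a co-commutative Hopf algebra over a field $\Bbbk$ of characteristic $0$. Then the partial Hopf algebra $H_{par}$ has the structure of a unital quantum inverse semigroup.
   Context: Unadorned tensor products are over $\Bbbk$, and Sweedler notation $\Delta(h)=h_{(1)}\otimes h_{(2)}$ is used. Partial Hopf algebra: let $H$ be a Hopf algebra over $\Bbbk$ with antipode $S$, and let $T(H)$ be the tensor algebra of the vector space $H$. The partial Hopf algebra $H_{par}$ is the quotient algebra of $T(H)$ by the (two-sided) ideal generated by the elements of the form (1) $1_H-1_{T(H)}$; (2) $h\otimes k_{(1)}\otimes S(k_{(2)})-hk_{(1)}\otimes S(k_{(2)})$, for all $h,k\in H$; (3) $h_{(1)}\otimes S(h_{(2)})\otimes k-h_{(1)}\otimes S(h_{(2)})k$, for all $h,k\in H$. Quantum inverse semigroup (QISG): a triple $(Q,\Delta,\mathcal S)$ in which (QISG1) $Q$ is a (not necessarily unital) associative $\Bbbk$-algebra; (QISG2) $\Delta:Q\to Q\otimes Q$ is a $\Bbbk$-linear map that is multiplicative and coassociative; (QISG3) $\mathcal S:Q\to Q$ is a $\Bbbk$-linear map (the pseudo-antipode) such that (i) $\mathcal S(hk)=\mathcal S(k)\mathcal S(h)$ for all $h,k\in Q$, and (ii) $I\ast\mathcal S\ast I=I$ and $\mathcal S\ast I\ast\mathcal S=\mathcal S$ in the convolution algebra $\mathrm{End}_\Bbbk(Q)$, where $I$ is the identity map and $(f\ast g)(h)=f(h_{(1)})g(h_{(2)})$; (QISG4) the subalgebras generated by the images of $I\ast\mathcal S$ and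 $\mathcal S\ast I$ mutually commute, that is, for all $h,k\in Q$, $h_{(1)}\mathcal S(h_{(2)})\mathcal S(k_{(1)})k_{(2)}=\mathcal S(k_{(1)})k_{(2)}h_{(1)}\mathcal S(h_{(2)})$. A QISG is unital if $Q$ is a unital $\Bbbk$-algebra and $\mathcal S(1_Q)=1_Q$. *)

theory Defs
  imports "HOL-Algebra.QuotRing" "HOL-Algebra.Module"
begin

section \<open>Linear algebra over a field given as a record\<close>

definition char_zero :: "'k ring \<Rightarrow> bool" where
  "char_zero K \<longleftrightarrow> (\<forall>n::nat. n > 0 \<longrightarrow> [n] \<cdot>\<^bsub>K\<^esub> \<one>\<^bsub>K\<^esub> \<noteq> \<zero>\<^bsub>K\<^esub>)"

definition linear_maps ::
    "'k ring \<Rightarrow> ('k, 'a) module \<Rightarrow> ('k, 'b) module \<Rightarrow> ('a \<Rightarrow> 'b) set" where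
  "linear_maps K V W = {f \<in> carrier V \<rightarrow> carrier W.
     (\<forall>x\<in>carrier V. \<forall>y\<in>carrier V. f (x \<oplus>\<^bsub>V\<^esub> y) = f x \<oplus>\<^bsub>W\<^esub> f y) \<and>
     (\<forall>c\<in>carrier K. \<forall>x\<in>carrier V. f (c \<odot>\<^bsub>V\<^esub> x) = c \<odot>\<^bsub>W\<^esub> f x)}"

definition self_module :: "'k ring \<Rightarrow> ('k, 'k) module" where
  "self_module K = ring.extend K (module.fields (\<lambda>c x. c \<otimes>\<^bsub>K\<^esub> x))"

text \<open>Associative algebras, not necessarily unital: the field \<open>one\<close> of the record is unconstrained.\<close>

locale assoc_algebra = field K + module K A
  for K :: "'k ring" and A :: "('k, 'a) module" +
  assumes alg_closed: "\<lbrakk>x \<in> carrier A; y \<in> carrier A\<rbrakk> \<Longrightarrow> x \<otimes>\<^bsub>A\<^esub> y \<in> carrier A"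
    and alg_assoc: "\<lbrakk>x \<in> carrier A; y \<in> carrier A; z \<in> carrier A\<rbrakk>
          \<Longrightarrow> (x \<otimes>\<^bsub>A\<^esub> y) \<otimes>\<^bsub>A\<^esub> z = x \<otimes>\<^bsub>A\<^esub> (y \<otimes>\<^bsub>A\<^esub> z)"
    and alg_l_distr: "\<lbrakk>x \<in> carrier A; y \<in> carrier A; z \<in> carrier A\<rbrakk>
          \<Longrightarrow> (x \<oplus>\<^bsub>A\<^esub> y) \<otimes>\<^bsub>A\<^esub> z = x \<otimes>\<^bsub>A\<^esub> z \<oplus>\<^bsub>A\<^esub> y \<otimes>\<^bsub>A\<^esub> z"
    and alg_r_distr: "\<lbrakk>x \<in> carrier A; y \<in> carrier A; z \<in> carrier A\<rbrakk>
          \<Longrightarrow> z \<otimes>\<^bsub>A\<^esub> (x \<oplus>\<^bsub>A\<^esub> y) = z \<otimes>\<^bsub>A\<^esub> x \<oplus>\<^bsub>A\<^esub> z \<otimes>\<^bsub>A\<^esub> y"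
    and alg_smult_l: "\<lbrakk>c \<in> carrier K; x \<in> carrier A; y \<in> carrier A\<rbrakk>
          \<Longrightarrow> (c \<odot>\<^bsub>A\<^esub> x) \<otimes>\<^bsub>A\<^esub> y = c \<odot>\<^bsub>A\<^esub> (x \<otimes>\<^bsub>A\<^esub> y)"
    and alg_smult_r: "\<lbrakk>c \<in> carrier K; x \<in> carrier A; y \<in> carrier A\<rbrakk>
          \<Longrightarrow> x \<otimes>\<^bsub>A\<^esub> (c \<odot>\<^bsub>A\<^esub> y) = c \<odot>\<^bsub>A\<^esub> (x \<otimes>\<^bsub>A\<^esub> y)"

locale unital_algebra = assoc_algebra K A + monoid A
  for K :: "'k ring" and A :: "('k, 'a) module"

text \<open>Only the module part of \<open>free_module\<close> is meaningful.\<close>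

definition free_module :: "'k ring \<Rightarrow> 's set \<Rightarrow> ('k, 's \<Rightarrow> 'k) module" where
  "free_module K B = \<lparr>
     carrier = {f. range f \<subseteq> carrier K \<and> finite {s. f s \<noteq> \<zero>\<^bsub>K\<^esub>} \<and> {s. f s \<noteq> \<zero>\<^bsub>K\<^esub>} \<subseteq> B},
     mult = undefined, one = undefined,
     zero = (\<lambda>s. \<zero>\<^bsub>K\<^esub>), add = (\<lambda>f g s. f s \<oplus>\<^bsub>K\<^esub> g s),
     smult = (\<lambda>c f s. c \<otimes>\<^bsub>K\<^esub> f s)\<rparr>"

definition basis_elem :: "'k ring \<Rightarrow> 's \<Rightarrow> 's \<Rightarrow> 'k" where
  "basis_elem K s = (\<lambda>t. if t = s then \<one>\<^bsub>K\<^esub> else \<zero>\<^bsub>K\<^esub>)"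

definition free_extend ::
    "'k ring \<Rightarrow> ('k, 'u) module \<Rightarrow> ('s \<Rightarrow> 'u) \<Rightarrow> ('s \<Rightarrow> 'k) \<Rightarrow> 'u" where
  "free_extend K U f x = (\<Oplus>\<^bsub>U\<^esub>s\<in>{s. x s \<noteq> \<zero>\<^bsub>K\<^esub>}. x s \<odot>\<^bsub>U\<^esub> f s)"

definition module_span :: "'k ring \<Rightarrow> ('k, 'a) module \<Rightarrow> 'a set \<Rightarrow> 'a set" where
  "module_span K M X = \<Inter>{N. submodule N K M \<and> X \<subseteq> N}"

text \<open>For a submodule \<open>N\<close> this is the quotient module, for a two-sided ideal the quotient algebra.\<close>

definition quot_module :: "('k, 'a) module \<Rightarrow> 'a set \<Rightarrow> ('k, 'a set) module" where
  "quot_module A N =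
     ring.extend (A Quot N) (module.fields (\<lambda>c X. \<Union>x\<in>X. N +>\<^bsub>A\<^esub> (c \<odot>\<^bsub>A\<^esub> x)))"


section \<open>Tensor products\<close>

definition bilinear_relations ::
    "'k ring \<Rightarrow> ('k, 'a) module \<Rightarrow> ('k, 'b) module \<Rightarrow> ('a \<times> 'b \<Rightarrow> 'k) set" where
  "bilinear_relations K V W = (let F = free_module K (carrier V \<times> carrier W); e = basis_elem K in
     {e (a \<oplus>\<^bsub>V\<^esub> a', b) \<ominus>\<^bsub>F\<^esub> e (a, b) \<ominus>\<^bsub>F\<^esub> e (a', b) |a a' b.
        a \<in> carrier V \<and> a' \<in> carrier V \<and> b \<in> carrier W} \<union>
     {e (a, b \<oplus>\<^bsub>W\<^esub> b') \<ominus>\<^bsub>F\<^esub> e (a, b) \<ominus>\<^bsub>F\<^esub> e (a, b') |a b b'.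
        a \<in> carrier V \<and> b \<in> carrier W \<and> b' \<in> carrier W} \<union>
     {e (c \<odot>\<^bsub>V\<^esub> a, b) \<ominus>\<^bsub>F\<^esub> (c \<odot>\<^bsub>F\<^esub> e (a, b)) |c a b.
        c \<in> carrier K \<and> a \<in> carrier V \<and> b \<in> carrier W} \<union>
     {e (a, c \<odot>\<^bsub>W\<^esub> b) \<ominus>\<^bsub>F\<^esub> (c \<odot>\<^bsub>F\<^esub> e (a, b)) |c a b.
        c \<in> carrier K \<and> a \<in> carrier V \<and> b \<in> carrier W})"

definition bilinear_kernel ::
    "'k ring \<Rightarrow> ('k, 'a) module \<Rightarrow> ('k, 'b) module \<Rightarrow> ('a \<times> 'b \<Rightarrow> 'k) set" where
  "bilinear_kernel K V W =
     module_span K (free_module K (carrier V \<times> carrier W)) (bilinear_relations K V W)"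

definition tensor_module ::
    "'k ring \<Rightarrow> ('k, 'a) module \<Rightarrow> ('k, 'b) module \<Rightarrow> ('k, ('a \<times> 'b \<Rightarrow> 'k) set) module" where
  "tensor_module K V W =
     quot_module (free_module K (carrier V \<times> carrier W)) (bilinear_kernel K V W)"

definition pure_tensor ::
    "'k ring \<Rightarrow> ('k, 'a) module \<Rightarrow> ('k, 'b) module \<Rightarrow> 'a \<Rightarrow> 'b \<Rightarrow> ('a \<times> 'b \<Rightarrow> 'k) set" where
  "pure_tensor K V W a b =
     bilinear_kernel K V W +>\<^bsub>free_module K (carrier V \<times> carrier W)\<^esub> basis_elem K (a, b)"

text \<open>The linear map \<open>V \<otimes> W \<rightarrow> U\<close> induced by \<open>f\<close>: it sends the class of
  \<open>\<Sum>c\<^sub>i (a\<^sub>i, b\<^sub>i)\<close> to \<open>\<Sum>c\<^sub>i f a\<^sub>i b\<^sub>i\<close>.  The value does not depend on the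
  representative when \<open>f\<close> is bilinear.  With \<open>t = \<Delta> h\<close> this is the Sweedler
  expression \<open>f h\<^sub>1 h\<^sub>2\<close>.\<close>

definition tensor_lift ::
    "'k ring \<Rightarrow> ('k, 'u) module \<Rightarrow> ('a \<Rightarrow> 'b \<Rightarrow> 'u) \<Rightarrow> ('a \<times> 'b \<Rightarrow> 'k) set \<Rightarrow> 'u" where
  "tensor_lift K U f t = free_extend K U (\<lambda>(a, b). f a b) (SOME x. x \<in> t)"

definition tensor_prod ::
    "'k ring \<Rightarrow> ('k, 'a) module \<Rightarrow> ('k, 'b) module \<Rightarrow> ('k, ('a \<times> 'b \<Rightarrow> 'k) set) module" where
  "tensor_prod K A B = (let T = tensor_module K A B; p = pure_tensor K A B in
     T\<lparr>mult := (\<lambda>s t. tensor_lift K T (\<lambda>a b.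
                  tensor_lift K T (\<lambda>c d. p (a \<otimes>\<^bsub>A\<^esub> c) (b \<otimes>\<^bsub>B\<^esub> d)) t) s),
       one := p \<one>\<^bsub>A\<^esub> \<one>\<^bsub>B\<^esub>\<rparr>)"

definition tensor_map ::
    "'k ring \<Rightarrow> ('k, 'c) module \<Rightarrow> ('k, 'd) module \<Rightarrow> ('a \<Rightarrow> 'c) \<Rightarrow> ('b \<Rightarrow> 'd)
      \<Rightarrow> ('a \<times> 'b \<Rightarrow> 'k) set \<Rightarrow> ('c \<times> 'd \<Rightarrow> 'k) set" where
  "tensor_map K C D f g =
     tensor_lift K (tensor_prod K C D) (\<lambda>a b. pure_tensor K C D (f a) (g b))"

definition tensor_flip ::
    "'k ring \<Rightarrow> ('k, 'a) module \<Rightarrow> ('k, 'b) module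
      \<Rightarrow> ('a \<times> 'b \<Rightarrow> 'k) set \<Rightarrow> ('b \<times> 'a \<Rightarrow> 'k) set" where
  "tensor_flip K A B = tensor_lift K (tensor_prod K B A) (\<lambda>a b. pure_tensor K B A b a)"

definition tensor_assoc ::
    "'k ring \<Rightarrow> ('k, 'a) module \<Rightarrow> ('k, 'b) module \<Rightarrow> ('k, 'c) module
      \<Rightarrow> (('a \<times> 'b \<Rightarrow> 'k) set \<times> 'c \<Rightarrow> 'k) set \<Rightarrow> ('a \<times> ('b \<times> 'c \<Rightarrow> 'k) set \<Rightarrow> 'k) set" where
  "tensor_assoc K A B C = (let BC = tensor_prod K B C; T = tensor_prod K A BC in
     tensor_lift K T (\<lambda>t c.
       tensor_lift K T (\<lambda>a b. pure_tensor K A BC a (pure_tensor K B C b c)) t))"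

definition coassociative ::
    "'k ring \<Rightarrow> ('k, 'a) module \<Rightarrow> ('a \<Rightarrow> ('a \<times> 'a \<Rightarrow> 'k) set) \<Rightarrow> bool" where
  "coassociative K A \<Delta> \<longleftrightarrow> (\<forall>x\<in>carrier A.
     tensor_assoc K A A A (tensor_map K (tensor_prod K A A) A \<Delta> (\<lambda>y. y) (\<Delta> x)) =
     tensor_map K A (tensor_prod K A A) (\<lambda>y. y) \<Delta> (\<Delta> x))"

definition convolution ::
    "'k ring \<Rightarrow> ('k, 'a) module \<Rightarrow> ('a \<Rightarrow> ('a \<times> 'a \<Rightarrow> 'k) set)
      \<Rightarrow> ('a \<Rightarrow> 'a) \<Rightarrow> ('a \<Rightarrow> 'a) \<Rightarrow> 'a \<Rightarrow> 'a" where
  "convolution K A \<Delta> f g = (\<lambda>x. tensor_lift K A (\<lambda>a b. f a \<otimes>\<^bsub>A\<^esub> g b) (\<Delta> x))"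


section \<open>Hopf algebras\<close>

locale hopf_algebra = unital_algebra K H
  for K :: "'k ring" and H :: "('k, 'h) module"
    and \<Delta> :: "'h \<Rightarrow> ('h \<times> 'h \<Rightarrow> 'k) set" and \<epsilon> :: "'h \<Rightarrow> 'k" and S :: "'h \<Rightarrow> 'h" +
  assumes comult_linear: "\<Delta> \<in> linear_maps K H (tensor_prod K H H)"
    and comult_hom: "\<Delta> \<in> ring_hom H (tensor_prod K H H)"
    and comult_coassoc: "coassociative K H \<Delta>"
    and counit_linear: "\<epsilon> \<in> linear_maps K H (self_module K)"
    and counit_hom: "\<epsilon> \<in> ring_hom H K"
    and counit_l: "h \<in> carrier H \<Longrightarrow> tensor_lift K H (\<lambda>a b. \<epsilon> a \<odot>\<^bsub>H\<^esub> b) (\<Delta> h) = h"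
    and counit_r: "h \<in> carrier H \<Longrightarrow> tensor_lift K H (\<lambda>a b. \<epsilon> b \<odot>\<^bsub>H\<^esub> a) (\<Delta> h) = h"
    and antipode_linear: "S \<in> linear_maps K H H"
    and antipode_l: "h \<in> carrier H \<Longrightarrow> convolution K H \<Delta> S (\<lambda>x. x) h = \<epsilon> h \<odot>\<^bsub>H\<^esub> \<one>\<^bsub>H\<^esub>"
    and antipode_r: "h \<in> carrier H \<Longrightarrow> convolution K H \<Delta> (\<lambda>x. x) S h = \<epsilon> h \<odot>\<^bsub>H\<^esub> \<one>\<^bsub>H\<^esub>"

definition cocommutative ::
    "'k ring \<Rightarrow> ('k, 'a) module \<Rightarrow> ('a \<Rightarrow> ('a \<times> 'a \<Rightarrow> 'k) set) \<Rightarrow> bool" where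
  "cocommutative K A \<Delta> \<longleftrightarrow> (\<forall>x\<in>carrier A. tensor_flip K A A (\<Delta> x) = \<Delta> x)"


section \<open>The tensor algebra and the partial Hopf algebra\<close>

text \<open>The free \<open>K\<close>-algebra on the set \<open>X\<close>: finitely supported functions on words over \<open>X\<close>,
  multiplied by linearly extending concatenation.\<close>

definition free_algebra :: "'k ring \<Rightarrow> 'x set \<Rightarrow> ('k, 'x list \<Rightarrow> 'k) module" where
  "free_algebra K X = (free_module K (lists X))
     \<lparr>mult := (\<lambda>f g w. \<Oplus>\<^bsub>K\<^esub>i\<in>{..length w}. f (take i w) \<otimes>\<^bsub>K\<^esub> g (drop i w)),
      one := basis_elem K []\<rparr>"

text \<open>\<open>T(V)\<close> is the free algebra on the set \<open>V\<close> modulo linearity of the letters.  In word length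
  \<open>n\<close> the ideal is spanned by the multilinearity relations, so the quotient is the direct sum of
  the \<open>n\<close>-fold tensor powers of \<open>V\<close>; its product is the concatenation \<open>\<otimes>\<close>.\<close>

definition tensor_algebra_ideal ::
    "'k ring \<Rightarrow> ('k, 'v) module \<Rightarrow> ('v list \<Rightarrow> 'k) set" where
  "tensor_algebra_ideal K V = (let F = free_algebra K (carrier V); e = (\<lambda>a. basis_elem K [a]) in
     genideal F
      ({e (a \<oplus>\<^bsub>V\<^esub> b) \<ominus>\<^bsub>F\<^esub> e a \<ominus>\<^bsub>F\<^esub> e b |a b. a \<in> carrier V \<and> b \<in> carrier V} \<union>
       {e (c \<odot>\<^bsub>V\<^esub> a) \<ominus>\<^bsub>F\<^esub> (c \<odot>\<^bsub>F\<^esub> e a) |c a. c \<in> carrier K \<and> a \<in> carrier V}))"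

definition tensor_algebra ::
    "'k ring \<Rightarrow> ('k, 'v) module \<Rightarrow> ('k, ('v list \<Rightarrow> 'k) set) module" where
  "tensor_algebra K V = quot_module (free_algebra K (carrier V)) (tensor_algebra_ideal K V)"

definition tensor_algebra_incl ::
    "'k ring \<Rightarrow> ('k, 'v) module \<Rightarrow> 'v \<Rightarrow> ('v list \<Rightarrow> 'k) set" where
  "tensor_algebra_incl K V v =
     tensor_algebra_ideal K V +>\<^bsub>free_algebra K (carrier V)\<^esub> basis_elem K [v]"

text \<open>In order, in Sweedler notation: \<open>1\<^sub>H - 1\<close>;
  \<open>h \<otimes> k\<^sub>1 \<otimes> S(k\<^sub>2) - hk\<^sub>1 \<otimes> S(k\<^sub>2)\<close>;
  \<open>h\<^sub>1 \<otimes> S(h\<^sub>2) \<otimes> k - h\<^sub>1 \<otimes> S(h\<^sub>2)k\<close>.\<close>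

definition hpar_relations ::
    "'k ring \<Rightarrow> ('k, 'h) module \<Rightarrow> ('h \<Rightarrow> ('h \<times> 'h \<Rightarrow> 'k) set) \<Rightarrow> ('h \<Rightarrow> 'h)
      \<Rightarrow> ('h list \<Rightarrow> 'k) set set" where
  "hpar_relations K H \<Delta> S = (let T = tensor_algebra K H; \<iota> = tensor_algebra_incl K H in
     {\<iota> \<one>\<^bsub>H\<^esub> \<ominus>\<^bsub>T\<^esub> \<one>\<^bsub>T\<^esub>} \<union>
     {tensor_lift K T (\<lambda>a b. \<iota> h \<otimes>\<^bsub>T\<^esub> \<iota> a \<otimes>\<^bsub>T\<^esub> \<iota> (S b)) (\<Delta> k) \<ominus>\<^bsub>T\<^esub>
      tensor_lift K T (\<lambda>a b. \<iota> (h \<otimes>\<^bsub>H\<^esub> a) \<otimes>\<^bsub>T\<^esub> \<iota> (S b)) (\<Delta> k)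
      |h k. h \<in> carrier H \<and> k \<in> carrier H} \<union>
     {tensor_lift K T (\<lambda>a b. \<iota> a \<otimes>\<^bsub>T\<^esub> \<iota> (S b) \<otimes>\<^bsub>T\<^esub> \<iota> k) (\<Delta> h) \<ominus>\<^bsub>T\<^esub>
      tensor_lift K T (\<lambda>a b. \<iota> a \<otimes>\<^bsub>T\<^esub> \<iota> (S b \<otimes>\<^bsub>H\<^esub> k)) (\<Delta> h)
      |h k. h \<in> carrier H \<and> k \<in> carrier H})"

definition hpar_ideal ::
    "'k ring \<Rightarrow> ('k, 'h) module \<Rightarrow> ('h \<Rightarrow> ('h \<times> 'h \<Rightarrow> 'k) set) \<Rightarrow> ('h \<Rightarrow> 'h)
      \<Rightarrow> ('h list \<Rightarrow> 'k) set set" where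
  "hpar_ideal K H \<Delta> S = genideal (tensor_algebra K H) (hpar_relations K H \<Delta> S)"

definition hpar ::
    "'k ring \<Rightarrow> ('k, 'h) module \<Rightarrow> ('h \<Rightarrow> ('h \<times> 'h \<Rightarrow> 'k) set) \<Rightarrow> ('h \<Rightarrow> 'h)
      \<Rightarrow> ('k, ('h list \<Rightarrow> 'k) set set) module" where
  "hpar K H \<Delta> S = quot_module (tensor_algebra K H) (hpar_ideal K H \<Delta> S)"

definition hpar_class ::
    "'k ring \<Rightarrow> ('k, 'h) module \<Rightarrow> ('h \<Rightarrow> ('h \<times> 'h \<Rightarrow> 'k) set) \<Rightarrow> ('h \<Rightarrow> 'h)
      \<Rightarrow> 'h \<Rightarrow> ('h list \<Rightarrow> 'k) set set" where
  "hpar_class K H \<Delta> S h = hpar_ideal K H \<Delta> S +>\<^bsub>tensor_algebra K H\<^esub> tensor_algebra_incl K H h"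


section \<open>Quantum inverse semigroups\<close>

locale qisg = assoc_algebra K Q
  for K :: "'k ring" and Q :: "('k, 'q) module"
    and \<Delta> :: "'q \<Rightarrow> ('q \<times> 'q \<Rightarrow> 'k) set" and S :: "'q \<Rightarrow> 'q" +
  assumes comult_linear: "\<Delta> \<in> linear_maps K Q (tensor_prod K Q Q)"
    and comult_mult: "\<lbrakk>x \<in> carrier Q; y \<in> carrier Q\<rbrakk>
          \<Longrightarrow> \<Delta> (x \<otimes>\<^bsub>Q\<^esub> y) = \<Delta> x \<otimes>\<^bsub>tensor_prod K Q Q\<^esub> \<Delta> y"
    and comult_coassoc: "coassociative K Q \<Delta>"
    and pseudo_antipode_linear: "S \<in> linear_maps K Q Q"
    and pseudo_antipode_antimult: "\<lbrakk>x \<in> carrier Q; y \<in> carrier Q\<rbrakk>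
          \<Longrightarrow> S (x \<otimes>\<^bsub>Q\<^esub> y) = S y \<otimes>\<^bsub>Q\<^esub> S x"
    and id_S_id: "x \<in> carrier Q \<Longrightarrow>
          convolution K Q \<Delta> (convolution K Q \<Delta> (\<lambda>y. y) S) (\<lambda>y. y) x = x"
    and S_id_S: "x \<in> carrier Q \<Longrightarrow>
          convolution K Q \<Delta> (convolution K Q \<Delta> S (\<lambda>y. y)) S x = S x"
    and images_commute: "\<lbrakk>x \<in> carrier Q; y \<in> carrier Q\<rbrakk> \<Longrightarrow>
          convolution K Q \<Delta> (\<lambda>z. z) S x \<otimes>\<^bsub>Q\<^esub> convolution K Q \<Delta> S (\<lambda>z. z) y =
          convolution K Q \<Delta> S (\<lambda>z. z) y \<otimes>\<^bsub>Q\<^esub> convolution K Q \<Delta> (\<lambda>z. z) S x"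

locale unital_qisg = qisg K Q \<Delta> S + unital_algebra K Q
  for K :: "'k ring" and Q :: "('k, 'q) module"
    and \<Delta> :: "'q \<Rightarrow> ('q \<times> 'q \<Rightarrow> 'k) set" and S :: "'q \<Rightarrow> 'q" +
  assumes pseudo_antipode_one: "S \<one>\<^bsub>Q\<^esub> = \<one>\<^bsub>Q\<^esub>"

end

theory Submission
  imports Defs
begin

text \<open>Write \<open>[h]\<close> for the class of \<open>h\<close> in \<open>Q = H\<^sub>p\<^sub>a\<^sub>r\<close>.  For the algebra of a group, \<open>Q\<close> is the
algebra of the monoid with generators \<open>[g]\<close> and relations \<open>[1] = 1\<close>, \<open>[g][h][h\<inverse>] = [gh][h\<inverse>]\<close> and
\<open>[g][g\<inverse>][h] = [g][g\<inverse>h]\<close>, and the proof is the linearised version of Exel's proof that this monoid is inverse.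

Cocommutativity makes \<open>S\<close> an involutive morphism of coalgebras (\<open>comult_antipode\<close>, \<open>antipode_antipode\<close>),
and \<open>S\<close> is an antimorphism of algebras (\<open>antipode_mult\<close>).  With these facts the assignments
\<open>h \<mapsto> [h\<^sub>1] \<otimes> [h\<^sub>2]\<close> into \<open>Q \<otimes> Q\<close> and \<open>h \<mapsto> [S h]\<close> into the opposite algebra of \<open>Q\<close> respect the defining relations
of \<open>Q\<close>, so the universal property \<open>hpar_lift\<close> turns them into the comultiplication \<open>\<Delta>p\<close> and the
pseudo-antipode \<open>Sp\<close>.  Coassociativity of \<open>\<Delta>p\<close> is inherited from \<open>H\<close> by induction on products of classes.

Everything else rests on the elements \<open>\<epsilon>\<^sub>h = [h\<^sub>1][S h\<^sub>2]\<close> (\<open>idem\<close>).  The relations give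
\<open>[h]\<epsilon>\<^sub>k = \<epsilon>\<^bsub>h\<^sub>1k\<^esub>[h\<^sub>2]\<close> (\<open>hpar_class_idem\<close>), and from this and cocommutativity \<open>\<epsilon>\<^sub>h\<epsilon>\<^sub>k = \<epsilon>\<^sub>k\<epsilon>\<^sub>h\<close> (\<open>idem_commute\<close>).
Hence the span \<open>A\<close> of the products of such elements (\<open>idem_span\<close>) is commutative, and it is stable
under \<open>a \<mapsto> [h\<^sub>1] a [S h\<^sub>2]\<close> (\<open>idem_span_conjugate\<close>).  Building up \<open>x\<close> one class at a time shows that
\<open>x\<^sub>1 Sp(x\<^sub>2)\<close> always lies in \<open>A\<close>, and, since it then commutes with the \<open>\<epsilon>\<close>'s, that \<open>x\<^sub>1 Sp(x\<^sub>2) x\<^sub>3 = x\<close>.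
The pseudo-antipode is itself an involutive morphism of coalgebras, so \<open>Sp(x\<^sub>1) x\<^sub>2\<close> is the value of
\<open>y \<mapsto> y\<^sub>1 Sp(y\<^sub>2)\<close> at \<open>y = Sp x\<close>; this transfers both facts to the other convolution product.

A Sweedler sum \<open>\<Sum> f h\<^sub>1 h\<^sub>2\<close> is \<open>tensor_lift K U f (\<Delta> h)\<close>.  The sections on tensor products and on
linear expressions provide a calculus for such sums: they commute with linear maps, may be exchanged,
and their multilinearity is derived syntactically from \<open>linear_intros\<close>, which is what is needed to apply
coassociativity, cocommutativity and the counit and antipode axioms inside an expression.\<close>

section \<open>Linear maps and quotient modules\<close>

lemma (in abelian_group) minus_zero_imp_eq:
  assumes "x \<ominus> y = \<zero>" "x \<in> carrier G" "y \<in> carrier G"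
  shows "x = y"
  using assms minus_equality[of x "\<ominus> y"] by (simp add: a_minus_def)

lemma linear_mapsI:
  assumes "\<And>x. x \<in> carrier V \<Longrightarrow> f x \<in> carrier W"
    and "\<And>x y. x \<in> carrier V \<Longrightarrow> y \<in> carrier V \<Longrightarrow> f (x \<oplus>\<^bsub>V\<^esub> y) = f x \<oplus>\<^bsub>W\<^esub> f y"
    and "\<And>c x. c \<in> carrier K \<Longrightarrow> x \<in> carrier V \<Longrightarrow> f (c \<odot>\<^bsub>V\<^esub> x) = c \<odot>\<^bsub>W\<^esub> f x"
  shows "f \<in> linear_maps K V W"
  using assms by (auto simp: linear_maps_def)

lemma linear_maps_closed: "f \<in> linear_maps K V W \<Longrightarrow> x \<in> carrier V \<Longrightarrow> f x \<in> carrier W"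
  by (auto simp: linear_maps_def)

lemma linear_maps_add:
  "f \<in> linear_maps K V W \<Longrightarrow> x \<in> carrier V \<Longrightarrow> y \<in> carrier V \<Longrightarrow> f (x \<oplus>\<^bsub>V\<^esub> y) = f x \<oplus>\<^bsub>W\<^esub> f y"
  by (auto simp: linear_maps_def)

lemma linear_maps_smult:
  "f \<in> linear_maps K V W \<Longrightarrow> c \<in> carrier K \<Longrightarrow> x \<in> carrier V \<Longrightarrow> f (c \<odot>\<^bsub>V\<^esub> x) = c \<odot>\<^bsub>W\<^esub> f x"
  by (auto simp: linear_maps_def)

lemma linear_maps_zero:
  assumes "module K V" "module K W" "f \<in> linear_maps K V W"
  shows "f \<zero>\<^bsub>V\<^esub> = \<zero>\<^bsub>W\<^esub>"
proof -
  interpret V: module K V by fact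
  interpret W: module K W by fact
  have "f (\<zero>\<^bsub>K\<^esub> \<odot>\<^bsub>V\<^esub> \<zero>\<^bsub>V\<^esub>) = \<zero>\<^bsub>K\<^esub> \<odot>\<^bsub>W\<^esub> f \<zero>\<^bsub>V\<^esub>"
    by (rule linear_maps_smult[OF assms(3)]) auto
  then show ?thesis using linear_maps_closed[OF assms(3)] by simp
qed

lemma linear_maps_uminus:
  assumes "module K V" "module K W" "f \<in> linear_maps K V W" "x \<in> carrier V"
  shows "f (\<ominus>\<^bsub>V\<^esub> x) = \<ominus>\<^bsub>W\<^esub> f x"
proof -
  interpret V: module K V by fact
  interpret W: module K W by fact
  have "f (\<ominus>\<^bsub>V\<^esub> x) \<oplus>\<^bsub>W\<^esub> f x = \<zero>\<^bsub>W\<^esub>"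
    using assms linear_maps_add[OF assms(3), of "\<ominus>\<^bsub>V\<^esub> x" x] linear_maps_zero[OF assms(1-3)]
    by (simp add: V.M.l_neg)
  then show ?thesis
    using assms(4) linear_maps_closed[OF assms(3)] W.M.minus_equality by force
qed

lemma linear_maps_minus:
  assumes "module K V" "module K W" "f \<in> linear_maps K V W" "x \<in> carrier V" "y \<in> carrier V"
  shows "f (x \<ominus>\<^bsub>V\<^esub> y) = f x \<ominus>\<^bsub>W\<^esub> f y"
proof -
  interpret V: module K V by fact
  interpret W: module K W by fact
  show ?thesis using assms by (simp add: a_minus_def linear_maps_add[OF assms(3)] linear_maps_uminus)
qed

lemma linear_maps_finsum:
  assumes "module K V" "module K W" "f \<in> linear_maps K V W" "finite A" "g \<in> A \<rightarrow> carrier V"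
  shows "f (\<Oplus>\<^bsub>V\<^esub>i\<in>A. g i) = (\<Oplus>\<^bsub>W\<^esub>i\<in>A. f (g i))"
proof -
  interpret V: module K V by fact
  interpret W: module K W by fact
  show ?thesis using assms(4,5)
  proof (induction)
    case empty then show ?case using linear_maps_zero[OF assms(1-3)] by simp
  next
    case (insert x F)
    then have "f \<in> carrier V \<rightarrow> carrier W" using linear_maps_closed[OF assms(3)] by auto
    with insert show ?case by (simp add: Pi_def linear_maps_add[OF assms(3)])
  qed
qed

lemma linear_maps_comp:
  "f \<in> linear_maps K V W \<Longrightarrow> g \<in> linear_maps K W U \<Longrightarrow> (\<lambda>x. g (f x)) \<in> linear_maps K V U"
  by (auto simp: linear_maps_def Pi_def)

lemma kernel_submodule:
  assumes "module K V" "module K W" "f \<in> linear_maps K V W"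
  shows "submodule {x \<in> carrier V. f x = \<zero>\<^bsub>W\<^esub>} K V"
proof -
  interpret V: module K V by fact
  interpret W: module K W by fact
  show ?thesis
    by (rule V.submoduleI) (auto simp: linear_maps_zero[OF assms] linear_maps_uminus[OF assms]
        linear_maps_add[OF assms(3)] linear_maps_smult[OF assms(3)])
qed

lemma submodule_abelian_subgroup:
  assumes "module K M" "submodule N K M"
  shows "abelian_subgroup N M"
proof -
  interpret M: module K M by fact
  interpret N: submodule N K M by fact
  show ?thesis
    by (rule abelian_subgroupI3, rule additive_subgroupI) (unfold_locales)
qed

lemma quot_module_carrier: "carrier (quot_module A N) = {N +>\<^bsub>A\<^esub> a |a. a \<in> carrier A}"
  by (auto simp: quot_module_def ring.extend_def module.fields_def FactRing_def A_RCOSETS_def')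

lemma quot_module_simps:
  "zero (quot_module A N) = N" "one (quot_module A N) = N +>\<^bsub>A\<^esub> \<one>\<^bsub>A\<^esub>"
  "add (quot_module A N) = set_add A" "mult (quot_module A N) = rcoset_mult A N"
  "smult (quot_module A N) = (\<lambda>c X. \<Union>x\<in>X. N +>\<^bsub>A\<^esub> (c \<odot>\<^bsub>A\<^esub> x))"
  by (auto simp: quot_module_def ring.extend_def module.fields_def FactRing_def)

lemma coset_eq_iff:
  assumes "module K M" "submodule N K M" "x \<in> carrier M" "y \<in> carrier M"
  shows "N +>\<^bsub>M\<^esub> x = N +>\<^bsub>M\<^esub> y \<longleftrightarrow> x \<ominus>\<^bsub>M\<^esub> y \<in> N"
proof -
  interpret M: module K M by fact
  interpret N: abelian_subgroup N M by (rule submodule_abelian_subgroup) fact+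
  have "x \<in> N +>\<^bsub>M\<^esub> y \<longleftrightarrow> x \<ominus>\<^bsub>M\<^esub> y \<in> N"
    using N.a_rcos_module[OF assms(4,3)] by (simp add: a_minus_def)
  then show ?thesis
    using assms(3,4) N.a_rcos_self M.a_repr_independence[OF _ _ N.a_subgroup] by metis
qed

lemma coset_add:
  assumes "module K M" "submodule N K M" "x \<in> carrier M" "y \<in> carrier M"
  shows "(N +>\<^bsub>M\<^esub> x) \<oplus>\<^bsub>quot_module M N\<^esub> (N +>\<^bsub>M\<^esub> y) = N +>\<^bsub>M\<^esub> (x \<oplus>\<^bsub>M\<^esub> y)"
proof -
  interpret N: abelian_subgroup N M by (rule submodule_abelian_subgroup) fact+
  show ?thesis using assms(3,4) by (simp add: quot_module_simps N.a_rcos_sum)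
qed

lemma coset_elem:
  assumes "module K M" "submodule N K M" "x \<in> carrier M" "y \<in> N +>\<^bsub>M\<^esub> x"
  shows "y \<in> carrier M" "y \<ominus>\<^bsub>M\<^esub> x \<in> N" "N +>\<^bsub>M\<^esub> y = N +>\<^bsub>M\<^esub> x"
proof -
  interpret M: module K M by fact
  interpret N: abelian_subgroup N M by (rule submodule_abelian_subgroup) fact+
  show y: "y \<in> carrier M" using assms(3,4) N.a_subset M.M.a_r_coset_subset_G by blast
  show eq: "N +>\<^bsub>M\<^esub> y = N +>\<^bsub>M\<^esub> x"
    using M.a_repr_independence[OF assms(4,3) N.a_subgroup] by simp
  then show "y \<ominus>\<^bsub>M\<^esub> x \<in> N" using coset_eq_iff[OF assms(1,2) y assms(3)] by simp
qed

lemma coset_smult: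
  assumes "module K M" "submodule N K M" "x \<in> carrier M" "c \<in> carrier K"
  shows "c \<odot>\<^bsub>quot_module M N\<^esub> (N +>\<^bsub>M\<^esub> x) = N +>\<^bsub>M\<^esub> (c \<odot>\<^bsub>M\<^esub> x)"
proof -
  interpret M: module K M by fact
  interpret N: abelian_subgroup N M by (rule submodule_abelian_subgroup) fact+
  have *: "N +>\<^bsub>M\<^esub> (c \<odot>\<^bsub>M\<^esub> y) = N +>\<^bsub>M\<^esub> (c \<odot>\<^bsub>M\<^esub> x)" if "y \<in> N +>\<^bsub>M\<^esub> x" for y
  proof -
    note y = coset_elem[OF assms(1-3) that]
    have "c \<odot>\<^bsub>M\<^esub> y \<ominus>\<^bsub>M\<^esub> c \<odot>\<^bsub>M\<^esub> x = c \<odot>\<^bsub>M\<^esub> (y \<ominus>\<^bsub>M\<^esub> x)"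
      using y(1) assms(3,4) by (simp add: a_minus_def M.smult_r_distr M.smult_r_minus)
    also have "\<dots> \<in> N" using assms(2,4) y(2) by (rule submodule.smult_closed)
    finally show ?thesis
      by (subst coset_eq_iff[OF assms(1,2)]) (use y(1) assms(3,4) in auto)
  qed
  have "x \<in> N +>\<^bsub>M\<^esub> x" using assms(3) by (rule N.a_rcos_self)
  then have "(\<Union>y\<in>N +>\<^bsub>M\<^esub> x. N +>\<^bsub>M\<^esub> (c \<odot>\<^bsub>M\<^esub> x)) = N +>\<^bsub>M\<^esub> (c \<odot>\<^bsub>M\<^esub> x)" by auto
  moreover have "(\<Union>y\<in>N +>\<^bsub>M\<^esub> x. N +>\<^bsub>M\<^esub> (c \<odot>\<^bsub>M\<^esub> y)) = (\<Union>y\<in>N +>\<^bsub>M\<^esub> x. N +>\<^bsub>M\<^esub> (c \<odot>\<^bsub>M\<^esub> x))"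
    by (rule SUP_cong) (rule refl, rule *)
  ultimately show ?thesis by (simp add: quot_module_simps)
qed

lemma module_quot_module:
  assumes "module K M" "submodule N K M"
  shows "module K (quot_module M N)"
proof -
  interpret M: module K M by fact
  interpret N: abelian_subgroup N M by (rule submodule_abelian_subgroup) fact+
  have z: "\<zero>\<^bsub>quot_module M N\<^esub> = N +>\<^bsub>M\<^esub> \<zero>\<^bsub>M\<^esub>"
    using N.a_subset by (simp add: quot_module_simps M.a_coset_add_zero)
  note r = coset_add[OF assms] coset_smult[OF assms]
  let ?Q = "quot_module M N"
  have obt: "\<exists>a\<in>carrier M. x = N +>\<^bsub>M\<^esub> a" if "x \<in> carrier ?Q" for x
    using that by (auto simp: quot_module_carrier)
  have cl: "N +>\<^bsub>M\<^esub> a \<in> carrier ?Q" if "a \<in> carrier M" for a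
    using that by (auto simp: quot_module_carrier)
  have ag: "abelian_group ?Q"
  proof (rule abelian_groupI)
    fix x assume "x \<in> carrier ?Q"
    then obtain a where a: "a \<in> carrier M" "x = N +>\<^bsub>M\<^esub> a" using obt by blast
    have "(N +>\<^bsub>M\<^esub> (\<ominus>\<^bsub>M\<^esub> a)) \<oplus>\<^bsub>?Q\<^esub> x = \<zero>\<^bsub>?Q\<^esub>"
      using a by (simp add: r z M.M.l_neg)
    then show "\<exists>y\<in>carrier ?Q. y \<oplus>\<^bsub>?Q\<^esub> x = \<zero>\<^bsub>?Q\<^esub>" using a cl M.M.a_inv_closed by blast
    show "\<zero>\<^bsub>?Q\<^esub> \<oplus>\<^bsub>?Q\<^esub> x = x" using a by (simp add: z r)
    fix y assume "y \<in> carrier ?Q"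
    then obtain b where b: "b \<in> carrier M" "y = N +>\<^bsub>M\<^esub> b" using obt by blast
    show "x \<oplus>\<^bsub>?Q\<^esub> y \<in> carrier ?Q" "x \<oplus>\<^bsub>?Q\<^esub> y = y \<oplus>\<^bsub>?Q\<^esub> x" using a b by (simp_all add: r cl M.M.a_comm)
    fix w assume "w \<in> carrier ?Q"
    then obtain c where "c \<in> carrier M" "w = N +>\<^bsub>M\<^esub> c" using obt by blast
    then show "(x \<oplus>\<^bsub>?Q\<^esub> y) \<oplus>\<^bsub>?Q\<^esub> w = x \<oplus>\<^bsub>?Q\<^esub> (y \<oplus>\<^bsub>?Q\<^esub> w)" using a b by (simp add: r M.M.a_assoc)
  next
    show "\<zero>\<^bsub>?Q\<^esub> \<in> carrier ?Q" unfolding z by (rule cl) simp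
  qed
  show ?thesis
  proof (rule moduleI[OF M.is_cring ag])
    fix x assume "x \<in> carrier ?Q"
    then obtain a where a: "a \<in> carrier M" "x = N +>\<^bsub>M\<^esub> a" using obt by blast
    show "\<one>\<^bsub>K\<^esub> \<odot>\<^bsub>?Q\<^esub> x = x" using a by (simp add: r)
    fix c assume c: "c \<in> carrier K"
    show "c \<odot>\<^bsub>?Q\<^esub> x \<in> carrier ?Q" using a c by (simp add: r cl)
    show "(c \<oplus>\<^bsub>K\<^esub> d) \<odot>\<^bsub>?Q\<^esub> x = c \<odot>\<^bsub>?Q\<^esub> x \<oplus>\<^bsub>?Q\<^esub> d \<odot>\<^bsub>?Q\<^esub> x"
      "(c \<otimes>\<^bsub>K\<^esub> d) \<odot>\<^bsub>?Q\<^esub> x = c \<odot>\<^bsub>?Q\<^esub> (d \<odot>\<^bsub>?Q\<^esub> x)" if "d \<in> carrier K" for d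
      using a c that by (simp_all add: r M.smult_l_distr M.smult_assoc1)
    fix y assume "y \<in> carrier ?Q"
    then obtain b where b: "b \<in> carrier M" "y = N +>\<^bsub>M\<^esub> b" using obt by blast
    then show "c \<odot>\<^bsub>?Q\<^esub> (x \<oplus>\<^bsub>?Q\<^esub> y) = c \<odot>\<^bsub>?Q\<^esub> x \<oplus>\<^bsub>?Q\<^esub> c \<odot>\<^bsub>?Q\<^esub> y"
      using a c by (simp add: r M.smult_r_distr)
  qed
qed

lemma linear_coset:
  assumes "module K M" "submodule N K M"
  shows "(\<lambda>x. N +>\<^bsub>M\<^esub> x) \<in> linear_maps K M (quot_module M N)"
  by (rule linear_mapsI) (auto simp: quot_module_carrier coset_add[OF assms] coset_smult[OF assms])

text \<open>A representative is chosen, so this is meaningful only for maps that are constant on cosets.\<close>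

definition quot_lift :: "('a \<Rightarrow> 'b) \<Rightarrow> 'a set \<Rightarrow> 'b" where
  "quot_lift f X = f (SOME x. x \<in> X)"

lemma quot_lift_coset:
  assumes "module K M" "submodule N K M" "module K U" "f \<in> linear_maps K M U"
    and "\<And>x. x \<in> N \<Longrightarrow> f x = \<zero>\<^bsub>U\<^esub>" "x \<in> carrier M"
  shows "quot_lift f (N +>\<^bsub>M\<^esub> x) = f x"
proof -
  interpret M: module K M by fact
  interpret U: module K U by fact
  interpret N: abelian_subgroup N M by (rule submodule_abelian_subgroup) fact+
  define y where "y = (SOME y. y \<in> N +>\<^bsub>M\<^esub> x)"
  have "y \<in> N +>\<^bsub>M\<^esub> x"
    unfolding y_def using N.a_rcos_self[OF assms(6)] by (rule someI)
  note y = coset_elem[OF assms(1,2,6) this]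
  have "f y \<ominus>\<^bsub>U\<^esub> f x = \<zero>\<^bsub>U\<^esub>"
    using y assms(5)[OF y(2)] by (simp add: linear_maps_minus[OF assms(1,3,4)] assms(6))
  then have "f y = f x"
    using y(1) assms(6) linear_maps_closed[OF assms(4)] by (simp add: U.minus_zero_imp_eq)
  then show ?thesis by (simp add: quot_lift_def y_def)
qed

lemma linear_quot_lift:
  assumes "module K M" "submodule N K M" "module K U" "f \<in> linear_maps K M U"
    and "\<And>x. x \<in> N \<Longrightarrow> f x = \<zero>\<^bsub>U\<^esub>"
  shows "quot_lift f \<in> linear_maps K (quot_module M N) U"
proof -
  interpret M: module K M by fact
  note q = quot_lift_coset[OF assms]
  show ?thesis
  proof (rule linear_mapsI)
    fix X assume "X \<in> carrier (quot_module M N)"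
    then obtain x where x: "x \<in> carrier M" "X = N +>\<^bsub>M\<^esub> x" by (auto simp: quot_module_carrier)
    then show "quot_lift f X \<in> carrier U" by (simp add: q linear_maps_closed[OF assms(4)])
    show "quot_lift f (X \<oplus>\<^bsub>quot_module M N\<^esub> Y) = quot_lift f X \<oplus>\<^bsub>U\<^esub> quot_lift f Y"
      if Y: "Y \<in> carrier (quot_module M N)" for Y
    proof -
      obtain y where "y \<in> carrier M" "Y = N +>\<^bsub>M\<^esub> y" using Y by (auto simp: quot_module_carrier)
      then show ?thesis using x by (simp add: coset_add[OF assms(1,2)] q linear_maps_add[OF assms(4)])
    qed
    show "quot_lift f (c \<odot>\<^bsub>quot_module M N\<^esub> X) = c \<odot>\<^bsub>U\<^esub> quot_lift f X" if "c \<in> carrier K" for c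
      using x that by (simp add: coset_smult[OF assms(1,2)] q linear_maps_smult[OF assms(4)])
  qed
qed

lemma module_span:
  assumes "module K M" "X \<subseteq> carrier M"
  shows "submodule (module_span K M X) K M" "X \<subseteq> module_span K M X"
proof -
  interpret M: module K M by fact
  have c: "submodule (carrier M) K M" by (rule M.carrier_is_submodule)
  show "X \<subseteq> module_span K M X" by (auto simp: module_span_def)
  show "submodule (module_span K M X) K M"
  proof (rule M.submoduleI)
    show "module_span K M X \<subseteq> carrier M" using c assms by (auto simp: module_span_def)
    show "\<zero>\<^bsub>M\<^esub> \<in> module_span K M X"
      by (auto simp: module_span_def submodule_def dest: subgroup.one_closed)
  qed (auto simp: module_span_def dest: M.submoduleE)
qed

lemma module_span_minimal:
  "submodule N K M \<Longrightarrow> X \<subseteq> N \<Longrightarrow> module_span K M X \<subseteq> N"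
  by (auto simp: module_span_def)

section \<open>Free modules\<close>

lemma free_module_simps [simp]:
  "zero (free_module K B) = (\<lambda>s. \<zero>\<^bsub>K\<^esub>)" "add (free_module K B) = (\<lambda>f g s. f s \<oplus>\<^bsub>K\<^esub> g s)"
  "smult (free_module K B) = (\<lambda>c f s. c \<otimes>\<^bsub>K\<^esub> f s)"
  by (auto simp: free_module_def)

lemma free_module_carrier:
  "f \<in> carrier (free_module K B) \<longleftrightarrow>
    (\<forall>s. f s \<in> carrier K) \<and> finite {s. f s \<noteq> \<zero>\<^bsub>K\<^esub>} \<and> {s. f s \<noteq> \<zero>\<^bsub>K\<^esub>} \<subseteq> B"
  by (auto simp: free_module_def)

lemma module_free_module:
  assumes "cring K"
  shows "module K (free_module K B)"
proof -
  interpret cring K by fact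
  have add: "(\<lambda>s. f s \<oplus>\<^bsub>K\<^esub> g s) \<in> carrier (free_module K B)"
    if "f \<in> carrier (free_module K B)" "g \<in> carrier (free_module K B)" for f g
  proof -
    have "{s. f s \<oplus>\<^bsub>K\<^esub> g s \<noteq> \<zero>\<^bsub>K\<^esub>} \<subseteq> {s. f s \<noteq> \<zero>\<^bsub>K\<^esub>} \<union> {s. g s \<noteq> \<zero>\<^bsub>K\<^esub>}" by auto
    moreover have "finite ({s. f s \<noteq> \<zero>\<^bsub>K\<^esub>} \<union> {s. g s \<noteq> \<zero>\<^bsub>K\<^esub>})"
      using that by (auto simp: free_module_carrier)
    ultimately show ?thesis using that unfolding free_module_carrier
      by (auto intro: finite_subset)
  qed
  have smult: "(\<lambda>s. c \<otimes>\<^bsub>K\<^esub> f s) \<in> carrier (free_module K B)"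
    if "c \<in> carrier K" "f \<in> carrier (free_module K B)" for c f
  proof -
    have "{s. c \<otimes>\<^bsub>K\<^esub> f s \<noteq> \<zero>\<^bsub>K\<^esub>} \<subseteq> {s. f s \<noteq> \<zero>\<^bsub>K\<^esub>}" using that by auto
    then show ?thesis using that unfolding free_module_carrier by (auto intro: finite_subset)
  qed
  have minus: "(\<lambda>s. \<ominus>\<^bsub>K\<^esub> f s) \<in> carrier (free_module K B)"
    if "f \<in> carrier (free_module K B)" for f
  proof -
    have "{s. \<ominus>\<^bsub>K\<^esub> f s \<noteq> \<zero>\<^bsub>K\<^esub>} \<subseteq> {s. f s \<noteq> \<zero>\<^bsub>K\<^esub>}" using that by auto
    then show ?thesis using that unfolding free_module_carrier by (auto intro: finite_subset)
  qed
  have "abelian_group (free_module K B)"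
  proof (rule abelian_groupI)
    fix f assume f: "f \<in> carrier (free_module K B)"
    then have "(\<lambda>s. \<ominus>\<^bsub>K\<^esub> f s) \<oplus>\<^bsub>free_module K B\<^esub> f = \<zero>\<^bsub>free_module K B\<^esub>"
      by (auto simp: free_module_carrier l_neg)
    with minus[OF f]
    show "\<exists>y\<in>carrier (free_module K B). y \<oplus>\<^bsub>free_module K B\<^esub> f = \<zero>\<^bsub>free_module K B\<^esub>" by blast
  next
    show "\<zero>\<^bsub>free_module K B\<^esub> \<in> carrier (free_module K B)" by (auto simp: free_module_carrier)
  qed (use add in simp, auto simp: free_module_carrier a_ac)
  then show ?thesis
    by (rule moduleI[OF is_cring]) (simp_all add: smult, auto simp: free_module_carrier l_distr r_distr m_assoc)
qed

lemma basis_elem_closed: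
  assumes "cring K" "s \<in> B"
  shows "basis_elem K s \<in> carrier (free_module K B)"
proof -
  interpret cring K by fact
  show ?thesis using assms(2) by (auto simp: free_module_carrier basis_elem_def)
qed

text \<open>Enlarging the range of summation lets the sums for two different elements be compared, as the proof of
linearity requires.\<close>

lemma free_extend_superset:
  assumes "module K U" "x \<in> carrier (free_module K B)" "f \<in> B \<rightarrow> carrier U"
    and "finite A" "{s. x s \<noteq> \<zero>\<^bsub>K\<^esub>} \<subseteq> A" "A \<subseteq> B"
  shows "free_extend K U f x = (\<Oplus>\<^bsub>U\<^esub>s\<in>A. x s \<odot>\<^bsub>U\<^esub> f s)"
proof -
  interpret U: module K U by fact
  show ?thesis unfolding free_extend_def
    by (rule U.add.finprod_mono_neutral_cong_left)
      (use assms in \<open>auto simp: free_module_carrier Pi_def\<close>)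
qed

lemma free_extend_closed:
  assumes "module K U" "x \<in> carrier (free_module K B)" "f \<in> B \<rightarrow> carrier U"
  shows "free_extend K U f x \<in> carrier U"
proof -
  interpret U: module K U by fact
  show ?thesis unfolding free_extend_def
    by (rule U.finsum_closed) (use assms in \<open>auto simp: free_module_carrier Pi_def\<close>)
qed

lemma linear_free_extend:
  assumes "module K U" "f \<in> B \<rightarrow> carrier U"
  shows "free_extend K U f \<in> linear_maps K (free_module K B) U"
proof -
  interpret U: module K U by fact
  interpret F: module K "free_module K B" by (rule module_free_module) (rule U.is_cring)
  show ?thesis
  proof (rule linear_mapsI)
    fix x assume x: "x \<in> carrier (free_module K B)"
    then show "free_extend K U f x \<in> carrier U" by (rule free_extend_closed[OF assms(1) _ assms(2)])
    {
      fix y assume y: "y \<in> carrier (free_module K B)"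
      let ?A = "{s. x s \<noteq> \<zero>\<^bsub>K\<^esub>} \<union> {s. y s \<noteq> \<zero>\<^bsub>K\<^esub>}"
      have A: "finite ?A" "?A \<subseteq> B" using x y by (auto simp: free_module_carrier)
      have xy: "x \<oplus>\<^bsub>free_module K B\<^esub> y \<in> carrier (free_module K B)" using x y by (rule F.M.a_closed)
      have s: "{s. (x \<oplus>\<^bsub>free_module K B\<^esub> y) s \<noteq> \<zero>\<^bsub>K\<^esub>} \<subseteq> ?A" by auto
      have "free_extend K U f (x \<oplus>\<^bsub>free_module K B\<^esub> y)
        = (\<Oplus>\<^bsub>U\<^esub>s\<in>?A. (x \<oplus>\<^bsub>free_module K B\<^esub> y) s \<odot>\<^bsub>U\<^esub> f s)"
        by (rule free_extend_superset[OF assms(1) xy assms(2) A(1) s A(2)])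
      also have "\<dots> = (\<Oplus>\<^bsub>U\<^esub>s\<in>?A. x s \<odot>\<^bsub>U\<^esub> f s \<oplus>\<^bsub>U\<^esub> y s \<odot>\<^bsub>U\<^esub> f s)"
        by (rule U.finsum_cong') (use x y A assms(2) in \<open>auto simp: U.smult_l_distr free_module_carrier Pi_def\<close>)
      also have "\<dots> = (\<Oplus>\<^bsub>U\<^esub>s\<in>?A. x s \<odot>\<^bsub>U\<^esub> f s) \<oplus>\<^bsub>U\<^esub> (\<Oplus>\<^bsub>U\<^esub>s\<in>?A. y s \<odot>\<^bsub>U\<^esub> f s)"
        by (rule U.finsum_addf) (use x y A assms(2) in \<open>auto simp: free_module_carrier Pi_def\<close>)
      also have "\<dots> = free_extend K U f x \<oplus>\<^bsub>U\<^esub> free_extend K U f y"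
        using free_extend_superset[OF assms(1) x assms(2) A(1) _ A(2)]
          free_extend_superset[OF assms(1) y assms(2) A(1) _ A(2)] by auto
      finally show "free_extend K U f (x \<oplus>\<^bsub>free_module K B\<^esub> y)
        = free_extend K U f x \<oplus>\<^bsub>U\<^esub> free_extend K U f y" .
    }
    fix c assume c: "c \<in> carrier K"
    let ?A = "{s. x s \<noteq> \<zero>\<^bsub>K\<^esub>}"
    have A: "finite ?A" "?A \<subseteq> B" using x by (auto simp: free_module_carrier)
    have cx: "c \<odot>\<^bsub>free_module K B\<^esub> x \<in> carrier (free_module K B)" using c x by (rule F.smult_closed)
    have s: "{s. (c \<odot>\<^bsub>free_module K B\<^esub> x) s \<noteq> \<zero>\<^bsub>K\<^esub>} \<subseteq> ?A" using c by auto
    have "free_extend K U f (c \<odot>\<^bsub>free_module K B\<^esub> x) = (\<Oplus>\<^bsub>U\<^esub>s\<in>?A. (c \<odot>\<^bsub>free_module K B\<^esub> x) s \<odot>\<^bsub>U\<^esub> f s)"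
      by (rule free_extend_superset[OF assms(1) cx assms(2) A(1) s A(2)])
    also have "\<dots> = (\<Oplus>\<^bsub>U\<^esub>s\<in>?A. c \<odot>\<^bsub>U\<^esub> (x s \<odot>\<^bsub>U\<^esub> f s))"
      by (rule U.finsum_cong') (use c x A assms(2) in \<open>auto simp: U.smult_assoc1 free_module_carrier Pi_def\<close>)
    also have "\<dots> = c \<odot>\<^bsub>U\<^esub> free_extend K U f x"
      unfolding free_extend_def
      by (rule U.finsum_smult_ldistr[symmetric]) (use c x A assms(2) in \<open>auto simp: free_module_carrier Pi_def\<close>)
    finally show "free_extend K U f (c \<odot>\<^bsub>free_module K B\<^esub> x) = c \<odot>\<^bsub>U\<^esub> free_extend K U f x" .
  qed
qed

lemma free_extend_basis:
  assumes "module K U" "s \<in> B" "f \<in> B \<rightarrow> carrier U"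
  shows "free_extend K U f (basis_elem K s) = f s"
proof -
  interpret U: module K U by fact
  have "free_extend K U f (basis_elem K s) = (\<Oplus>\<^bsub>U\<^esub>t\<in>{s}. basis_elem K s t \<odot>\<^bsub>U\<^esub> f t)"
    by (rule free_extend_superset[OF assms(1) basis_elem_closed[OF U.is_cring assms(2)] assms(3)])
      (use assms in \<open>auto simp: basis_elem_def\<close>)
  also have "\<dots> = f s" using assms by (auto simp: basis_elem_def Pi_def)
  finally show ?thesis .
qed

text \<open>This reduces statements about linear maps on a free module to statements about the basis.\<close>

lemma free_extend_basis_elem:
  assumes "cring K" "x \<in> carrier (free_module K B)"
  shows "free_extend K (free_module K B) (basis_elem K) x = x"
proof
  fix t
  interpret cring K by fact
  let ?F = "free_module K B"
  interpret F: module K ?F by (rule module_free_module) fact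
  let ?A = "{s. x s \<noteq> \<zero>\<^bsub>K\<^esub>}"
  have A: "finite ?A" "?A \<subseteq> B" and xc: "\<And>s. x s \<in> carrier K" using assms by (auto simp: free_module_carrier)
  have "(\<Oplus>\<^bsub>?F\<^esub>s\<in>C. x s \<odot>\<^bsub>?F\<^esub> basis_elem K s) t = (if t \<in> C then x t else \<zero>\<^bsub>K\<^esub>)"
    if "finite C" "C \<subseteq> B" for C
    using that
  proof (induction C)
    case empty
    have "(\<Oplus>\<^bsub>?F\<^esub>s\<in>{}. x s \<odot>\<^bsub>?F\<^esub> basis_elem K s) = \<zero>\<^bsub>?F\<^esub>" by (rule F.finsum_empty)
    then show ?case by simp
  next
    case (insert a C)
    have "(\<Oplus>\<^bsub>?F\<^esub>s\<in>insert a C. x s \<odot>\<^bsub>?F\<^esub> basis_elem K s)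
      = x a \<odot>\<^bsub>?F\<^esub> basis_elem K a \<oplus>\<^bsub>?F\<^esub> (\<Oplus>\<^bsub>?F\<^esub>s\<in>C. x s \<odot>\<^bsub>?F\<^esub> basis_elem K s)"
      by (rule F.finsum_insert) (use insert xc basis_elem_closed[OF assms(1), of _ B] F.smult_closed in auto)
    then show ?case using insert xc by (auto simp: basis_elem_def)
  qed
  from this[OF A] show "free_extend K ?F (basis_elem K) x t = x t"
    by (auto simp: free_extend_def)
qed

lemma linear_eq_free_extend:
  assumes "module K U" "g \<in> linear_maps K (free_module K B) U" "x \<in> carrier (free_module K B)"
  shows "g x = free_extend K U (\<lambda>s. g (basis_elem K s)) x"
proof -
  interpret U: module K U by fact
  let ?F = "free_module K B"
  interpret F: module K ?F by (rule module_free_module) (rule U.is_cring)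
  have "g x = g (free_extend K ?F (basis_elem K) x)"
    using free_extend_basis_elem[OF U.is_cring assms(3)] by simp
  also have "\<dots> = (\<Oplus>\<^bsub>U\<^esub>s\<in>{s. x s \<noteq> \<zero>\<^bsub>K\<^esub>}. g (x s \<odot>\<^bsub>?F\<^esub> basis_elem K s))"
    unfolding free_extend_def
    by (rule linear_maps_finsum[OF F.module_axioms assms(1,2)])
      (use assms(3) basis_elem_closed[OF U.is_cring, of _ B] F.smult_closed in \<open>auto simp: free_module_carrier\<close>)
  also have "\<dots> = free_extend K U (\<lambda>s. g (basis_elem K s)) x"
    unfolding free_extend_def
    by (rule U.finsum_cong') (use assms(3) linear_maps_smult[OF assms(2)] linear_maps_closed[OF assms(2)]
       basis_elem_closed[OF U.is_cring, of _ B] in \<open>auto simp: free_module_carrier Pi_def simp del: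
         free_module_simps\<close>)
  finally show ?thesis .
qed

lemma linear_eq_on_basis:
  assumes "module K U" "f \<in> linear_maps K (free_module K B) U" "g \<in> linear_maps K (free_module K B) U"
    and "\<And>s. s \<in> B \<Longrightarrow> f (basis_elem K s) = g (basis_elem K s)" "x \<in> carrier (free_module K B)"
  shows "f x = g x"
proof -
  interpret U: module K U by fact
  have "free_extend K U (\<lambda>s. f (basis_elem K s)) x = free_extend K U (\<lambda>s. g (basis_elem K s)) x"
    unfolding free_extend_def
    by (rule U.finsum_cong') (use assms(4,5) linear_maps_closed[OF assms(3)]
       basis_elem_closed[OF U.is_cring, of _ B] in \<open>auto simp: free_module_carrier Pi_def\<close>)
  then show ?thesis using linear_eq_free_extend[OF assms(1,2,5)] linear_eq_free_extend[OF assms(1,3,5)] by simp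
qed

section \<open>Tensor products\<close>

text \<open>\<open>tensor_prod\<close> and \<open>free_algebra\<close> are obtained from modules by overwriting the fields of the
product and the unit, which module theory does not see.\<close>

lemma module_same_fields:
  fixes M M' :: "('k, 'a) module"
  assumes "module K M" "carrier M' = carrier M" "add M' = add M" "zero M' = zero M" "smult M' = smult M"
  shows "module K M'"
proof -
  interpret M: module K M by fact
  have "abelian_group M'"
    by (rule comm_group_abelian_groupI) (use M.a_comm_group assms(2-) in simp)
  then show ?thesis
    by (rule moduleI[OF M.is_cring]) (auto simp: assms M.smult_l_distr M.smult_r_distr M.smult_assoc1)
qed

lemma tensor_prod_simps:
  "carrier (tensor_prod K V W) = carrier (tensor_module K V W)"
  "add (tensor_prod K V W) = add (tensor_module K V W)"
  "zero (tensor_prod K V W) = zero (tensor_module K V W)"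
  "smult (tensor_prod K V W) = smult (tensor_module K V W)"
  "one (tensor_prod K V W) = pure_tensor K V W \<one>\<^bsub>V\<^esub> \<one>\<^bsub>W\<^esub>"
  by (simp_all add: tensor_prod_def Let_def)

lemma tensor_lift_tensor_prod:
  "tensor_lift K (tensor_module K V W) = tensor_lift K (tensor_prod K V W)"
  by (simp add: tensor_lift_def free_extend_def tensor_prod_simps finsum_def fun_eq_iff)

lemma mult_tensor_prod:
  "s \<otimes>\<^bsub>tensor_prod K A B\<^esub> t = tensor_lift K (tensor_prod K A B) (\<lambda>a b.
     tensor_lift K (tensor_prod K A B) (\<lambda>c d. pure_tensor K A B (a \<otimes>\<^bsub>A\<^esub> c) (b \<otimes>\<^bsub>B\<^esub> d)) t) s"
proof -
  have "s \<otimes>\<^bsub>tensor_prod K A B\<^esub> t = tensor_lift K (tensor_module K A B) (\<lambda>a b.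
     tensor_lift K (tensor_module K A B) (\<lambda>c d. pure_tensor K A B (a \<otimes>\<^bsub>A\<^esub> c) (b \<otimes>\<^bsub>B\<^esub> d)) t) s"
    by (simp add: tensor_prod_def Let_def)
  then show ?thesis by (simp only: tensor_lift_tensor_prod)
qed

definition bilinear_maps ::
    "'k ring \<Rightarrow> ('k, 'a) module \<Rightarrow> ('k, 'b) module \<Rightarrow> ('k, 'u) module \<Rightarrow> ('a \<Rightarrow> 'b \<Rightarrow> 'u) set" where
  "bilinear_maps K V W U = {f. (\<forall>b\<in>carrier W. (\<lambda>a. f a b) \<in> linear_maps K V U) \<and>
     (\<forall>a\<in>carrier V. (\<lambda>b. f a b) \<in> linear_maps K W U)}"

lemma bilinear_mapsI:
  assumes "\<And>b. b \<in> carrier W \<Longrightarrow> (\<lambda>a. f a b) \<in> linear_maps K V U"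
    and "\<And>a. a \<in> carrier V \<Longrightarrow> (\<lambda>b. f a b) \<in> linear_maps K W U"
  shows "f \<in> bilinear_maps K V W U"
  using assms by (auto simp: bilinear_maps_def)

lemma bilinear_mapsD:
  assumes "f \<in> bilinear_maps K V W U"
  shows "b \<in> carrier W \<Longrightarrow> (\<lambda>a. f a b) \<in> linear_maps K V U"
    and "a \<in> carrier V \<Longrightarrow> (\<lambda>b. f a b) \<in> linear_maps K W U"
  using assms by (auto simp: bilinear_maps_def)

lemma bilinear_maps_closed:
  "f \<in> bilinear_maps K V W U \<Longrightarrow> a \<in> carrier V \<Longrightarrow> b \<in> carrier W \<Longrightarrow> f a b \<in> carrier U"
  using linear_maps_closed[OF bilinear_mapsD(1)] .

lemma bilinear_kernel_submodule:
  assumes "module K V" "module K W"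
  shows "submodule (bilinear_kernel K V W) K (free_module K (carrier V \<times> carrier W))"
    and "bilinear_relations K V W \<subseteq> bilinear_kernel K V W"
proof -
  interpret V: module K V by fact
  interpret W: module K W by fact
  let ?F = "free_module K (carrier V \<times> carrier W)"
  have F: "module K ?F" by (rule module_free_module) (rule V.is_cring)
  interpret F: module K ?F by (rule F)
  have e: "basis_elem K (a, b) \<in> carrier ?F" if "a \<in> carrier V" "b \<in> carrier W" for a b
    by (rule basis_elem_closed) (use V.is_cring that in auto)
  have "bilinear_relations K V W \<subseteq> carrier ?F"
    unfolding bilinear_relations_def Let_def
    by (intro Un_least subsetI; elim CollectE exE conjE; hypsubst; intro F.M.minus_closed e F.smult_closed; simp)
  from module_span[OF F this]
  show "submodule (bilinear_kernel K V W) K ?F" "bilinear_relations K V W \<subseteq> bilinear_kernel K V W"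
    by (simp_all only: bilinear_kernel_def)
qed

lemma module_tensor_prod:
  assumes "module K V" "module K W"
  shows "module K (tensor_prod K V W)"
proof -
  interpret V: module K V by fact
  have "module K (tensor_module K V W)" unfolding tensor_module_def
    by (rule module_quot_module[OF module_free_module bilinear_kernel_submodule(1)[OF assms]]) (rule V.is_cring)
  then show ?thesis by (rule module_same_fields) (simp_all add: tensor_prod_simps)
qed

text \<open>The kernel of the linear extension of \<open>f\<close> is a submodule, and bilinearity says precisely that it
contains the generators of \<open>bilinear_kernel\<close>.\<close>

lemma free_extend_bilinear_kernel:
  assumes "module K V" "module K W" "module K U" "f \<in> bilinear_maps K V W U"
    and "x \<in> bilinear_kernel K V W"
  shows "free_extend K U (\<lambda>(a, b). f a b) x = \<zero>\<^bsub>U\<^esub>"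
proof -
  interpret V: module K V by fact
  interpret W: module K W by fact
  interpret U: module K U by fact
  let ?F = "free_module K (carrier V \<times> carrier W)" and ?g = "free_extend K U (\<lambda>(a, b). f a b)"
  have F: "module K ?F" by (rule module_free_module) (rule V.is_cring)
  interpret F: module K ?F by (rule F)
  have f: "(\<lambda>(a, b). f a b) \<in> carrier V \<times> carrier W \<rightarrow> carrier U"
    using bilinear_maps_closed[OF assms(4)] by auto
  have g: "?g \<in> linear_maps K ?F U" by (rule linear_free_extend[OF assms(3) f])
  have e: "basis_elem K (a, b) \<in> carrier ?F" if "a \<in> carrier V" "b \<in> carrier W" for a b
    by (rule basis_elem_closed) (use V.is_cring that in auto)
  have ge: "?g (basis_elem K (a, b)) = f a b" if "a \<in> carrier V" "b \<in> carrier W" for a b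
    using free_extend_basis[OF assms(3) _ f, of "(a,b)"] that by auto
  note gm = linear_maps_minus[OF F assms(3) g] linear_maps_smult[OF g]
  have fc: "f a b \<in> carrier U" if "a \<in> carrier V" "b \<in> carrier W" for a b
    using bilinear_maps_closed[OF assms(4)] that by auto
  note fl = linear_maps_add[OF bilinear_mapsD(1)[OF assms(4)]] linear_maps_add[OF bilinear_mapsD(2)[OF assms(4)]]
    linear_maps_smult[OF bilinear_mapsD(1)[OF assms(4)]] linear_maps_smult[OF bilinear_mapsD(2)[OF assms(4)]]
  have c: "u \<oplus>\<^bsub>U\<^esub> v \<ominus>\<^bsub>U\<^esub> u \<ominus>\<^bsub>U\<^esub> v = \<zero>\<^bsub>U\<^esub>" if "u \<in> carrier U" "v \<in> carrier U" for u v
    using that by (simp add: a_minus_def U.M.a_assoc U.M.a_comm[of v] U.M.r_neg2 U.M.r_neg)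
  have c': "u \<ominus>\<^bsub>U\<^esub> u = \<zero>\<^bsub>U\<^esub>" if "u \<in> carrier U" for u
    using that by (simp_all add: a_minus_def U.M.r_neg)
  have "bilinear_relations K V W \<subseteq> {x \<in> carrier ?F. ?g x = \<zero>\<^bsub>U\<^esub>}"
    unfolding bilinear_relations_def Let_def
    by (intro Un_least subsetI; elim CollectE exE conjE; hypsubst)
      (simp_all del: free_module_simps add: gm ge e fc fl c c')
  then have "bilinear_kernel K V W \<subseteq> {x \<in> carrier ?F. ?g x = \<zero>\<^bsub>U\<^esub>}"
    unfolding bilinear_kernel_def by (rule module_span_minimal[OF kernel_submodule[OF F assms(3) g]])
  then show ?thesis using assms(5) by auto
qed

lemma tensor_rep:
  assumes "module K V" "module K W" "t \<in> carrier (tensor_prod K V W)"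
  shows "(SOME x. x \<in> t) \<in> carrier (free_module K (carrier V \<times> carrier W))"
    and "bilinear_kernel K V W +>\<^bsub>free_module K (carrier V \<times> carrier W)\<^esub> (SOME x. x \<in> t) = t"
proof -
  interpret V: module K V by fact
  let ?F = "free_module K (carrier V \<times> carrier W)"
  have F: "module K ?F" by (rule module_free_module) (rule V.is_cring)
  note S = bilinear_kernel_submodule(1)[OF assms(1,2)]
  interpret N: abelian_subgroup "bilinear_kernel K V W" ?F by (rule submodule_abelian_subgroup[OF F S])
  obtain x where x: "x \<in> carrier ?F" "t = bilinear_kernel K V W +>\<^bsub>?F\<^esub> x"
    using assms(3) by (auto simp: tensor_prod_simps tensor_module_def quot_module_carrier)
  then have "x \<in> t" using N.a_rcos_self by simp
  then have "(SOME x. x \<in> t) \<in> t" by (rule someI[of "\<lambda>x. x \<in> t"])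
  from coset_elem[OF F S x(1) this[unfolded x(2)]]
  show "(SOME x. x \<in> t) \<in> carrier ?F" "bilinear_kernel K V W +>\<^bsub>?F\<^esub> (SOME x. x \<in> t) = t"
    by (simp_all only: x(2))
qed

lemma tensor_lift_closed:
  assumes "module K V" "module K W" "module K U" "t \<in> carrier (tensor_prod K V W)"
    and "\<And>a b. a \<in> carrier V \<Longrightarrow> b \<in> carrier W \<Longrightarrow> f a b \<in> carrier U"
  shows "tensor_lift K U f t \<in> carrier U"
  unfolding tensor_lift_def
  by (rule free_extend_closed[OF assms(3) tensor_rep(1)[OF assms(1,2,4)]]) (use assms(5) in auto)

lemma tensor_lift_cong:
  assumes "module K V" "module K W" "module K U" "t \<in> carrier (tensor_prod K V W)"
    and "\<And>a b. a \<in> carrier V \<Longrightarrow> b \<in> carrier W \<Longrightarrow> f a b = g a b"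
    and "\<And>a b. a \<in> carrier V \<Longrightarrow> b \<in> carrier W \<Longrightarrow> g a b \<in> carrier U"
  shows "tensor_lift K U f t = tensor_lift K U g t"
proof -
  interpret U: module K U by fact
  show ?thesis unfolding tensor_lift_def free_extend_def
    by (rule U.finsum_cong') (use tensor_rep(1)[OF assms(1,2,4)] assms(5,6) in \<open>auto simp: free_module_carrier\<close>)
qed

text \<open>The universal property of the tensor product: the value does not depend on the representative.\<close>

lemma tensor_lift_coset:
  assumes "module K V" "module K W" "module K U" "f \<in> bilinear_maps K V W U"
    and "x \<in> carrier (free_module K (carrier V \<times> carrier W))"
  shows "tensor_lift K U f (bilinear_kernel K V W +>\<^bsub>free_module K (carrier V \<times> carrier W)\<^esub> x)
    = free_extend K U (\<lambda>(a, b). f a b) x"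
proof -
  interpret V: module K V by fact
  have f: "(\<lambda>(a, b). f a b) \<in> carrier V \<times> carrier W \<rightarrow> carrier U"
    using bilinear_maps_closed[OF assms(4)] by auto
  show ?thesis
    using quot_lift_coset[OF module_free_module[OF V.is_cring] bilinear_kernel_submodule(1)[OF assms(1,2)] assms(3)
       linear_free_extend[OF assms(3) f] free_extend_bilinear_kernel[OF assms(1-4)] assms(5)]
    by (simp add: tensor_lift_def quot_lift_def)
qed

lemma linear_tensor_lift:
  assumes "module K V" "module K W" "module K U" "f \<in> bilinear_maps K V W U"
  shows "tensor_lift K U f \<in> linear_maps K (tensor_prod K V W) U"
proof -
  interpret V: module K V by fact
  have f: "(\<lambda>(a, b). f a b) \<in> carrier V \<times> carrier W \<rightarrow> carrier U"
    using bilinear_maps_closed[OF assms(4)] by auto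
  have "quot_lift (free_extend K U (\<lambda>(a, b). f a b)) \<in> linear_maps K (tensor_module K V W) U"
    unfolding tensor_module_def
    by (rule linear_quot_lift[OF module_free_module[OF V.is_cring] bilinear_kernel_submodule(1)[OF assms(1,2)]
      assms(3)
       linear_free_extend[OF assms(3) f] free_extend_bilinear_kernel[OF assms(1-4)]])
  moreover have "quot_lift (free_extend K U (\<lambda>(a, b). f a b)) = tensor_lift K U f"
    by (simp add: tensor_lift_def quot_lift_def fun_eq_iff)
  ultimately show ?thesis by (simp add: linear_maps_def tensor_prod_simps)
qed

lemma tensor_lift_pure:
  assumes "module K V" "module K W" "module K U" "f \<in> bilinear_maps K V W U" "a \<in> carrier V" "b \<in> carrier W"
  shows "tensor_lift K U f (pure_tensor K V W a b) = f a b"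
proof -
  interpret V: module K V by fact
  have f: "(\<lambda>(a, b). f a b) \<in> carrier V \<times> carrier W \<rightarrow> carrier U"
    using bilinear_maps_closed[OF assms(4)] by auto
  show ?thesis unfolding pure_tensor_def
    using tensor_lift_coset[OF assms(1-4) basis_elem_closed[OF V.is_cring, of "(a, b)"]]
      free_extend_basis[OF assms(3) _ f, of "(a, b)"] assms(5,6) by simp
qed

text \<open>Each law is one of the generating relations of \<open>bilinear_kernel\<close>, read modulo that kernel.\<close>

lemma bilinear_pure_tensor:
  assumes "module K V" "module K W"
  shows "pure_tensor K V W \<in> bilinear_maps K V W (tensor_prod K V W)"
proof -
  interpret V: module K V by fact
  interpret W: module K W by fact
  let ?F = "free_module K (carrier V \<times> carrier W)" and ?N = "bilinear_kernel K V W"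
  have F: "module K ?F" by (rule module_free_module) (rule V.is_cring)
  interpret F: module K ?F by (rule F)
  note S = bilinear_kernel_submodule(1)[OF assms]
  have e: "basis_elem K (a, b) \<in> carrier ?F" if "a \<in> carrier V" "b \<in> carrier W" for a b
    by (rule basis_elem_closed) (use V.is_cring that in auto)
  have cl: "pure_tensor K V W a b \<in> carrier (tensor_prod K V W)" if "a \<in> carrier V" "b \<in> carrier W" for a b
    using e[OF that] by (auto simp: pure_tensor_def tensor_prod_simps tensor_module_def quot_module_carrier)
  have add: "pure_tensor K V W a b \<oplus>\<^bsub>tensor_prod K V W\<^esub> pure_tensor K V W a' b' = pure_tensor K V W a'' b''"
    if "a \<in> carrier V" "b \<in> carrier W" "a' \<in> carrier V" "b' \<in> carrier W" "a'' \<in> carrier V" "b'' \<in> carrier W"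
      and r: "basis_elem K (a'', b'') \<ominus>\<^bsub>?F\<^esub> basis_elem K (a, b) \<ominus>\<^bsub>?F\<^esub> basis_elem K (a', b') \<in> bilinear_relations K V W"
    for a b a' b' a'' b''
  proof -
    note e' = e[OF that(1,2)] e[OF that(3,4)] e[OF that(5,6)]
    have "basis_elem K (a'', b'') \<ominus>\<^bsub>?F\<^esub> (basis_elem K (a, b) \<oplus>\<^bsub>?F\<^esub> basis_elem K (a', b'))
      = basis_elem K (a'', b'') \<ominus>\<^bsub>?F\<^esub> basis_elem K (a, b) \<ominus>\<^bsub>?F\<^esub> basis_elem K (a', b')"
      using e' by (simp del: free_module_simps add: a_minus_def F.M.minus_add F.M.a_assoc)
    then have "basis_elem K (a'', b'') \<ominus>\<^bsub>?F\<^esub> (basis_elem K (a, b) \<oplus>\<^bsub>?F\<^esub> basis_elem K (a', b')) \<in> ?N"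
      using r bilinear_kernel_submodule(2)[OF assms] by auto
    then show ?thesis
      using e' coset_add[OF F S e'(1,2)] coset_eq_iff[OF F S e'(3) F.M.a_closed[OF e'(1,2)]]
      by (simp add: pure_tensor_def tensor_prod_simps tensor_module_def)
  qed
  have smult: "c \<odot>\<^bsub>tensor_prod K V W\<^esub> pure_tensor K V W a b = pure_tensor K V W a' b'"
    if "c \<in> carrier K" "a \<in> carrier V" "b \<in> carrier W" "a' \<in> carrier V" "b' \<in> carrier W"
      and r: "basis_elem K (a', b') \<ominus>\<^bsub>?F\<^esub> (c \<odot>\<^bsub>?F\<^esub> basis_elem K (a, b)) \<in> bilinear_relations K V W"
    for c a b a' b'
  proof -
    note e' = e[OF that(2,3)] e[OF that(4,5)]
    have "basis_elem K (a', b') \<ominus>\<^bsub>?F\<^esub> (c \<odot>\<^bsub>?F\<^esub> basis_elem K (a, b)) \<in> ?N"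
      using r bilinear_kernel_submodule(2)[OF assms] by auto
    then show ?thesis
      using coset_smult[OF F S e'(1) that(1)] coset_eq_iff[OF F S e'(2) F.smult_closed[OF that(1) e'(1)]]
      by (simp add: pure_tensor_def tensor_prod_simps tensor_module_def)
  qed
  show ?thesis
  proof (rule bilinear_mapsI; rule linear_mapsI)
    fix a b assume ab: "a \<in> carrier V" "b \<in> carrier W"
    show cab: "pure_tensor K V W a b \<in> carrier (tensor_prod K V W)" by (rule cl[OF ab])
    show "pure_tensor K V W a b \<in> carrier (tensor_prod K V W)" by (rule cab)
    show "pure_tensor K V W (a \<oplus>\<^bsub>V\<^esub> a') b = pure_tensor K V W a b \<oplus>\<^bsub>tensor_prod K V W\<^esub> pure_tensor K V W a' b"
      if "a' \<in> carrier V" for a'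
      by (rule add[symmetric]) (use ab that in \<open>auto simp: bilinear_relations_def Let_def\<close>)
    show "pure_tensor K V W a (b \<oplus>\<^bsub>W\<^esub> b') = pure_tensor K V W a b \<oplus>\<^bsub>tensor_prod K V W\<^esub> pure_tensor K V W a b'"
      if "b' \<in> carrier W" for b'
      by (rule add[symmetric]) (use ab that in \<open>auto simp: bilinear_relations_def Let_def\<close>)
    fix c assume c: "c \<in> carrier K"
    show "pure_tensor K V W (c \<odot>\<^bsub>V\<^esub> a) b = c \<odot>\<^bsub>tensor_prod K V W\<^esub> pure_tensor K V W a b"
      by (rule smult[symmetric]) (use ab c in \<open>auto simp: bilinear_relations_def Let_def simp del: free_module_simps\<close>)
    show "pure_tensor K V W a (c \<odot>\<^bsub>W\<^esub> b) = c \<odot>\<^bsub>tensor_prod K V W\<^esub> pure_tensor K V W a b"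
      by (rule smult[symmetric]) (use ab c in \<open>auto simp: bilinear_relations_def Let_def simp del: free_module_simps\<close>)
  qed
qed

text \<open>The chosen representative of \<open>t\<close> makes the left-hand side \<open>g\<close> of a finite linear combination of values of \<open>f\<close>.\<close>

lemma linear_tensor_lift_comp:
  assumes "module K V" "module K W" "module K U" "module K U'" "g \<in> linear_maps K U U'"
    and "t \<in> carrier (tensor_prod K V W)"
    and "\<And>a b. a \<in> carrier V \<Longrightarrow> b \<in> carrier W \<Longrightarrow> f a b \<in> carrier U"
  shows "g (tensor_lift K U f t) = tensor_lift K U' (\<lambda>a b. g (f a b)) t"
proof -
  interpret U: module K U by fact
  interpret U': module K U' by fact
  let ?x = "SOME x. x \<in> t" let ?A = "{s. ?x s \<noteq> \<zero>\<^bsub>K\<^esub>}"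
  have x: "\<And>s. ?x s \<in> carrier K" "finite ?A" "?A \<subseteq> carrier V \<times> carrier W"
    using tensor_rep(1)[OF assms(1,2,6)] by (auto simp: free_module_carrier)
  have "g (\<Oplus>\<^bsub>U\<^esub>s\<in>?A. ?x s \<odot>\<^bsub>U\<^esub> (\<lambda>(a, b). f a b) s) = (\<Oplus>\<^bsub>U'\<^esub>s\<in>?A. g (?x s \<odot>\<^bsub>U\<^esub> (\<lambda>(a, b). f a b) s))"
    by (rule linear_maps_finsum[OF assms(3-5)]) (use x assms(7) in auto)
  also have "\<dots> = (\<Oplus>\<^bsub>U'\<^esub>s\<in>?A. ?x s \<odot>\<^bsub>U'\<^esub> (\<lambda>(a, b). g (f a b)) s)"
    by (rule U'.finsum_cong') (use x assms(7) in \<open>auto simp: linear_maps_smult[OF assms(5)]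
      linear_maps_closed[OF assms(5)]\<close>)
  finally show ?thesis by (simp add: tensor_lift_def free_extend_def)
qed

text \<open>Expanding the chosen representative in the basis exhibits \<open>t\<close> as a linear combination of pure tensors.\<close>

lemma tensor_lift_pure_tensor:
  assumes "module K V" "module K W" "t \<in> carrier (tensor_prod K V W)"
  shows "tensor_lift K (tensor_prod K V W) (pure_tensor K V W) t = t"
proof -
  interpret V: module K V by fact
  let ?F = "free_module K (carrier V \<times> carrier W)" and ?N = "bilinear_kernel K V W"
  have F: "module K ?F" by (rule module_free_module) (rule V.is_cring)
  note S = bilinear_kernel_submodule(1)[OF assms(1,2)]
  let ?x = "SOME x. x \<in> t"
  have l: "(\<lambda>x. ?N +>\<^bsub>?F\<^esub> x) \<in> linear_maps K ?F (tensor_prod K V W)"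
    using linear_coset[OF F S] by (simp add: linear_maps_def tensor_prod_simps tensor_module_def)
  have "?N +>\<^bsub>?F\<^esub> ?x = t" by (rule tensor_rep(2)[OF assms])
  moreover have "(\<lambda>(a, b). pure_tensor K V W a b) = (\<lambda>s. ?N +>\<^bsub>?F\<^esub> basis_elem K s)"
    by (auto simp: pure_tensor_def)
  ultimately show ?thesis
    using linear_eq_free_extend[OF module_tensor_prod[OF assms(1,2)] l tensor_rep(1)[OF assms]]
    by (simp add: tensor_lift_def)
qed

lemma linear_eq_on_pure_tensors:
  assumes "module K V" "module K W" "module K U"
    and "f \<in> linear_maps K (tensor_prod K V W) U" "g \<in> linear_maps K (tensor_prod K V W) U"
    and "\<And>a b. a \<in> carrier V \<Longrightarrow> b \<in> carrier W \<Longrightarrow> f (pure_tensor K V W a b) = g (pure_tensor K V W a b)"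
    and "t \<in> carrier (tensor_prod K V W)"
  shows "f t = g t"
proof -
  note T = module_tensor_prod[OF assms(1,2)]
  note p = bilinear_maps_closed[OF bilinear_pure_tensor[OF assms(1,2)]]
  have "f t = tensor_lift K U (\<lambda>a b. f (pure_tensor K V W a b)) t"
    using linear_tensor_lift_comp[OF assms(1,2) T assms(3,4,7), where f
      = "pure_tensor K V W", OF p] tensor_lift_pure_tensor[OF assms(1,2,7)] by simp
  also have "\<dots> = tensor_lift K U (\<lambda>a b. g (pure_tensor K V W a b)) t"
    by (rule tensor_lift_cong[OF assms(1-3,7)]) (use assms(6) p linear_maps_closed[OF assms(5)] in auto)
  also have "\<dots> = g t"
    using linear_tensor_lift_comp[OF assms(1,2) T assms(3,5,7), where f
      = "pure_tensor K V W", OF p] tensor_lift_pure_tensor[OF assms(1,2,7)] by simp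
  finally show ?thesis .
qed

lemma (in abelian_monoid) finsum_swap:
  assumes "finite A" "finite B" "\<And>i j. i \<in> A \<Longrightarrow> j \<in> B \<Longrightarrow> f i j \<in> carrier G"
  shows "(\<Oplus>i\<in>A. \<Oplus>j\<in>B. f i j) = (\<Oplus>j\<in>B. \<Oplus>i\<in>A. f i j)"
  using assms(1,3)
proof (induction A)
  case (insert a A)
  have "(\<Oplus>j\<in>B. \<Oplus>i\<in>insert a A. f i j) = (\<Oplus>j\<in>B. f a j \<oplus> (\<Oplus>i\<in>A. f i j))"
    by (rule finsum_cong') (use insert in \<open>auto simp: Pi_def intro!: finsum_closed\<close>)
  also have "\<dots> = (\<Oplus>j\<in>B. f a j) \<oplus> (\<Oplus>j\<in>B. \<Oplus>i\<in>A. f i j)"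
    by (rule finsum_addf) (use insert in \<open>auto simp: Pi_def intro!: finsum_closed\<close>)
  finally show ?case using insert by (simp add: Pi_def finsum_closed)
qed (simp add: finsum_zero)

text \<open>Once representatives of \<open>s\<close> and \<open>t\<close> are chosen, both sides are the same finite double sum.\<close>

lemma tensor_lift_swap:
  assumes "module K V" "module K W" "module K V'" "module K W'" "module K U"
    and "s \<in> carrier (tensor_prod K V W)" "t \<in> carrier (tensor_prod K V' W')"
    and "\<And>a b c d. a \<in> carrier V \<Longrightarrow> b \<in> carrier W \<Longrightarrow> c \<in> carrier V' \<Longrightarrow> d \<in> carrier W' \<Longrightarrow> f a b c d \<in> carrier U"
  shows "tensor_lift K U (\<lambda>a b. tensor_lift K U (\<lambda>c d. f a b c d) t) s
    = tensor_lift K U (\<lambda>c d. tensor_lift K U (\<lambda>a b. f a b c d) s) t"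
proof -
  interpret U: module K U by fact
  let ?x = "SOME x. x \<in> s" let ?A = "{p. ?x p \<noteq> \<zero>\<^bsub>K\<^esub>}"
  let ?y = "SOME x. x \<in> t" let ?B = "{p. ?y p \<noteq> \<zero>\<^bsub>K\<^esub>}"
  have x: "\<And>s. ?x s \<in> carrier K" "finite ?A" "?A \<subseteq> carrier V \<times> carrier W"
    using tensor_rep(1)[OF assms(1,2,6)] by (auto simp: free_module_carrier)
  have y: "\<And>s. ?y s \<in> carrier K" "finite ?B" "?B \<subseteq> carrier V' \<times> carrier W'"
    using tensor_rep(1)[OF assms(3,4,7)] by (auto simp: free_module_carrier)
  define F where "F p q = (case p of (a, b) \<Rightarrow> case q of (c, d) \<Rightarrow> f a b c d)" for p q
  have F: "F p q \<in> carrier U" if "p \<in> ?A" "q \<in> ?B" for p q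
  proof -
    have "p \<in> carrier V \<times> carrier W" "q \<in> carrier V' \<times> carrier W'" using that x(3) y(3) by blast+
    then show ?thesis using assms(8) by (auto simp: F_def)
  qed
  have "tensor_lift K U (\<lambda>a b. tensor_lift K U (\<lambda>c d. f a b c d) t) s
    = (\<Oplus>\<^bsub>U\<^esub>p\<in>?A. ?x p \<odot>\<^bsub>U\<^esub> (\<Oplus>\<^bsub>U\<^esub>q\<in>?B. ?y q \<odot>\<^bsub>U\<^esub> F p q))"
    by (simp add: tensor_lift_def free_extend_def F_def case_prod_beta)
  also have "\<dots> = (\<Oplus>\<^bsub>U\<^esub>p\<in>?A. \<Oplus>\<^bsub>U\<^esub>q\<in>?B. ?x p \<odot>\<^bsub>U\<^esub> (?y q \<odot>\<^bsub>U\<^esub> F p q))"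
    by (rule U.finsum_cong') (use x y F in \<open>auto simp: U.finsum_smult_ldistr Pi_def intro!: U.finsum_closed\<close>)
  also have "\<dots> = (\<Oplus>\<^bsub>U\<^esub>q\<in>?B. \<Oplus>\<^bsub>U\<^esub>p\<in>?A. ?x p \<odot>\<^bsub>U\<^esub> (?y q \<odot>\<^bsub>U\<^esub> F p q))"
    by (rule U.finsum_swap) (use x y F in auto)
  also have "\<dots> = (\<Oplus>\<^bsub>U\<^esub>q\<in>?B. \<Oplus>\<^bsub>U\<^esub>p\<in>?A. ?y q \<odot>\<^bsub>U\<^esub> (?x p \<odot>\<^bsub>U\<^esub> F p q))"
  proof -
    have "?x p \<odot>\<^bsub>U\<^esub> (?y q \<odot>\<^bsub>U\<^esub> F p q) = ?y q \<odot>\<^bsub>U\<^esub> (?x p \<odot>\<^bsub>U\<^esub> F p q)" if "p \<in> ?A" "q \<in> ?B" for p q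
      using that x(1) y(1) F U.smult_assoc1[symmetric] U.R.m_comm by simp
    then show ?thesis
      using x y F by (intro U.finsum_cong') (auto simp: Pi_def intro!: U.finsum_closed U.finsum_cong')
  qed
  also have "\<dots> = (\<Oplus>\<^bsub>U\<^esub>q\<in>?B. ?y q \<odot>\<^bsub>U\<^esub> (\<Oplus>\<^bsub>U\<^esub>p\<in>?A. ?x p \<odot>\<^bsub>U\<^esub> F p q))"
    by (rule U.finsum_cong') (use x y F in \<open>auto simp: U.finsum_smult_ldistr Pi_def intro!: U.finsum_closed\<close>)
  also have "\<dots> = tensor_lift K U (\<lambda>c d. tensor_lift K U (\<lambda>a b. f a b c d) s) t"
    by (simp add: tensor_lift_def free_extend_def F_def case_prod_beta)
  finally show ?thesis .
qed

text \<open>Together with \<open>linear_tensor_lift\<close> this makes nested Sweedler sums linear in each variable.\<close>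

lemma linear_tensor_lift_param:
  assumes "module K X" "module K V" "module K W" "module K U" "t \<in> carrier (tensor_prod K V W)"
    and "\<And>a b. a \<in> carrier V \<Longrightarrow> b \<in> carrier W \<Longrightarrow> (\<lambda>x. f x a b) \<in> linear_maps K X U"
  shows "(\<lambda>x. tensor_lift K U (f x) t) \<in> linear_maps K X U"
proof -
  interpret U: module K U by fact
  interpret X: module K X by fact
  let ?x = "SOME x. x \<in> t" let ?A = "{p. ?x p \<noteq> \<zero>\<^bsub>K\<^esub>}"
  have x: "\<And>s. ?x s \<in> carrier K" "finite ?A" "?A \<subseteq> carrier V \<times> carrier W"
    using tensor_rep(1)[OF assms(2,3,5)] by (auto simp: free_module_carrier)
  define F where "F y p = (case p of (a, b) \<Rightarrow> f y a b)" for y p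
  have F: "(\<lambda>y. F y p) \<in> linear_maps K X U" if "p \<in> ?A" for p
  proof -
    have "p \<in> carrier V \<times> carrier W" using that x(3) by blast
    then show ?thesis using assms(6) by (auto simp: F_def)
  qed
  note Fl = linear_maps_closed[OF F] linear_maps_add[OF F] linear_maps_smult[OF F]
  have eq: "tensor_lift K U (f y) t = (\<Oplus>\<^bsub>U\<^esub>p\<in>?A. ?x p \<odot>\<^bsub>U\<^esub> F y p)" for y
    by (simp add: tensor_lift_def free_extend_def F_def case_prod_beta)
  show ?thesis unfolding eq
  proof (rule linear_mapsI)
    fix y assume y: "y \<in> carrier X"
    show "(\<Oplus>\<^bsub>U\<^esub>p\<in>?A. ?x p \<odot>\<^bsub>U\<^esub> F y p) \<in> carrier U" using x y Fl by (intro U.finsum_closed) auto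
    fix z assume z: "z \<in> carrier X"
    have "(\<Oplus>\<^bsub>U\<^esub>p\<in>?A. ?x p \<odot>\<^bsub>U\<^esub> F (y \<oplus>\<^bsub>X\<^esub> z) p) = (\<Oplus>\<^bsub>U\<^esub>p\<in>?A. ?x p \<odot>\<^bsub>U\<^esub> F y p \<oplus>\<^bsub>U\<^esub> ?x p \<odot>\<^bsub>U\<^esub> F z p)"
      by (rule U.finsum_cong') (use x y z Fl in \<open>auto simp: U.smult_r_distr\<close>)
    also have "\<dots> = (\<Oplus>\<^bsub>U\<^esub>p\<in>?A. ?x p \<odot>\<^bsub>U\<^esub> F y p) \<oplus>\<^bsub>U\<^esub> (\<Oplus>\<^bsub>U\<^esub>p\<in>?A. ?x p \<odot>\<^bsub>U\<^esub> F z p)"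
      by (rule U.finsum_addf) (use x y z Fl in auto)
    finally show "(\<Oplus>\<^bsub>U\<^esub>p\<in>?A. ?x p \<odot>\<^bsub>U\<^esub> F (y \<oplus>\<^bsub>X\<^esub> z) p) = \<dots>" .
  next
    fix c y assume c: "c \<in> carrier K" and y: "y \<in> carrier X"
    have "(\<Oplus>\<^bsub>U\<^esub>p\<in>?A. ?x p \<odot>\<^bsub>U\<^esub> F (c \<odot>\<^bsub>X\<^esub> y) p) = (\<Oplus>\<^bsub>U\<^esub>p\<in>?A. c \<odot>\<^bsub>U\<^esub> (?x p \<odot>\<^bsub>U\<^esub> F y p))"
    proof (rule U.finsum_cong')
      fix p assume p: "p \<in> ?A"
      show "?x p \<odot>\<^bsub>U\<^esub> F (c \<odot>\<^bsub>X\<^esub> y) p = c \<odot>\<^bsub>U\<^esub> (?x p \<odot>\<^bsub>U\<^esub> F y p)"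
        using x(1) c y Fl(1)[OF p y] Fl(3)[OF p c y]
        by (simp add: U.smult_assoc1[symmetric] U.R.m_comm)
    qed (use x c y Fl in auto)
    also have "\<dots> = c \<odot>\<^bsub>U\<^esub> (\<Oplus>\<^bsub>U\<^esub>p\<in>?A. ?x p \<odot>\<^bsub>U\<^esub> F y p)"
      by (rule U.finsum_smult_ldistr[symmetric]) (use x c y Fl in auto)
    finally show "(\<Oplus>\<^bsub>U\<^esub>p\<in>?A. ?x p \<odot>\<^bsub>U\<^esub> F (c \<odot>\<^bsub>X\<^esub> y) p) = \<dots>" .
  qed
qed

section \<open>Linear expressions\<close>

lemma linear_id: "(\<lambda>x. x) \<in> linear_maps K V V"
  by (rule linear_mapsI) auto

lemma linear_mult_left:
  assumes "assoc_algebra K A" "f \<in> linear_maps K X A" "c \<in> carrier A"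
  shows "(\<lambda>x. f x \<otimes>\<^bsub>A\<^esub> c) \<in> linear_maps K X A"
proof -
  interpret A: assoc_algebra K A by fact
  show ?thesis
    by (rule linear_mapsI) (use assms(3) in \<open>auto simp: linear_maps_closed[OF assms(2)] linear_maps_add[OF assms(2)]
        linear_maps_smult[OF assms(2)] A.alg_closed A.alg_l_distr A.alg_smult_l\<close>)
qed

lemma linear_mult_right:
  assumes "assoc_algebra K A" "f \<in> linear_maps K X A" "c \<in> carrier A"
  shows "(\<lambda>x. c \<otimes>\<^bsub>A\<^esub> f x) \<in> linear_maps K X A"
proof -
  interpret A: assoc_algebra K A by fact
  show ?thesis
    by (rule linear_mapsI) (use assms(3) in \<open>auto simp: linear_maps_closed[OF assms(2)] linear_maps_add[OF assms(2)]
        linear_maps_smult[OF assms(2)] A.alg_closed A.alg_r_distr A.alg_smult_r\<close>)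
qed

lemma linear_pure_left:
  assumes "module K V" "module K W" "f \<in> linear_maps K X V" "b \<in> carrier W"
  shows "(\<lambda>x. pure_tensor K V W (f x) b) \<in> linear_maps K X (tensor_prod K V W)"
  by (rule linear_maps_comp[OF assms(3) bilinear_mapsD(1)[OF bilinear_pure_tensor[OF assms(1,2)] assms(4)]])

lemma linear_pure_right:
  assumes "module K V" "module K W" "f \<in> linear_maps K X W" "a \<in> carrier V"
  shows "(\<lambda>x. pure_tensor K V W a (f x)) \<in> linear_maps K X (tensor_prod K V W)"
  by (rule linear_maps_comp[OF assms(3) bilinear_mapsD(2)[OF bilinear_pure_tensor[OF assms(1,2)] assms(4)]])

lemma pure_tensor_closed:
  assumes "module K V" "module K W" "a \<in> carrier V" "b \<in> carrier W"
  shows "pure_tensor K V W a b \<in> carrier (tensor_prod K V W)"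
  by (rule bilinear_maps_closed[OF bilinear_pure_tensor[OF assms(1,2)] assms(3,4)])

lemma linear_tensor_lift_arg:
  assumes "g \<in> linear_maps K X (tensor_prod K V W)" "module K V" "module K W" "module K U"
    and "h \<in> bilinear_maps K V W U"
  shows "(\<lambda>x. tensor_lift K U h (g x)) \<in> linear_maps K X U"
  by (rule linear_maps_comp[OF assms(1) linear_tensor_lift[OF assms(2-)]])

lemma self_module_simps:
  "carrier (self_module K) = carrier K" "add (self_module K) = add K" "zero (self_module K) = zero K"
  "smult (self_module K) = mult K"
  by (auto simp: self_module_def ring.extend_def module.fields_def)

lemma linear_smult_left:
  assumes "module K U" "f \<in> linear_maps K X (self_module K)" "u \<in> carrier U"
  shows "(\<lambda>x. f x \<odot>\<^bsub>U\<^esub> u) \<in> linear_maps K X U"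
proof -
  interpret U: module K U by fact
  show ?thesis
    by (rule linear_mapsI) (use assms(3) linear_maps_closed[OF assms(2)] in \<open>auto simp: linear_maps_add[OF assms(2)]
        linear_maps_smult[OF assms(2)] self_module_simps U.smult_l_distr U.smult_assoc1\<close>)
qed

lemma linear_smult_right:
  assumes "module K U" "f \<in> linear_maps K X U" "c \<in> carrier K"
  shows "(\<lambda>x. c \<odot>\<^bsub>U\<^esub> f x) \<in> linear_maps K X U"
proof -
  interpret U: module K U by fact
  show ?thesis
    by (rule linear_mapsI) (use assms(3) linear_maps_closed[OF assms(2)] in \<open>auto simp: linear_maps_add[OF assms(2)]
        linear_maps_smult[OF assms(2)] U.smult_r_distr U.smult_assoc1[symmetric] U.R.m_comm\<close>)
qed

text \<open>Syntax-directed rules for proving that an expression is linear in a variable: the outermost operation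
of the expression determines the rule.  Since \<open>bilinear_mapsI\<close> is included, bilinearity is reduced to
linearity in each argument.\<close>

lemmas linear_intros = linear_id linear_mult_left linear_mult_right linear_pure_left linear_pure_right
  linear_smult_left linear_smult_right linear_tensor_lift_param linear_tensor_lift_arg bilinear_mapsI

section \<open>Algebras and their homomorphisms\<close>

lemma assoc_algebraD:
  assumes "assoc_algebra K A"
  shows "field K" "module K A" "cring K"
  using assms field.axioms(1) domain.axioms(1) by (auto simp: assoc_algebra_def)

lemma unital_algebraD:
  assumes "unital_algebra K A"
  shows "assoc_algebra K A" "module K A" "field K" "monoid A" "cring K"
  using assms assoc_algebraD by (auto simp: unital_algebra_def)

lemma unital_algebra_ring:
  assumes "unital_algebra K A"
  shows "ring A"
proof -
  interpret A: unital_algebra K A by fact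
  show ?thesis
    by (rule ringI) (auto intro: module.axioms(2)[OF A.module_axioms] A.monoid_axioms A.alg_l_distr A.alg_r_distr)
qed

lemma unital_algebraI:
  assumes "field K" "module K A" "mult A \<in> bilinear_maps K A A A" "\<one>\<^bsub>A\<^esub> \<in> carrier A"
    and "\<And>x y z. x \<in> carrier A \<Longrightarrow> y \<in> carrier A \<Longrightarrow> z \<in> carrier A \<Longrightarrow>
      (x \<otimes>\<^bsub>A\<^esub> y) \<otimes>\<^bsub>A\<^esub> z = x \<otimes>\<^bsub>A\<^esub> (y \<otimes>\<^bsub>A\<^esub> z)"
    and "\<And>x. x \<in> carrier A \<Longrightarrow> \<one>\<^bsub>A\<^esub> \<otimes>\<^bsub>A\<^esub> x = x" "\<And>x. x \<in> carrier A \<Longrightarrow> x \<otimes>\<^bsub>A\<^esub> \<one>\<^bsub>A\<^esub> = x"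
  shows "unital_algebra K A"
proof -
  note b = bilinear_mapsD[OF assms(3)]
  note c = bilinear_maps_closed[OF assms(3)]
  have "assoc_algebra_axioms K A"
    by unfold_locales (simp_all add: c assms(5) linear_maps_add[OF b(1)] linear_maps_add[OF b(2)]
        linear_maps_smult[OF b(1)] linear_maps_smult[OF b(2)])
  moreover have "monoid A" by (rule monoidI) (simp_all add: c assms)
  ultimately show ?thesis
    by (simp add: unital_algebra_def assoc_algebra_def assms(1,2))
qed

lemma bilinear_mult:
  assumes "assoc_algebra K A"
  shows "mult A \<in> bilinear_maps K A A A"
  by (intro linear_intros assms; assumption)

definition algebra_homs :: "'k ring \<Rightarrow> ('k, 'a) module \<Rightarrow> ('k, 'b) module \<Rightarrow> ('a \<Rightarrow> 'b) set" where
  "algebra_homs K A B = linear_maps K A B \<inter> ring_hom A B"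

lemma algebra_homsI:
  assumes "f \<in> linear_maps K A B" "f \<one>\<^bsub>A\<^esub> = \<one>\<^bsub>B\<^esub>"
    and "\<And>x y. x \<in> carrier A \<Longrightarrow> y \<in> carrier A \<Longrightarrow> f (x \<otimes>\<^bsub>A\<^esub> y) = f x \<otimes>\<^bsub>B\<^esub> f y"
  shows "f \<in> algebra_homs K A B"
  using assms by (auto simp: algebra_homs_def ring_hom_def linear_maps_def)

lemma algebra_homsD:
  assumes "f \<in> algebra_homs K A B"
  shows "f \<in> linear_maps K A B" "f \<one>\<^bsub>A\<^esub> = \<one>\<^bsub>B\<^esub>"
    and "x \<in> carrier A \<Longrightarrow> y \<in> carrier A \<Longrightarrow> f (x \<otimes>\<^bsub>A\<^esub> y) = f x \<otimes>\<^bsub>B\<^esub> f y"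
  using assms by (auto simp: algebra_homs_def ring_hom_def)

lemma bilinear_mult_pure:
  assumes "assoc_algebra K A" "assoc_algebra K B" "a \<in> carrier A" "b \<in> carrier B"
  shows "(\<lambda>c d. pure_tensor K A B (a \<otimes>\<^bsub>A\<^esub> c) (b \<otimes>\<^bsub>B\<^esub> d)) \<in> bilinear_maps K A B (tensor_prod K A B)"
  using assms by (intro linear_intros) (auto intro!: linear_intros simp: assoc_algebraD assoc_algebra.alg_closed)

lemma bilinear_mult_tensor_prod:
  assumes "assoc_algebra K A" "assoc_algebra K B"
  shows "mult (tensor_prod K A B) \<in> bilinear_maps K (tensor_prod K A B) (tensor_prod K A B) (tensor_prod K A B)"
proof -
  note m = assoc_algebraD(2)[OF assms(1)] assoc_algebraD(2)[OF assms(2)]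
  note T = module_tensor_prod[OF m]
  note b = bilinear_mult_pure[OF assms]
  have "(\<lambda>s t. s \<otimes>\<^bsub>tensor_prod K A B\<^esub> t) \<in> bilinear_maps K (tensor_prod K A B) (tensor_prod K A B) (tensor_prod K A B)"
    unfolding mult_tensor_prod
    using assms m T by (intro linear_intros) (auto intro!: linear_intros simp: assoc_algebra.alg_closed)
  then show ?thesis by simp
qed

lemma mult_pure_tensor:
  assumes "assoc_algebra K A" "assoc_algebra K B"
    and "a \<in> carrier A" "b \<in> carrier B" "c \<in> carrier A" "d \<in> carrier B"
  shows "pure_tensor K A B a b \<otimes>\<^bsub>tensor_prod K A B\<^esub> pure_tensor K A B c d
    = pure_tensor K A B (a \<otimes>\<^bsub>A\<^esub> c) (b \<otimes>\<^bsub>B\<^esub> d)"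
proof -
  note m = assoc_algebraD(2)[OF assms(1)] assoc_algebraD(2)[OF assms(2)]
  note T = module_tensor_prod[OF m]
  have "(\<lambda>a b. tensor_lift K (tensor_prod K A B) (\<lambda>c d. pure_tensor K A B (a \<otimes>\<^bsub>A\<^esub> c) (b \<otimes>\<^bsub>B\<^esub> d)) t)
    \<in> bilinear_maps K A B (tensor_prod K A B)" if "t \<in> carrier (tensor_prod K A B)" for t
    using assms(1,2) m T that by (intro linear_intros) (auto intro!: linear_intros simp: assoc_algebra.alg_closed)
  then show ?thesis unfolding mult_tensor_prod
    by (simp add: tensor_lift_pure[OF m T] pure_tensor_closed[OF m] bilinear_mult_pure[OF assms(1,2)] assms(3-))
qed

text \<open>All laws are linear in each argument, so they can be checked on pure tensors, where they follow from
the laws of the two factors.\<close>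

lemma unital_algebra_tensor_prod:
  assumes A: "unital_algebra K A" and B: "unital_algebra K B"
  shows "unital_algebra K (tensor_prod K A B)"
proof -
  let ?T = "tensor_prod K A B"
  interpret A: unital_algebra K A by fact
  interpret B: unital_algebra K B by fact
  note a = unital_algebraD(1)[OF A] unital_algebraD(1)[OF B]
  note m = unital_algebraD(2)[OF A] unital_algebraD(2)[OF B]
  note T = module_tensor_prod[OF m]
  note bm = bilinear_mult_tensor_prod[OF a]
  note pc = pure_tensor_closed[OF m]
  note mc = bilinear_maps_closed[OF bm]
  note mp = mult_pure_tensor[OF a]
  note mr = linear_maps_comp[OF _ bilinear_mapsD(1)[OF bm]] linear_maps_comp[OF _ bilinear_mapsD(2)[OF bm]]
  note cl = A.alg_closed B.alg_closed
  show ?thesis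
  proof (rule unital_algebraI[OF unital_algebraD(3)[OF A] T bm])
    show one: "\<one>\<^bsub>?T\<^esub> \<in> carrier ?T" unfolding tensor_prod_simps(5) by (simp add: pc)
    show "\<one>\<^bsub>?T\<^esub> \<otimes>\<^bsub>?T\<^esub> x = x" if "x \<in> carrier ?T" for x
      by (rule linear_eq_on_pure_tensors[OF m T _ _ _ that])
       (intro linear_intros mr one, rule linear_id, simp add: tensor_prod_simps(5) mp)
    show "x \<otimes>\<^bsub>?T\<^esub> \<one>\<^bsub>?T\<^esub> = x" if "x \<in> carrier ?T" for x
      by (rule linear_eq_on_pure_tensors[OF m T _ _ _ that])
       (intro linear_intros mr one, rule linear_id, simp add: tensor_prod_simps(5) mp)
    have ppp: "(p \<otimes>\<^bsub>?T\<^esub> q) \<otimes>\<^bsub>?T\<^esub> z = p \<otimes>\<^bsub>?T\<^esub> (q \<otimes>\<^bsub>?T\<^esub> z)"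
      if "p = pure_tensor K A B a b" "q = pure_tensor K A B c d" "a \<in> carrier A" "b \<in> carrier B"
        "c \<in> carrier A" "d \<in> carrier B" "z \<in> carrier ?T" for p q z a b c d
    proof (rule linear_eq_on_pure_tensors[OF m T _ _ _ that(7)])
      show "(\<lambda>z. (p \<otimes>\<^bsub>?T\<^esub> q) \<otimes>\<^bsub>?T\<^esub> z) \<in> linear_maps K ?T ?T" "(\<lambda>z. p \<otimes>\<^bsub>?T\<^esub> (q \<otimes>\<^bsub>?T\<^esub> z)) \<in> linear_maps K ?T ?T"
        by (intro linear_id mr mc; use that pc in simp)+
    qed (use that in \<open>simp add: mp cl A.m_assoc B.m_assoc\<close>)
    have pp: "(p \<otimes>\<^bsub>?T\<^esub> y) \<otimes>\<^bsub>?T\<^esub> z = p \<otimes>\<^bsub>?T\<^esub> (y \<otimes>\<^bsub>?T\<^esub> z)"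
      if "p = pure_tensor K A B a b" "a \<in> carrier A" "b \<in> carrier B" "y \<in> carrier ?T" "z \<in> carrier ?T" for p y z a b
    proof (rule linear_eq_on_pure_tensors[OF m T _ _ _ that(4)])
      show "(\<lambda>y. (p \<otimes>\<^bsub>?T\<^esub> y) \<otimes>\<^bsub>?T\<^esub> z) \<in> linear_maps K ?T ?T" "(\<lambda>y. p \<otimes>\<^bsub>?T\<^esub> (y \<otimes>\<^bsub>?T\<^esub> z)) \<in> linear_maps K ?T ?T"
        by (intro linear_id mr; use that pc in simp)+
    qed (use that ppp in simp)
    show "(x \<otimes>\<^bsub>?T\<^esub> y) \<otimes>\<^bsub>?T\<^esub> z = x \<otimes>\<^bsub>?T\<^esub> (y \<otimes>\<^bsub>?T\<^esub> z)"
      if "x \<in> carrier ?T" "y \<in> carrier ?T" "z \<in> carrier ?T" for x y z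
    proof (rule linear_eq_on_pure_tensors[OF m T _ _ _ that(1)])
      show "(\<lambda>x. (x \<otimes>\<^bsub>?T\<^esub> y) \<otimes>\<^bsub>?T\<^esub> z) \<in> linear_maps K ?T ?T" "(\<lambda>x. x \<otimes>\<^bsub>?T\<^esub> (y \<otimes>\<^bsub>?T\<^esub> z)) \<in> linear_maps K ?T ?T"
        by (intro linear_id mr mc; use that in simp)+
    qed (use that pp in simp)
  qed
qed

text \<open>For \<open>s = \<Delta> x\<close> and \<open>t = \<Delta> y\<close> this expresses a Sweedler sum over \<open>\<Delta> (x y) = \<Delta> x \<Delta> y\<close> by Sweedler sums over \<open>x\<close> and
\<open>y\<close>.\<close>

lemma tensor_lift_mult:
  assumes A: "assoc_algebra K A" and B: "assoc_algebra K B" and U: "module K U"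
    and f: "f \<in> bilinear_maps K A B U"
    and st: "s \<in> carrier (tensor_prod K A B)" "t \<in> carrier (tensor_prod K A B)"
  shows "tensor_lift K U f (s \<otimes>\<^bsub>tensor_prod K A B\<^esub> t)
    = tensor_lift K U (\<lambda>a b. tensor_lift K U (\<lambda>c d. f (a \<otimes>\<^bsub>A\<^esub> c) (b \<otimes>\<^bsub>B\<^esub> d)) t) s"
proof -
  note m = assoc_algebraD(2)[OF A] assoc_algebraD(2)[OF B]
  note T = module_tensor_prod[OF m]
  note pc = pure_tensor_closed[OF m]
  note lf = linear_tensor_lift[OF m U f]
  note cl = assoc_algebra.alg_closed[OF A] assoc_algebra.alg_closed[OF B]
  note fc = bilinear_maps_closed[OF f]
  have "tensor_lift K U f (s \<otimes>\<^bsub>tensor_prod K A B\<^esub> t)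
    = tensor_lift K U (\<lambda>a b. tensor_lift K U f (tensor_lift K (tensor_prod K A B) (\<lambda>c d. pure_tensor K A B (a
      \<otimes>\<^bsub>A\<^esub> c) (b \<otimes>\<^bsub>B\<^esub> d)) t)) s"
    unfolding mult_tensor_prod
    by (rule linear_tensor_lift_comp[OF m T U lf st(1)]) (use cl pc in \<open>auto intro!: tensor_lift_closed[OF m T
      st(2)]\<close>)
  also have "\<dots> = tensor_lift K U (\<lambda>a b. tensor_lift K U (\<lambda>c d. f (a \<otimes>\<^bsub>A\<^esub> c) (b \<otimes>\<^bsub>B\<^esub> d)) t) s"
  proof (rule tensor_lift_cong[OF m U st(1)])
    fix a b assume ab: "a \<in> carrier A" "b \<in> carrier B"
    show "tensor_lift K U (\<lambda>c d. f (a \<otimes>\<^bsub>A\<^esub> c) (b \<otimes>\<^bsub>B\<^esub> d)) t \<in> carrier U"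
      by (rule tensor_lift_closed[OF m U st(2)]) (use ab cl fc in auto)
    have "tensor_lift K U f (tensor_lift K (tensor_prod K A B) (\<lambda>c d. pure_tensor K A B (a \<otimes>\<^bsub>A\<^esub> c) (b \<otimes>\<^bsub>B\<^esub> d)) t)
      = tensor_lift K U (\<lambda>c d. tensor_lift K U f (pure_tensor K A B (a \<otimes>\<^bsub>A\<^esub> c) (b \<otimes>\<^bsub>B\<^esub> d))) t"
      by (rule linear_tensor_lift_comp[OF m T U lf st(2)]) (use ab cl pc in auto)
    also have "\<dots> = tensor_lift K U (\<lambda>c d. f (a \<otimes>\<^bsub>A\<^esub> c) (b \<otimes>\<^bsub>B\<^esub> d)) t"
      by (rule tensor_lift_cong[OF m U st(2)]) (use ab cl fc in \<open>auto intro!: tensor_lift_pure[OF m U f]\<close>)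
    finally show "tensor_lift K U f (tensor_lift K (tensor_prod K A B) (\<lambda>c d. pure_tensor K A B (a \<otimes>\<^bsub>A\<^esub> c) (b
      \<otimes>\<^bsub>B\<^esub> d)) t) = \<dots>" .
  qed
  finally show ?thesis .
qed

text \<open>Because \<open>c x = (c 1) x\<close>.\<close>

lemma ideal_submodule:
  assumes A: "unital_algebra K A" and "ideal N A"
  shows "submodule N K A"
proof -
  interpret A: unital_algebra K A by fact
  interpret N: ideal N A by fact
  show ?thesis
  proof (rule A.submoduleI)
    fix c x assume c: "c \<in> carrier K" and x: "x \<in> N"
    have xA: "x \<in> carrier A" using x by (rule N.a_Hcarr)
    have "(c \<odot>\<^bsub>A\<^esub> \<one>\<^bsub>A\<^esub>) \<otimes>\<^bsub>A\<^esub> x \<in> N" using c x by (intro N.I_l_closed) auto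
    then show "c \<odot>\<^bsub>A\<^esub> x \<in> N" using c xA by (simp add: A.alg_smult_l)
  qed (use N.a_subset in auto)
qed

lemma coset_algebra_hom:
  assumes A: "unital_algebra K A" and N: "ideal N A"
  shows "unital_algebra K (quot_module A N)" "(\<lambda>x. N +>\<^bsub>A\<^esub> x) \<in> algebra_homs K A (quot_module A N)"
proof -
  interpret A: unital_algebra K A by fact
  interpret N: ideal N A by fact
  let ?Q = "quot_module A N"
  note m = unital_algebraD(2)[OF A]
  note s = ideal_submodule[OF assms]
  note Q = module_quot_module[OF m s]
  note lin = linear_coset[OF m s]
  have mult: "(N +>\<^bsub>A\<^esub> x) \<otimes>\<^bsub>?Q\<^esub> (N +>\<^bsub>A\<^esub> y) = N +>\<^bsub>A\<^esub> (x \<otimes>\<^bsub>A\<^esub> y)" if "x \<in> carrier A" "y \<in> carrier A" for x y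
    using that by (simp add: quot_module_simps N.rcoset_mult_add)
  have one: "\<one>\<^bsub>?Q\<^esub> = N +>\<^bsub>A\<^esub> \<one>\<^bsub>A\<^esub>" by (simp add: quot_module_simps)
  show "(\<lambda>x. N +>\<^bsub>A\<^esub> x) \<in> algebra_homs K A ?Q"
    by (rule algebra_homsI) (simp_all add: lin one mult)
  have obt: "\<exists>a\<in>carrier A. x = N +>\<^bsub>A\<^esub> a" if "x \<in> carrier ?Q" for x
    using that by (auto simp: quot_module_carrier)
  have cl: "N +>\<^bsub>A\<^esub> a \<in> carrier ?Q" if "a \<in> carrier A" for a
    using that by (auto simp: quot_module_carrier)
  note r = coset_add[OF m s] coset_smult[OF m s] mult
  show "unital_algebra K ?Q"
  proof (rule unital_algebraI[OF unital_algebraD(3)[OF A] Q])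
    show "mult ?Q \<in> bilinear_maps K ?Q ?Q ?Q"
    proof (rule bilinear_mapsI; rule linear_mapsI)
      fix x y assume "x \<in> carrier ?Q" "y \<in> carrier ?Q"
      then obtain a b where ab: "a \<in> carrier A" "x = N +>\<^bsub>A\<^esub> a" "b \<in> carrier A" "y = N +>\<^bsub>A\<^esub> b" using obt by meson
      show "x \<otimes>\<^bsub>?Q\<^esub> y \<in> carrier ?Q" using ab by (simp add: r cl)
      show "x \<otimes>\<^bsub>?Q\<^esub> y \<in> carrier ?Q" using ab by (simp add: r cl)
      show "(c \<odot>\<^bsub>?Q\<^esub> x) \<otimes>\<^bsub>?Q\<^esub> y = c \<odot>\<^bsub>?Q\<^esub> (x \<otimes>\<^bsub>?Q\<^esub> y)" if "c \<in> carrier K" for c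
        using ab that by (simp add: r A.alg_smult_l)
      show "x \<otimes>\<^bsub>?Q\<^esub> (c \<odot>\<^bsub>?Q\<^esub> y) = c \<odot>\<^bsub>?Q\<^esub> (x \<otimes>\<^bsub>?Q\<^esub> y)" if "c \<in> carrier K" for c
        using ab that by (simp add: r A.alg_smult_r)
      fix z assume "z \<in> carrier ?Q"
      then obtain c where c: "c \<in> carrier A" "z = N +>\<^bsub>A\<^esub> c" using obt by meson
      show "(x \<oplus>\<^bsub>?Q\<^esub> z) \<otimes>\<^bsub>?Q\<^esub> y = x \<otimes>\<^bsub>?Q\<^esub> y \<oplus>\<^bsub>?Q\<^esub> z \<otimes>\<^bsub>?Q\<^esub> y"
        using ab c by (simp add: r A.alg_l_distr)
      show "x \<otimes>\<^bsub>?Q\<^esub> (y \<oplus>\<^bsub>?Q\<^esub> z) = x \<otimes>\<^bsub>?Q\<^esub> y \<oplus>\<^bsub>?Q\<^esub> x \<otimes>\<^bsub>?Q\<^esub> z"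
        using ab c by (simp add: r A.alg_r_distr)
    qed
    show "\<one>\<^bsub>?Q\<^esub> \<in> carrier ?Q" by (simp add: one cl)
    fix x assume "x \<in> carrier ?Q"
    then obtain a where a: "a \<in> carrier A" "x = N +>\<^bsub>A\<^esub> a" using obt by meson
    then show "\<one>\<^bsub>?Q\<^esub> \<otimes>\<^bsub>?Q\<^esub> x = x" "x \<otimes>\<^bsub>?Q\<^esub> \<one>\<^bsub>?Q\<^esub> = x" by (simp_all add: one r)
    fix y z assume "y \<in> carrier ?Q" "z \<in> carrier ?Q"
    then obtain b c where "b \<in> carrier A" "y = N +>\<^bsub>A\<^esub> b" "c \<in> carrier A" "z = N +>\<^bsub>A\<^esub> c" using obt by meson
    then show "(x \<otimes>\<^bsub>?Q\<^esub> y) \<otimes>\<^bsub>?Q\<^esub> z = x \<otimes>\<^bsub>?Q\<^esub> (y \<otimes>\<^bsub>?Q\<^esub> z)"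
      using a by (simp add: r A.m_assoc)
  qed
qed

text \<open>The kernel of \<open>f\<close> is an ideal.\<close>

lemma algebra_hom_genideal:
  assumes A: "unital_algebra K A" and B: "unital_algebra K B" and f: "f \<in> algebra_homs K A B"
    and R: "R \<subseteq> carrier A" "\<And>r. r \<in> R \<Longrightarrow> f r = \<zero>\<^bsub>B\<^esub>" and x: "x \<in> genideal A R"
  shows "f x = \<zero>\<^bsub>B\<^esub>"
proof -
  interpret A: ring A by (rule unital_algebra_ring[OF A])
  interpret B: ring B by (rule unital_algebra_ring[OF B])
  have fr: "f \<in> ring_hom A B" using f unfolding algebra_homs_def by (rule IntD2)
  note ker = ring_hom_ring.kernel_is_ideal[OF ring_hom_ringI2[OF A.ring_axioms B.ring_axioms fr]]
  have "R \<subseteq> a_kernel A B f"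
  proof
    fix r assume r: "r \<in> R"
    then have "r \<in> carrier A" "f r = \<zero>\<^bsub>B\<^esub>" using R(1) R(2)[OF r] by (auto dest: subsetD)
    then show "r \<in> a_kernel A B f" unfolding a_kernel_def' by (intro CollectI conjI)
  qed
  from A.genideal_minimal[OF ker this] have "x \<in> a_kernel A B f" using x by (rule subsetD)
  then show ?thesis unfolding a_kernel_def' by simp
qed

text \<open>The universal property of an algebra given by generators of an ideal of relations.\<close>

lemma quot_algebra_lift:
  assumes A: "unital_algebra K A" and B: "unital_algebra K B" and f: "f \<in> algebra_homs K A B"
    and R: "R \<subseteq> carrier A" "\<And>r. r \<in> R \<Longrightarrow> f r = \<zero>\<^bsub>B\<^esub>"
  shows "quot_lift f \<in> algebra_homs K (quot_module A (genideal A R)) B"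
    and "\<And>x. x \<in> carrier A \<Longrightarrow> quot_lift f (genideal A R +>\<^bsub>A\<^esub> x) = f x"
proof -
  let ?N = "genideal A R" let ?Q = "quot_module A ?N"
  interpret A: ring A by (rule unital_algebra_ring[OF A])
  have N: "ideal ?N A" by (rule A.genideal_ideal[OF R(1)])
  note s = ideal_submodule[OF A N]
  note z = algebra_hom_genideal[OF A B f R]
  note m = unital_algebraD(2)[OF A] unital_algebraD(2)[OF B]
  show q: "quot_lift f (?N +>\<^bsub>A\<^esub> x) = f x" if "x \<in> carrier A" for x
    by (rule quot_lift_coset[OF m(1) s m(2) algebra_homsD(1)[OF f] z that])
  note c = algebra_homsD[OF coset_algebra_hom(2)[OF A N]]
  show "quot_lift f \<in> algebra_homs K ?Q B"
  proof (rule algebra_homsI)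
    show "quot_lift f \<in> linear_maps K ?Q B"
      by (rule linear_quot_lift[OF m(1) s m(2) algebra_homsD(1)[OF f] z])
    show "quot_lift f \<one>\<^bsub>?Q\<^esub> = \<one>\<^bsub>B\<^esub>" using q[of "\<one>\<^bsub>A\<^esub>"] c(2) algebra_homsD(2)[OF f] by simp
    fix x y assume "x \<in> carrier ?Q" "y \<in> carrier ?Q"
    then obtain a b where ab: "a \<in> carrier A" "x = ?N +>\<^bsub>A\<^esub> a" "b \<in> carrier A" "y = ?N +>\<^bsub>A\<^esub> b"
      unfolding quot_module_carrier by blast
    have "x \<otimes>\<^bsub>?Q\<^esub> y = ?N +>\<^bsub>A\<^esub> (a \<otimes>\<^bsub>A\<^esub> b)" using c(3)[OF ab(1,3)] ab(2,4) by simp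
    then show "quot_lift f (x \<otimes>\<^bsub>?Q\<^esub> y) = quot_lift f x \<otimes>\<^bsub>B\<^esub> quot_lift f y"
      using q[OF ab(1)] q[OF ab(3)] q[of "a \<otimes>\<^bsub>A\<^esub> b"] ab algebra_homsD(3)[OF f ab(1,3)] by simp
  qed
qed

section \<open>Free algebras and tensor algebras\<close>

lemma free_algebra_simps:
  "carrier (free_algebra K X) = carrier (free_module K (lists X))"
  "add (free_algebra K X) = add (free_module K (lists X))"
  "zero (free_algebra K X) = zero (free_module K (lists X))"
  "smult (free_algebra K X) = smult (free_module K (lists X))"
  "one (free_algebra K X) = basis_elem K []"
  "mult (free_algebra K X) = (\<lambda>f g w. \<Oplus>\<^bsub>K\<^esub>i\<in>{..length w}. f (take i w) \<otimes>\<^bsub>K\<^esub> g (drop i w))"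
  by (simp_all add: free_algebra_def)

lemma linear_maps_free_algebra: "linear_maps K (free_algebra K X) U = linear_maps K (free_module K (lists X)) U"
  by (simp add: linear_maps_def free_algebra_simps(1-4) del: free_module_simps)

lemma module_free_algebra:
  assumes "cring K"
  shows "module K (free_algebra K X)"
  by (rule module_same_fields[OF module_free_module[OF assms]]) (simp_all only: free_algebra_simps)

text \<open>The support of a product lies in the finite set of concatenations of words from the two supports.\<close>

lemma free_algebra_mult_closed:
  assumes "cring K" "f \<in> carrier (free_algebra K X)" "g \<in> carrier (free_algebra K X)"
  shows "f \<otimes>\<^bsub>free_algebra K X\<^esub> g \<in> carrier (free_algebra K X)"
proof -
  interpret K: cring K by fact
  let ?S = "\<lambda>f. {s. f s \<noteq> \<zero>\<^bsub>K\<^esub>}"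
  let ?h = "f \<otimes>\<^bsub>free_algebra K X\<^esub> g"
  have fg: "\<And>w. f w \<in> carrier K" "\<And>w. g w \<in> carrier K" "finite (?S f)" "finite (?S g)"
    "?S f \<subseteq> lists X" "?S g \<subseteq> lists X"
    using assms(2,3) by (auto simp: free_algebra_simps(1) free_module_carrier)
  have h: "?h w = (\<Oplus>\<^bsub>K\<^esub>i\<in>{..length w}. f (take i w) \<otimes>\<^bsub>K\<^esub> g (drop i w))" for w
    by (simp add: free_algebra_simps)
  have "?S ?h \<subseteq> (\<lambda>(u, v). u @ v) ` (?S f \<times> ?S g)"
  proof
    fix w assume w: "w \<in> ?S ?h"
    have "\<exists>i. f (take i w) \<otimes>\<^bsub>K\<^esub> g (drop i w) \<noteq> \<zero>\<^bsub>K\<^esub>"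
    proof (rule ccontr)
      assume "\<not> ?thesis"
      then have "?h w = \<zero>\<^bsub>K\<^esub>" unfolding h by (intro K.add.finprod_one_eqI) auto
      then show False using w by simp
    qed
    then obtain i where i: "f (take i w) \<otimes>\<^bsub>K\<^esub> g (drop i w) \<noteq> \<zero>\<^bsub>K\<^esub>" by blast
    then have "f (take i w) \<noteq> \<zero>\<^bsub>K\<^esub>" "g (drop i w) \<noteq> \<zero>\<^bsub>K\<^esub>" using fg by auto
    then have "(take i w, drop i w) \<in> ?S f \<times> ?S g" by simp
    then show "w \<in> (\<lambda>(u, v). u @ v) ` (?S f \<times> ?S g)"
      by (rule rev_image_eqI) simp
  qed
  moreover have "finite ((\<lambda>(u, v). u @ v) ` (?S f \<times> ?S g))" by (intro finite_imageI finite_cartesian_product fg)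
  moreover have "(\<lambda>(u, v). u @ v) ` (?S f \<times> ?S g) \<subseteq> lists X"
  proof
    fix w assume "w \<in> (\<lambda>(u, v). u @ v) ` (?S f \<times> ?S g)"
    then obtain u v where "u \<in> ?S f" "v \<in> ?S g" "w = u @ v" by (elim imageE SigmaE) simp
    then show "w \<in> lists X" using subsetD[OF fg(5), of u] subsetD[OF fg(6), of v] by simp
  qed
  moreover have "?h w \<in> carrier K" for w unfolding h using fg by (intro K.finsum_closed) auto
  ultimately show ?thesis
    unfolding free_algebra_simps(1) free_module_carrier by (intro conjI allI) (assumption, erule (1)
      finite_subset, erule (1) order_trans)
qed

lemma bilinear_free_algebra_mult:
  assumes "cring K"
  shows "mult (free_algebra K X) \<in> bilinear_maps K (free_algebra K X) (free_algebra K X) (free_algebra K X)"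
proof -
  interpret K: cring K by fact
  note cl = free_algebra_mult_closed[OF assms]
  have val: "\<And>f w. f \<in> carrier (free_algebra K X) \<Longrightarrow> f w \<in> carrier K"
    by (auto simp: free_algebra_simps(1) free_module_carrier)
  show ?thesis
  proof (rule bilinear_mapsI; rule linear_mapsI)
    fix f g assume fg: "f \<in> carrier (free_algebra K X)" "g \<in> carrier (free_algebra K X)"
    note vf = val[OF fg(1)] and vg = val[OF fg(2)]
    show "f \<otimes>\<^bsub>free_algebra K X\<^esub> g \<in> carrier (free_algebra K X)" by (rule cl[OF fg])
    show "f \<otimes>\<^bsub>free_algebra K X\<^esub> g \<in> carrier (free_algebra K X)" by (rule cl[OF fg])
    {
      fix c assume c: "c \<in> carrier K"
      show "(c \<odot>\<^bsub>free_algebra K X\<^esub> f) \<otimes>\<^bsub>free_algebra K X\<^esub> g = c \<odot>\<^bsub>free_algebra K X\<^esub> (f \<otimes>\<^bsub>free_algebra K X\<^esub> g)"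
        using c vf vg by (auto simp: free_algebra_simps fun_eq_iff K.m_assoc K.finsum_rdistr intro!: K.finsum_cong')
      show "f \<otimes>\<^bsub>free_algebra K X\<^esub> (c \<odot>\<^bsub>free_algebra K X\<^esub> g) = c \<odot>\<^bsub>free_algebra K X\<^esub> (f \<otimes>\<^bsub>free_algebra K X\<^esub> g)"
        using c vf vg by (auto simp: free_algebra_simps fun_eq_iff K.m_lcomm K.finsum_rdistr intro!: K.finsum_cong')
    }
    fix h assume h: "h \<in> carrier (free_algebra K X)"
    note vh = val[OF h]
    show "(f \<oplus>\<^bsub>free_algebra K X\<^esub> h) \<otimes>\<^bsub>free_algebra K X\<^esub> g
      = f \<otimes>\<^bsub>free_algebra K X\<^esub> g \<oplus>\<^bsub>free_algebra K X\<^esub> h \<otimes>\<^bsub>free_algebra K X\<^esub> g"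
      using vf vg vh by (auto simp: free_algebra_simps fun_eq_iff K.l_distr K.finsum_addf)
    show "f \<otimes>\<^bsub>free_algebra K X\<^esub> (g \<oplus>\<^bsub>free_algebra K X\<^esub> h)
      = f \<otimes>\<^bsub>free_algebra K X\<^esub> g \<oplus>\<^bsub>free_algebra K X\<^esub> f \<otimes>\<^bsub>free_algebra K X\<^esub> h"
      using vf vg vh by (auto simp: free_algebra_simps fun_eq_iff K.r_distr K.finsum_addf)
  qed
qed

text \<open>The only cut of a word \<open>w\<close> into \<open>u\<close> and \<open>v\<close> is the one at position \<open>length u\<close>; it exists only for
\<open>w = u @ v\<close>.\<close>

lemma basis_elem_mult:
  assumes "cring K"
  shows "basis_elem K u \<otimes>\<^bsub>free_algebra K X\<^esub> basis_elem K v = basis_elem K (u @ v)"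
proof
  fix w
  interpret K: cring K by fact
  have *: "basis_elem K u (take i w) \<otimes>\<^bsub>K\<^esub> basis_elem K v (drop i w)
    = (if i = length u then (if w = u @ v then \<one>\<^bsub>K\<^esub> else \<zero>\<^bsub>K\<^esub>) else \<zero>\<^bsub>K\<^esub>)" if "i \<in> {..length w}" for i
  proof -
    have L: "basis_elem K u (take i w) \<otimes>\<^bsub>K\<^esub> basis_elem K v (drop i w)
      = (if take i w = u \<and> drop i w = v then \<one>\<^bsub>K\<^esub> else \<zero>\<^bsub>K\<^esub>)" by (simp add: basis_elem_def)
    have iff: "take i w = u \<and> drop i w = v \<longleftrightarrow> i = length u \<and> w = u @ v"
    proof
      assume "take i w = u \<and> drop i w = v"
      then show "i = length u \<and> w = u @ v"
        using that append_take_drop_id[of i w] length_take[of i w] by simp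
    qed simp
    show ?thesis unfolding L iff by simp
  qed
  have "(basis_elem K u \<otimes>\<^bsub>free_algebra K X\<^esub> basis_elem K v) w
    = (\<Oplus>\<^bsub>K\<^esub>i\<in>{..length w}. if i = length u then (if w = u @ v then \<one>\<^bsub>K\<^esub> else \<zero>\<^bsub>K\<^esub>) else \<zero>\<^bsub>K\<^esub>)"
    unfolding free_algebra_simps by (rule K.finsum_cong') (use * in auto)
  also have "\<dots> = basis_elem K (u @ v) w"
  proof (cases "w = u @ v")
    case True
    then have "length u \<in> {..length w}" by simp
    from K.add.finprod_singleton_swap[OF this, of "\<lambda>_. \<one>\<^bsub>K\<^esub>"] True
    show ?thesis by (simp add: basis_elem_def)
  next
    case False
    then show ?thesis by (simp add: basis_elem_def K.add.finprod_one_eqI)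
  qed
  finally show "(basis_elem K u \<otimes>\<^bsub>free_algebra K X\<^esub> basis_elem K v) w = basis_elem K (u @ v) w" .
qed

lemma linear_eq_on_words:
  assumes "module K U" "f \<in> linear_maps K (free_algebra K X) U" "g \<in> linear_maps K (free_algebra K X) U"
    and "\<And>w. w \<in> lists X \<Longrightarrow> f (basis_elem K w) = g (basis_elem K w)" "x \<in> carrier (free_algebra K X)"
  shows "f x = g x"
  using linear_eq_on_basis[OF assms(1), of f "lists X" g x] assms(2-)
  by (simp add: linear_maps_free_algebra free_algebra_simps)

text \<open>By multilinearity the laws need only be checked on words, where the product is concatenation.\<close>

lemma unital_algebra_free_algebra:
  assumes "field K"
  shows "unital_algebra K (free_algebra K X)"
proof -
  let ?F = "free_algebra K X"
  interpret K: field K by fact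
  have cr: "cring K" by (rule K.is_cring)
  note F = module_free_algebra[OF cr, of X]
  note bm = bilinear_free_algebra_mult[OF cr, of X]
  note mc = bilinear_maps_closed[OF bm]
  note mr = linear_maps_comp[OF _ bilinear_mapsD(1)[OF bm]] linear_maps_comp[OF _ bilinear_mapsD(2)[OF bm]]
  note bb = basis_elem_mult[OF cr]
  have e: "basis_elem K w \<in> carrier ?F" if "w \<in> lists X" for w
    using basis_elem_closed[OF cr that] by (simp add: free_algebra_simps)
  show ?thesis
  proof (rule unital_algebraI[OF assms F bm])
    show one: "\<one>\<^bsub>?F\<^esub> \<in> carrier ?F" by (simp add: free_algebra_simps(5) e)
    show "\<one>\<^bsub>?F\<^esub> \<otimes>\<^bsub>?F\<^esub> x = x" if "x \<in> carrier ?F" for x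
      by (rule linear_eq_on_words[OF F _ _ _ that])
       (intro mr one linear_id, rule linear_id, simp add: free_algebra_simps(5) bb)
    show "x \<otimes>\<^bsub>?F\<^esub> \<one>\<^bsub>?F\<^esub> = x" if "x \<in> carrier ?F" for x
      by (rule linear_eq_on_words[OF F _ _ _ that])
       (intro mr one linear_id, rule linear_id, simp add: free_algebra_simps(5) bb)
    have ppp: "(basis_elem K u \<otimes>\<^bsub>?F\<^esub> basis_elem K v) \<otimes>\<^bsub>?F\<^esub> z = basis_elem K u \<otimes>\<^bsub>?F\<^esub> (basis_elem K v \<otimes>\<^bsub>?F\<^esub> z)"
      if "u \<in> lists X" "v \<in> lists X" "z \<in> carrier ?F" for u v z
      by (rule linear_eq_on_words[OF F _ _ _ that(3)])
        (intro mr mc linear_id e that, intro mr mc linear_id e that, simp add: bb)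
    have pp: "(basis_elem K u \<otimes>\<^bsub>?F\<^esub> y) \<otimes>\<^bsub>?F\<^esub> z = basis_elem K u \<otimes>\<^bsub>?F\<^esub> (y \<otimes>\<^bsub>?F\<^esub> z)"
      if "u \<in> lists X" "y \<in> carrier ?F" "z \<in> carrier ?F" for u y z
      by (rule linear_eq_on_words[OF F _ _ _ that(2)])
        (intro mr mc linear_id e that, intro mr mc linear_id e that, use ppp that in simp)
    show "(x \<otimes>\<^bsub>?F\<^esub> y) \<otimes>\<^bsub>?F\<^esub> z = x \<otimes>\<^bsub>?F\<^esub> (y \<otimes>\<^bsub>?F\<^esub> z)"
      if "x \<in> carrier ?F" "y \<in> carrier ?F" "z \<in> carrier ?F" for x y z
      by (rule linear_eq_on_words[OF F _ _ _ that(1)])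
        (intro mr mc linear_id e that, intro mr mc linear_id e that, use pp that in simp)
  qed
qed

definition word_prod :: "('k, 'b) module \<Rightarrow> ('x \<Rightarrow> 'b) \<Rightarrow> 'x list \<Rightarrow> 'b" where
  "word_prod B \<phi> w = foldr (\<lambda>a r. \<phi> a \<otimes>\<^bsub>B\<^esub> r) w \<one>\<^bsub>B\<^esub>"

lemma word_prod_simps [simp]:
  "word_prod B \<phi> [] = \<one>\<^bsub>B\<^esub>" "word_prod B \<phi> (a # w) = \<phi> a \<otimes>\<^bsub>B\<^esub> word_prod B \<phi> w"
  by (simp_all add: word_prod_def)

lemma word_prod_closed:
  assumes "unital_algebra K B" "\<phi> \<in> X \<rightarrow> carrier B" "w \<in> lists X"
  shows "word_prod B \<phi> w \<in> carrier B"
proof -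
  interpret B: unital_algebra K B by fact
  show ?thesis using assms(3) by induction (use assms(2) in \<open>auto simp: Pi_def\<close>)
qed

lemma word_prod_append:
  assumes "unital_algebra K B" "\<phi> \<in> X \<rightarrow> carrier B" "u \<in> lists X" "v \<in> lists X"
  shows "word_prod B \<phi> (u @ v) = word_prod B \<phi> u \<otimes>\<^bsub>B\<^esub> word_prod B \<phi> v"
proof -
  interpret B: unital_algebra K B by fact
  note c = word_prod_closed[OF assms(1,2)]
  show ?thesis using assms(3) by induction (use assms(2) in \<open>auto simp: Pi_def c assms(4) B.m_assoc\<close>)
qed

lemma algebra_hom_word_prod:
  assumes "unital_algebra K A" "f \<in> algebra_homs K A B" "\<phi> \<in> X \<rightarrow> carrier A" "w \<in> lists X"
  shows "f (word_prod A \<phi> w) = word_prod B (\<lambda>a. f (\<phi> a)) w"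
  using assms(4)
  by induction (use assms(3) in \<open>auto simp: Pi_def algebra_homsD[OF assms(2)] word_prod_closed[OF assms(1,3)]\<close>)

text \<open>The universal property of the free algebra: the linear extension of \<open>word_prod\<close> is multiplicative because
  it is so on words.\<close>

lemma free_algebra_lift:
  assumes "unital_algebra K B" "\<phi> \<in> X \<rightarrow> carrier B"
  shows "free_extend K B (word_prod B \<phi>) \<in> algebra_homs K (free_algebra K X) B"
    and "w \<in> lists X \<Longrightarrow> free_extend K B (word_prod B \<phi>) (basis_elem K w) = word_prod B \<phi> w"
proof -
  let ?f = "free_extend K B (word_prod B \<phi>)" and ?F = "free_algebra K X"
  note b = unital_algebraD[OF assms(1)]
  have wp: "word_prod B \<phi> \<in> lists X \<rightarrow> carrier B" using word_prod_closed[OF assms] by auto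
  have fb: "?f (basis_elem K w) = word_prod B \<phi> w" if "w \<in> lists X" for w
    by (rule free_extend_basis[OF b(2) that wp])
  then show "w \<in> lists X \<Longrightarrow> ?f (basis_elem K w) = word_prod B \<phi> w" .
  have lin: "?f \<in> linear_maps K ?F B"
    unfolding linear_maps_free_algebra by (rule linear_free_extend[OF b(2) wp])
  have F: "unital_algebra K ?F" by (rule unital_algebra_free_algebra[OF b(3)])
  note fc = linear_maps_closed[OF lin]
  note mr = linear_maps_comp[OF _ bilinear_mapsD(1)[OF bilinear_mult[OF b(1)]]]
    linear_maps_comp[OF _ bilinear_mapsD(2)[OF bilinear_mult[OF b(1)]]]
    linear_maps_comp[OF linear_mult_left[OF unital_algebraD(1)[OF F] linear_id] lin]
    linear_maps_comp[OF linear_mult_right[OF unital_algebraD(1)[OF F] linear_id] lin]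
  have e: "basis_elem K w \<in> carrier ?F" if "w \<in> lists X" for w
    using basis_elem_closed[OF b(5) that] by (simp add: free_algebra_simps)
  have p: "?f (basis_elem K u \<otimes>\<^bsub>?F\<^esub> y) = ?f (basis_elem K u) \<otimes>\<^bsub>B\<^esub> ?f y" if "u \<in> lists X" "y \<in> carrier ?F" for u y
    by (rule linear_eq_on_words[OF b(2) _ _ _ that(2)])
      (intro mr lin fc e that, intro mr lin fc e that,
        use that in \<open>simp add: basis_elem_mult[OF b(5)] fb word_prod_append[OF assms]\<close>)
  show "?f \<in> algebra_homs K ?F B"
  proof (rule algebra_homsI[OF lin])
    show "?f \<one>\<^bsub>?F\<^esub> = \<one>\<^bsub>B\<^esub>" by (simp add: free_algebra_simps(5) fb)
    show "?f (x \<otimes>\<^bsub>?F\<^esub> y) = ?f x \<otimes>\<^bsub>B\<^esub> ?f y" if "x \<in> carrier ?F" "y \<in> carrier ?F" for x y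
      by (rule linear_eq_on_words[OF b(2) _ _ _ that(1)])
        (intro mr lin fc e that, intro mr lin fc e that, use that p in simp)
  qed
qed

lemma free_algebra_induct:
  assumes "cring K" "x \<in> carrier (free_algebra K X)"
    and "\<And>w. w \<in> lists X \<Longrightarrow> P (basis_elem K w)"
    and "\<And>x y. x \<in> carrier (free_algebra K X) \<Longrightarrow> y \<in> carrier (free_algebra K X) \<Longrightarrow> P x \<Longrightarrow> P y
      \<Longrightarrow> P (x \<oplus>\<^bsub>free_algebra K X\<^esub> y)"
    and "\<And>c x. c \<in> carrier K \<Longrightarrow> x \<in> carrier (free_algebra K X) \<Longrightarrow> P x \<Longrightarrow> P (c \<odot>\<^bsub>free_algebra K X\<^esub> x)"
  shows "P x"
proof -
  let ?F = "free_algebra K X" and ?M = "free_module K (lists X)"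
  interpret F: module K ?F by (rule module_free_algebra[OF assms(1)])
  have e: "basis_elem K w \<in> carrier ?F" if "w \<in> lists X" for w
    using basis_elem_closed[OF assms(1) that] by (simp add: free_algebra_simps)
  have zero: "P \<zero>\<^bsub>?F\<^esub>"
    using assms(5)[OF F.R.zero_closed e[of "[]"] assms(3)[of "[]"]] F.smult_l_null[OF e[of "[]"]] by simp
  have x: "\<And>s. x s \<in> carrier K" "finite {s. x s \<noteq> \<zero>\<^bsub>K\<^esub>}" "{s. x s \<noteq> \<zero>\<^bsub>K\<^esub>} \<subseteq> lists X"
    using assms(2) by (auto simp: free_algebra_simps(1) free_module_carrier)
  have "P (\<Oplus>\<^bsub>?F\<^esub>s\<in>A. x s \<odot>\<^bsub>?F\<^esub> basis_elem K s)" if "finite A" "A \<subseteq> lists X" for A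
    using that
  proof (induction A)
    case empty
    then show ?case using zero by simp
  next
    case (insert a A)
    have cl: "x s \<odot>\<^bsub>?F\<^esub> basis_elem K s \<in> carrier ?F" if "s \<in> insert a A" for s
      using insert.prems x(1) e that by (intro F.smult_closed) auto
    have "(\<Oplus>\<^bsub>?F\<^esub>s\<in>insert a A. x s \<odot>\<^bsub>?F\<^esub> basis_elem K s)
      = x a \<odot>\<^bsub>?F\<^esub> basis_elem K a \<oplus>\<^bsub>?F\<^esub> (\<Oplus>\<^bsub>?F\<^esub>s\<in>A. x s \<odot>\<^bsub>?F\<^esub> basis_elem K s)"
      by (rule F.finsum_insert) (use insert cl in auto)
    moreover have "P (x a \<odot>\<^bsub>?F\<^esub> basis_elem K a)"
      using insert.prems by (intro assms(3,5) x(1) e) auto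
    moreover have "(\<Oplus>\<^bsub>?F\<^esub>s\<in>A. x s \<odot>\<^bsub>?F\<^esub> basis_elem K s) \<in> carrier ?F"
      using cl by (intro F.finsum_closed) auto
    ultimately show ?case using assms(4) cl insert by simp
  qed
  from this[OF x(2,3)] have "P (free_extend K ?F (basis_elem K) x)" by (simp add: free_extend_def)
  moreover have "free_extend K ?F (basis_elem K) x = free_extend K ?M (basis_elem K) x"
    by (simp add: free_extend_def finsum_def free_algebra_simps(1-4) del: free_module_simps)
  ultimately show ?thesis
    using free_extend_basis_elem[OF assms(1), of x "lists X"] assms(2) by (simp add: free_algebra_simps(1))
qed

lemma word_prod_basis_elem:
  assumes "cring K" "w \<in> lists X"
  shows "word_prod (free_algebra K X) (\<lambda>a. basis_elem K [a]) w = basis_elem K w"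
  using assms(2) by induction (simp_all add: free_algebra_simps(5) basis_elem_mult[OF assms(1)])

text \<open>The generators of \<open>tensor_algebra_ideal\<close>; a homomorphism out of the tensor algebra is a homomorphism
out of the free algebra that kills them.\<close>

definition linearity_relations :: "'k ring \<Rightarrow> ('k, 'v) module \<Rightarrow> ('v list \<Rightarrow> 'k) set" where
  "linearity_relations K V = (let F = free_algebra K (carrier V); e = (\<lambda>a. basis_elem K [a]) in
      {e (a \<oplus>\<^bsub>V\<^esub> b) \<ominus>\<^bsub>F\<^esub> e a \<ominus>\<^bsub>F\<^esub> e b |a b. a \<in> carrier V \<and> b \<in> carrier V} \<union>
       {e (c \<odot>\<^bsub>V\<^esub> a) \<ominus>\<^bsub>F\<^esub> (c \<odot>\<^bsub>F\<^esub> e a) |c a. c \<in> carrier K \<and> a \<in> carrier V})"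

lemma tensor_algebra_ideal_eq:
  "tensor_algebra_ideal K V = genideal (free_algebra K (carrier V)) (linearity_relations K V)"
  by (simp add: tensor_algebra_ideal_def linearity_relations_def Let_def)

lemma tensor_algebra:
  assumes "field K" "module K V"
  shows "unital_algebra K (tensor_algebra K V)"
    and "tensor_algebra_incl K V \<in> linear_maps K V (tensor_algebra K V)"
    and "(\<lambda>x. tensor_algebra_ideal K V +>\<^bsub>free_algebra K (carrier V)\<^esub> x)
      \<in> algebra_homs K (free_algebra K (carrier V)) (tensor_algebra K V)"
    and "linearity_relations K V \<subseteq> carrier (free_algebra K (carrier V))"
proof -
  let ?F = "free_algebra K (carrier V)" and ?I = "tensor_algebra_ideal K V" and ?T = "tensor_algebra K V"
  interpret V: module K V by fact
  have F: "unital_algebra K ?F" by (rule unital_algebra_free_algebra[OF assms(1)])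
  have mF: "module K ?F" by (rule unital_algebraD(2)[OF F])
  interpret F: module K ?F by (rule mF)
  interpret F: ring ?F by (rule unital_algebra_ring[OF F])
  have e: "basis_elem K [a] \<in> carrier ?F" if "a \<in> carrier V" for a
    using basis_elem_closed[OF V.is_cring, of "[a]" "lists (carrier V)"] that by (simp add: free_algebra_simps)
  show R: "linearity_relations K V \<subseteq> carrier ?F"
    unfolding linearity_relations_def Let_def
    by (intro Un_least subsetI; elim CollectE exE conjE; hypsubst; intro F.M.minus_closed e F.smult_closed; simp)
  have I: "ideal ?I ?F" unfolding tensor_algebra_ideal_eq by (rule F.genideal_ideal[OF R])
  have RI: "linearity_relations K V \<subseteq> ?I" unfolding tensor_algebra_ideal_eq by (rule F.genideal_self[OF R])
  note s = ideal_submodule[OF F I]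
  show "unital_algebra K ?T" "(\<lambda>x. ?I +>\<^bsub>?F\<^esub> x) \<in> algebra_homs K ?F ?T"
    unfolding tensor_algebra_def by (rule coset_algebra_hom[OF F I])+
  show "tensor_algebra_incl K V \<in> linear_maps K V ?T"
  proof (rule linear_mapsI)
    fix a assume a: "a \<in> carrier V"
    show "tensor_algebra_incl K V a \<in> carrier ?T"
      using e[OF a] unfolding tensor_algebra_incl_def tensor_algebra_def quot_module_carrier by blast
    {
      fix b assume b: "b \<in> carrier V"
      have "basis_elem K [a \<oplus>\<^bsub>V\<^esub> b] \<ominus>\<^bsub>?F\<^esub> basis_elem K [a] \<ominus>\<^bsub>?F\<^esub> basis_elem K [b] \<in> ?I"
        using a b by (intro subsetD[OF RI]) (auto simp: linearity_relations_def Let_def)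
      moreover have "basis_elem K [a \<oplus>\<^bsub>V\<^esub> b] \<ominus>\<^bsub>?F\<^esub> basis_elem K [a] \<ominus>\<^bsub>?F\<^esub> basis_elem K [b]
        = basis_elem K [a \<oplus>\<^bsub>V\<^esub> b] \<ominus>\<^bsub>?F\<^esub> (basis_elem K [a] \<oplus>\<^bsub>?F\<^esub> basis_elem K [b])"
        using e[OF a] e[OF b] e[OF V.M.a_closed[OF a b]] by (simp add: a_minus_def F.minus_add F.a_assoc)
      ultimately show "tensor_algebra_incl K V (a \<oplus>\<^bsub>V\<^esub> b)
        = tensor_algebra_incl K V a \<oplus>\<^bsub>?T\<^esub> tensor_algebra_incl K V b"
        using coset_add[OF mF s e[OF a] e[OF b]]
          coset_eq_iff[OF mF s e[OF V.M.a_closed[OF a b]] F.a_closed[OF e[OF a] e[OF b]]]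
        by (simp add: tensor_algebra_incl_def tensor_algebra_def)
    }
    fix c assume c: "c \<in> carrier K"
    have "basis_elem K [c \<odot>\<^bsub>V\<^esub> a] \<ominus>\<^bsub>?F\<^esub> (c \<odot>\<^bsub>?F\<^esub> basis_elem K [a]) \<in> ?I"
      using a c by (intro subsetD[OF RI]) (auto simp: linearity_relations_def Let_def)
    then show "tensor_algebra_incl K V (c \<odot>\<^bsub>V\<^esub> a) = c \<odot>\<^bsub>?T\<^esub> tensor_algebra_incl K V a"
      using coset_smult[OF mF s e[OF a] c]
        coset_eq_iff[OF mF s e[OF V.smult_closed[OF c a]] F.smult_closed[OF c e[OF a]]]
      by (simp add: tensor_algebra_incl_def tensor_algebra_def)
  qed
qed

text \<open>The homomorphism that \<open>\<phi>\<close> induces on the free algebra over the set of vectors kills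
\<open>linearity_relations\<close> because \<open>\<phi>\<close> is linear.\<close>

lemma tensor_algebra_lift:
  assumes V: "module K V" and B: "unital_algebra K B" and \<phi>: "\<phi> \<in> linear_maps K V B"
  obtains \<Phi> where "\<Phi> \<in> algebra_homs K (tensor_algebra K V) B"
    and "\<And>v. v \<in> carrier V \<Longrightarrow> \<Phi> (tensor_algebra_incl K V v) = \<phi> v"
proof -
  let ?F = "free_algebra K (carrier V)" and ?f = "free_extend K B (word_prod B \<phi>)"
  note b = unital_algebraD[OF B]
  interpret V: module K V by fact
  interpret B: unital_algebra K B by fact
  have F: "unital_algebra K ?F" by (rule unital_algebra_free_algebra[OF b(3)])
  note mF = unital_algebraD(2)[OF F]
  interpret F: module K ?F by (rule mF)
  have \<phi>c: "\<phi> v \<in> carrier B" if "v \<in> carrier V" for v using linear_maps_closed[OF \<phi> that] .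
  then have \<phi>B: "\<phi> \<in> carrier V \<rightarrow> carrier B" by auto
  note f = free_algebra_lift[OF B \<phi>B]
  note fl = algebra_homsD(1)[OF f(1)]
  have e: "basis_elem K [a] \<in> carrier ?F" if "a \<in> carrier V" for a
    using basis_elem_closed[OF V.is_cring, of "[a]" "lists (carrier V)"] that by (simp add: free_algebra_simps)
  have fe: "?f (basis_elem K [a]) = \<phi> a" if "a \<in> carrier V" for a
    using f(2)[of "[a]"] that \<phi>c by simp
  note R = tensor_algebra(4)[OF b(3) V]
  have z: "?f r = \<zero>\<^bsub>B\<^esub>" if "r \<in> linearity_relations K V" for r
  proof -
    note m = linear_maps_minus[OF mF b(2) fl] linear_maps_smult[OF fl]
    have "u \<oplus>\<^bsub>B\<^esub> v \<ominus>\<^bsub>B\<^esub> u \<ominus>\<^bsub>B\<^esub> v = \<zero>\<^bsub>B\<^esub>" if "u \<in> carrier B" "v \<in> carrier B" for u v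
      using that by (simp add: a_minus_def B.M.a_assoc B.M.a_comm[of v] B.M.r_neg2 B.M.r_neg)
    moreover have "u \<ominus>\<^bsub>B\<^esub> u = \<zero>\<^bsub>B\<^esub>" if "u \<in> carrier B" for u
      using that by (simp add: a_minus_def B.M.r_neg)
    ultimately show ?thesis using that
      unfolding linearity_relations_def Let_def
      by (elim UnE CollectE exE conjE; hypsubst)
        (simp_all add: m fe e \<phi>c linear_maps_add[OF \<phi>] linear_maps_smult[OF \<phi>])
  qed
  show thesis
  proof (rule that)
    show "quot_lift ?f \<in> algebra_homs K (tensor_algebra K V) B"
      unfolding tensor_algebra_def tensor_algebra_ideal_eq by (rule quot_algebra_lift(1)[OF F B f(1) R z])
    show "quot_lift ?f (tensor_algebra_incl K V v) = \<phi> v" if "v \<in> carrier V" for v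
      unfolding tensor_algebra_incl_def tensor_algebra_ideal_eq
      using quot_algebra_lift(2)[OF F B f(1) R z e[OF that]] fe[OF that] by simp
  qed
qed

text \<open>The images of the words of the free algebra span the tensor algebra.\<close>

lemma tensor_algebra_induct:
  assumes K: "field K" and V: "module K V" and x: "x \<in> carrier (tensor_algebra K V)"
    and P: "\<And>w. w \<in> lists (carrier V) \<Longrightarrow> P (word_prod (tensor_algebra K V) (tensor_algebra_incl K V) w)"
      "\<And>x y. x \<in> carrier (tensor_algebra K V) \<Longrightarrow> y \<in> carrier (tensor_algebra K V) \<Longrightarrow> P x \<Longrightarrow> P y
        \<Longrightarrow> P (x \<oplus>\<^bsub>tensor_algebra K V\<^esub> y)"
      "\<And>c x. c \<in> carrier K \<Longrightarrow> x \<in> carrier (tensor_algebra K V) \<Longrightarrow> P x \<Longrightarrow> P (c \<odot>\<^bsub>tensor_algebra K V\<^esub> x)"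
  shows "P x"
proof -
  let ?F = "free_algebra K (carrier V)" and ?I = "tensor_algebra_ideal K V"
  interpret V: module K V by fact
  note h = tensor_algebra(3)[OF K V]
  note l = algebra_homsD(1)[OF h]
  have F: "unital_algebra K ?F" by (rule unital_algebra_free_algebra[OF K])
  have e: "basis_elem K [a] \<in> carrier ?F" if "a \<in> carrier V" for a
    using basis_elem_closed[OF V.is_cring, of "[a]" "lists (carrier V)"] that by (simp add: free_algebra_simps)
  obtain y where y: "y \<in> carrier ?F" "x = ?I +>\<^bsub>?F\<^esub> y"
    using x unfolding tensor_algebra_def quot_module_carrier by blast
  have "P (?I +>\<^bsub>?F\<^esub> y)"
    using y(1)
  proof (rule free_algebra_induct[OF V.is_cring])
    fix w assume w: "w \<in> lists (carrier V)"
    have "?I +>\<^bsub>?F\<^esub> basis_elem K w = ?I +>\<^bsub>?F\<^esub> word_prod ?F (\<lambda>a. basis_elem K [a]) w"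
      using word_prod_basis_elem[OF V.is_cring w] by simp
    also have "\<dots> = word_prod (tensor_algebra K V) (tensor_algebra_incl K V) w"
      using algebra_hom_word_prod[OF F h _ w, of "\<lambda>a. basis_elem K [a]"] e
      by (auto simp: tensor_algebra_incl_def[abs_def])
    finally show "P (?I +>\<^bsub>?F\<^esub> basis_elem K w)" using P(1)[OF w] by simp
  qed (simp_all add: linear_maps_add[OF l] linear_maps_smult[OF l] P linear_maps_closed[OF l])
  then show ?thesis using y by simp
qed

section \<open>Sweedler calculus\<close>

lemma tensor_map_eq: "tensor_map K C D f g t = tensor_lift K (tensor_prod K C D)
  (\<lambda>a b. pure_tensor K C D (f a) (g b)) t"
  by (simp add: tensor_map_def)

text \<open>Both sides of coassociativity, written as iterated Sweedler sums over the trilinear map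
\<open>(a, b, c) \<mapsto> a \<otimes> (b \<otimes> c)\<close>; this form serves to use coassociativity of \<open>H\<close> and to establish that of \<open>H\<^sub>p\<^sub>a\<^sub>r\<close>.\<close>

lemma coassociative_eq:
  fixes A :: "('k, 'a) module"
  assumes A: "module K A" and \<Delta>: "\<Delta> \<in> linear_maps K A (tensor_prod K A A)" and x: "x \<in> carrier A"
  defines "AA \<equiv> tensor_prod K A A" and "T \<equiv> tensor_prod K A (tensor_prod K A A)"
  shows "tensor_assoc K A A A (tensor_map K AA A \<Delta> (\<lambda>y. y) (\<Delta> x))
      = tensor_lift K T (\<lambda>a b. tensor_lift K T (\<lambda>c d. pure_tensor K A AA c (pure_tensor K A A d b)) (\<Delta> a)) (\<Delta> x)"
    and "tensor_map K A AA (\<lambda>y. y) \<Delta> (\<Delta> x)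
      = tensor_lift K T (\<lambda>a b. tensor_lift K T (\<lambda>c d. pure_tensor K A AA a (pure_tensor K A A c d)) (\<Delta> b)) (\<Delta> x)"
proof -
  have AA: "module K AA" unfolding AA_def by (rule module_tensor_prod[OF A A])
  have T: "module K T" unfolding T_def AA_def[symmetric] by (rule module_tensor_prod[OF A AA])
  have T': "T = tensor_prod K A AA" by (simp add: T_def AA_def)
  have AAA: "module K (tensor_prod K AA A)" by (rule module_tensor_prod[OF AA A])
  have \<Delta>c: "\<Delta> y \<in> carrier AA" if "y \<in> carrier A" for y
    using linear_maps_closed[OF \<Delta> that] by (simp add: AA_def)
  have \<Delta>c': "\<Delta> y \<in> carrier (tensor_prod K A A)" if "y \<in> carrier A" for y
    using linear_maps_closed[OF \<Delta> that] .
  note pc = pure_tensor_closed[OF A A, folded AA_def] pure_tensor_closed[OF A AA, folded T']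
    pure_tensor_closed[OF AA A]
  let ?g = "\<lambda>t c. tensor_lift K T (\<lambda>a b. pure_tensor K A AA a (pure_tensor K A A b c)) t"
  have pl: "(\<lambda>x. pure_tensor K A AA (f x) b) \<in> linear_maps K X T" if "f \<in> linear_maps K X A" "b \<in> carrier AA"
    for f b and X :: "('k, 'x) module"
    unfolding T' by (rule linear_pure_left[OF A AA that])
  have pr: "(\<lambda>x. pure_tensor K A AA b (f x)) \<in> linear_maps K X T" if "f \<in> linear_maps K X AA" "b \<in> carrier A"
    for f b and X :: "('k, 'x) module"
    unfolding T' by (rule linear_pure_right[OF A AA that])
  note l = linear_id linear_pure_left[OF A A, folded AA_def] linear_pure_right[OF A A, folded AA_def] bilinear_mapsI
  have b1: "(\<lambda>a b. pure_tensor K A AA a (pure_tensor K A A b c)) \<in> bilinear_maps K A A T" if "c \<in> carrier A" for c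
    by (intro bilinear_mapsI pl pr) (intro l pc that; assumption)+
  have g: "?g \<in> bilinear_maps K AA A T"
  proof (rule bilinear_mapsI)
    fix c assume c: "c \<in> carrier A"
    show "(\<lambda>t. ?g t c) \<in> linear_maps K AA T"
      unfolding AA_def using linear_tensor_lift[OF A A T b1[OF c]] by (simp add: AA_def)
  next
    fix t assume t: "t \<in> carrier AA"
    show "(\<lambda>c. ?g t c) \<in> linear_maps K A T"
      by (rule linear_tensor_lift_param[OF A A A T t[unfolded AA_def]]) (intro pr l; assumption)
  qed
  have "tensor_assoc K A A A s = tensor_lift K T ?g s" for s
    by (simp add: tensor_assoc_def Let_def AA_def T_def)
  then have "tensor_assoc K A A A (tensor_map K AA A \<Delta> (\<lambda>y. y) (\<Delta> x))
    = tensor_lift K T (\<lambda>a b. tensor_lift K T ?g (pure_tensor K AA A (\<Delta> a) b)) (\<Delta> x)"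
    unfolding tensor_map_eq
    using linear_tensor_lift_comp[OF A A AAA T linear_tensor_lift[OF AA A T g] \<Delta>c'[OF x]] \<Delta>c pc by simp
  also have "\<dots> = tensor_lift K T (\<lambda>a b. ?g (\<Delta> a) b) (\<Delta> x)"
    by (rule tensor_lift_cong[OF A A T \<Delta>c'[OF x]])
      (simp_all add: tensor_lift_pure[OF AA A T g] \<Delta>c bilinear_maps_closed[OF g])
  finally show "tensor_assoc K A A A (tensor_map K AA A \<Delta> (\<lambda>y. y) (\<Delta> x))
      = tensor_lift K T (\<lambda>a b. tensor_lift K T (\<lambda>c d. pure_tensor K A AA c (pure_tensor K A A d b)) (\<Delta> a)) (\<Delta> x)" .
  have "tensor_lift K T (\<lambda>c d. pure_tensor K A AA a (pure_tensor K A A c d)) (\<Delta> b) = pure_tensor K A AA a (\<Delta> b)"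
    if "a \<in> carrier A" "b \<in> carrier A" for a b
    using linear_tensor_lift_comp[OF A A AA T pr[OF linear_id that(1)] \<Delta>c'[OF that(2)], of "pure_tensor K A A"]
      pc tensor_lift_pure_tensor[OF A A \<Delta>c'[OF that(2)]] by (simp add: AA_def)
  then show "tensor_map K A AA (\<lambda>y. y) \<Delta> (\<Delta> x)
      = tensor_lift K T (\<lambda>a b. tensor_lift K T (\<lambda>c d. pure_tensor K A AA a (pure_tensor K A A c d)) (\<Delta> b)) (\<Delta> x)"
    unfolding tensor_map_eq T'[symmetric]
    by (intro tensor_lift_cong[OF A A T \<Delta>c'[OF x]]) (simp_all add: pc \<Delta>c)
qed

text \<open>A trilinear map factors through the universal one of the previous lemma
  by a linear map, which is \<open>G\<close> in the proof.\<close>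

lemma tensor_lift_coassoc:
  fixes A :: "('k, 'a) module" and F :: "'a \<Rightarrow> 'a \<Rightarrow> 'a \<Rightarrow> 'u"
  assumes A: "module K A" and \<Delta>: "\<Delta> \<in> linear_maps K A (tensor_prod K A A)" and co: "coassociative K A \<Delta>"
    and U: "module K U" and x: "x \<in> carrier A"
    and F: "\<And>b c. b \<in> carrier A \<Longrightarrow> c \<in> carrier A \<Longrightarrow> (\<lambda>a. F a b c) \<in> linear_maps K A U"
      "\<And>a c. a \<in> carrier A \<Longrightarrow> c \<in> carrier A \<Longrightarrow> (\<lambda>b. F a b c) \<in> linear_maps K A U"
      "\<And>a b. a \<in> carrier A \<Longrightarrow> b \<in> carrier A \<Longrightarrow> (\<lambda>c. F a b c) \<in> linear_maps K A U"
  shows "tensor_lift K U (\<lambda>a b. tensor_lift K U (\<lambda>c d. F c d b) (\<Delta> a)) (\<Delta> x)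
    = tensor_lift K U (\<lambda>a b. tensor_lift K U (\<lambda>c d. F a c d) (\<Delta> b)) (\<Delta> x)"
proof -
  let ?AA = "tensor_prod K A A"
  let ?T = "tensor_prod K A ?AA"
  have AA: "module K ?AA" by (rule module_tensor_prod[OF A A])
  have T: "module K ?T" by (rule module_tensor_prod[OF A AA])
  have \<Delta>c: "\<Delta> y \<in> carrier ?AA" if "y \<in> carrier A" for y
    using linear_maps_closed[OF \<Delta> that] .
  have Fc: "F a b c \<in> carrier U" if "a \<in> carrier A" "b \<in> carrier A" "c \<in> carrier A" for a b c
    using linear_maps_closed[OF F(1)[OF that(2,3)] that(1)] .
  note pc = pure_tensor_closed[OF A A] pure_tensor_closed[OF A AA]
  have Fb: "(\<lambda>c d. F a c d) \<in> bilinear_maps K A A U" if "a \<in> carrier A" for a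
    by (rule bilinear_mapsI) (intro F that; assumption)+
  have h: "(\<lambda>a t. tensor_lift K U (\<lambda>c d. F a c d) t) \<in> bilinear_maps K A ?AA U"
    by (intro bilinear_mapsI linear_tensor_lift_param[OF A A A U] F linear_tensor_lift[OF A A U] Fb; assumption)
  define G where "G = tensor_lift K U (\<lambda>a t. tensor_lift K U (\<lambda>c d. F a c d) t)"
  have G: "G \<in> linear_maps K ?T U" unfolding G_def by (rule linear_tensor_lift[OF A AA U h])
  have Gp: "G (pure_tensor K A ?AA a (pure_tensor K A A b c)) = F a b c"
    if "a \<in> carrier A" "b \<in> carrier A" "c \<in> carrier A" for a b c
    using that by (simp add: G_def tensor_lift_pure[OF A AA U h] tensor_lift_pure[OF A A U Fb] pc)
  have G2: "G (tensor_lift K ?T (\<lambda>a b. tensor_lift K ?T (\<lambda>c d. p a b c d) (\<Delta> (q a b))) (\<Delta> x))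
     = tensor_lift K U (\<lambda>a b. tensor_lift K U (\<lambda>c d. G (p a b c d)) (\<Delta> (q a b))) (\<Delta> x)"
    if p: "\<And>a b c d. a \<in> carrier A \<Longrightarrow> b \<in> carrier A \<Longrightarrow> c \<in> carrier A \<Longrightarrow> d \<in> carrier A \<Longrightarrow> p a b c d \<in> carrier ?T"
      and q: "\<And>a b. a \<in> carrier A \<Longrightarrow> b \<in> carrier A \<Longrightarrow> q a b \<in> carrier A" for p q
  proof -
    have "G (tensor_lift K ?T (\<lambda>a b. tensor_lift K ?T (\<lambda>c d. p a b c d) (\<Delta> (q a b))) (\<Delta> x))
       = tensor_lift K U (\<lambda>a b. G (tensor_lift K ?T (\<lambda>c d. p a b c d) (\<Delta> (q a b)))) (\<Delta> x)"
      by (rule linear_tensor_lift_comp[OF A A T U G \<Delta>c[OF x]]) (intro tensor_lift_closed[OF A A T] \<Delta>c p q; assumption)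
    also have "\<dots> = tensor_lift K U (\<lambda>a b. tensor_lift K U (\<lambda>c d. G (p a b c d)) (\<Delta> (q a b))) (\<Delta> x)"
    proof (rule tensor_lift_cong[OF A A U \<Delta>c[OF x]])
      fix a b assume ab: "a \<in> carrier A" "b \<in> carrier A"
      show "G (tensor_lift K ?T (\<lambda>c d. p a b c d) (\<Delta> (q a b))) = tensor_lift K U (\<lambda>c d. G (p a b c d)) (\<Delta> (q a b))"
        by (rule linear_tensor_lift_comp[OF A A T U G \<Delta>c[OF q[OF ab]]]) (rule p[OF ab])
      show "tensor_lift K U (\<lambda>c d. G (p a b c d)) (\<Delta> (q a b)) \<in> carrier U"
        by (rule tensor_lift_closed[OF A A U \<Delta>c[OF q[OF ab]]]) (rule linear_maps_closed[OF G p[OF ab]])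
    qed
    finally show ?thesis .
  qed
  have "tensor_lift K ?T (\<lambda>a b. tensor_lift K ?T (\<lambda>c d. pure_tensor K A ?AA c (pure_tensor K A A d b)) (\<Delta> a)) (\<Delta> x)
    = tensor_lift K ?T (\<lambda>a b. tensor_lift K ?T (\<lambda>c d. pure_tensor K A ?AA a (pure_tensor K A A c d)) (\<Delta> b)) (\<Delta> x)"
    using co x coassociative_eq[OF A \<Delta> x] unfolding coassociative_def by simp
  from arg_cong[OF this, of G]
  have *: "tensor_lift K U (\<lambda>a b. tensor_lift K U (\<lambda>c d. G (pure_tensor K A ?AA c (pure_tensor K A A d b))) (\<Delta>
    a)) (\<Delta> x)
    = tensor_lift K U (\<lambda>a b. tensor_lift K U (\<lambda>c d. G (pure_tensor K A ?AA a (pure_tensor K A A c d))) (\<Delta> b)) (\<Delta> x)"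
    using G2[of "\<lambda>a b c d. pure_tensor K A ?AA c (pure_tensor K A A d b)" "\<lambda>a b. a"]
      G2[of "\<lambda>a b c d. pure_tensor K A ?AA a (pure_tensor K A A c d)" "\<lambda>a b. b"] pc by simp
  have "tensor_lift K U (\<lambda>a b. tensor_lift K U (\<lambda>c d. G (pure_tensor K A ?AA c (pure_tensor K A A d b))) (\<Delta> a)) (\<Delta> x)
    = tensor_lift K U (\<lambda>a b. tensor_lift K U (\<lambda>c d. F c d b) (\<Delta> a)) (\<Delta> x)"
    by (intro tensor_lift_cong[OF A A U] tensor_lift_closed[OF A A U] \<Delta>c x Gp Fc; assumption)
  moreover have "tensor_lift K U (\<lambda>a b. tensor_lift K U (\<lambda>c d. G (pure_tensor K A ?AA a (pure_tensor K A A c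
    d))) (\<Delta> b)) (\<Delta> x)
    = tensor_lift K U (\<lambda>a b. tensor_lift K U (\<lambda>c d. F a c d) (\<Delta> b)) (\<Delta> x)"
    by (intro tensor_lift_cong[OF A A U] tensor_lift_closed[OF A A U] \<Delta>c x Gp Fc; assumption)
  ultimately show ?thesis using * by simp
qed

section \<open>Sweedler calculus in a Hopf algebra\<close>

context hopf_algebra
begin

lemma algebra_H [simp, intro!]: "unital_algebra K H" "assoc_algebra K H" "module K H"
  by (unfold_locales)

lemma comult_closed [simp, intro!]: "h \<in> carrier H \<Longrightarrow> \<Delta> h \<in> carrier (tensor_prod K H H)"
  by (rule linear_maps_closed[OF comult_linear])

lemma antipode_closed [simp, intro!]: "h \<in> carrier H \<Longrightarrow> S h \<in> carrier H"
  by (rule linear_maps_closed[OF antipode_linear])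

lemma counit_closed [simp, intro!]: "h \<in> carrier H \<Longrightarrow> \<epsilon> h \<in> carrier K"
  using linear_maps_closed[OF counit_linear] by (simp add: self_module_simps)

abbreviation mult_H (infixl "\<bullet>" 70) where "a \<bullet> b \<equiv> a \<otimes>\<^bsub>H\<^esub> b"

lemma mult_H_closed [simp, intro!]: "h \<in> carrier H \<Longrightarrow> k \<in> carrier H \<Longrightarrow> h \<bullet> k \<in> carrier H"
  by (rule alg_closed)

abbreviation sweedler :: "('k, 'u) module \<Rightarrow> 'h \<Rightarrow> ('h \<Rightarrow> 'h \<Rightarrow> 'u) \<Rightarrow> 'u" where
  "sweedler U h f \<equiv> tensor_lift K U f (\<Delta> h)"

lemma sweedler_closed [intro!]:
  assumes "module K U" "h \<in> carrier H" "\<And>a b. a \<in> carrier H \<Longrightarrow> b \<in> carrier H \<Longrightarrow> f a b \<in> carrier U"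
  shows "sweedler U h f \<in> carrier U"
  by (rule tensor_lift_closed[of K H H]) (use assms in auto)

lemma sweedler_cong:
  assumes "module K U" "h \<in> carrier H" "\<And>a b. a \<in> carrier H \<Longrightarrow> b \<in> carrier H \<Longrightarrow> f a b = g a b"
    "\<And>a b. a \<in> carrier H \<Longrightarrow> b \<in> carrier H \<Longrightarrow> g a b \<in> carrier U"
  shows "sweedler U h f = sweedler U h g"
  by (rule tensor_lift_cong[of K H H]) (use assms in auto)

lemma linear_antipode: "f \<in> linear_maps K X H \<Longrightarrow> (\<lambda>x. S (f x)) \<in> linear_maps K X H"
  by (rule linear_maps_comp[OF _ antipode_linear])

lemma linear_comult: "f \<in> linear_maps K X H \<Longrightarrow> (\<lambda>x. \<Delta> (f x)) \<in> linear_maps K X (tensor_prod K H H)"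
  by (rule linear_maps_comp[OF _ comult_linear])

lemma linear_counit: "f \<in> linear_maps K X H \<Longrightarrow> (\<lambda>x. \<epsilon> (f x)) \<in> linear_maps K X (self_module K)"
  by (rule linear_maps_comp[OF _ counit_linear])

lemma linear_sweedler_arg:
  assumes "g \<in> linear_maps K X H" "module K U" "f \<in> bilinear_maps K H H U"
  shows "(\<lambda>x. sweedler U (g x) f) \<in> linear_maps K X U"
  by (rule linear_tensor_lift_arg[OF linear_comult[OF assms(1)]]) (use assms in auto)

lemma linear_sweedler_param:
  assumes "module K X" "module K U" "h \<in> carrier H"
    "\<And>a b. a \<in> carrier H \<Longrightarrow> b \<in> carrier H \<Longrightarrow> (\<lambda>x. f x a b) \<in> linear_maps K X U"
  shows "(\<lambda>x. sweedler U h (f x)) \<in> linear_maps K X U"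
  by (rule linear_tensor_lift_param[of K X H H]) (use assms in auto)

lemmas linear_sweedler = linear_id linear_mult_left linear_mult_right linear_pure_left linear_pure_right
  linear_smult_left linear_smult_right linear_antipode linear_counit linear_comult
  linear_sweedler_arg linear_sweedler_param bilinear_mapsI

lemma sweedler_swap:
  assumes "module K U" "h \<in> carrier H" "k \<in> carrier H"
    "\<And>a b c d. a \<in> carrier H \<Longrightarrow> b \<in> carrier H \<Longrightarrow> c \<in> carrier H \<Longrightarrow> d \<in> carrier H \<Longrightarrow> f a b c d \<in> carrier U"
  shows "sweedler U h (\<lambda>a b. sweedler U k (\<lambda>c d. f a b c d)) = sweedler U k (\<lambda>c d. sweedler U h (\<lambda>a b. f a b c d))"
  by (rule tensor_lift_swap[of K H H H H]) (use assms in auto)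

lemma linear_sweedler_comp:
  assumes "g \<in> linear_maps K U U'" "module K U" "module K U'" "h \<in> carrier H"
    "\<And>a b. a \<in> carrier H \<Longrightarrow> b \<in> carrier H \<Longrightarrow> f a b \<in> carrier U"
  shows "g (sweedler U h f) = sweedler U' h (\<lambda>a b. g (f a b))"
  by (rule linear_tensor_lift_comp[of K H H]) (use assms in auto)

lemma sweedler_coassoc:
  assumes "module K U" "h \<in> carrier H"
    and "\<And>b c. b \<in> carrier H \<Longrightarrow> c \<in> carrier H \<Longrightarrow> (\<lambda>a. F a b c) \<in> linear_maps K H U"
      "\<And>a c. a \<in> carrier H \<Longrightarrow> c \<in> carrier H \<Longrightarrow> (\<lambda>b. F a b c) \<in> linear_maps K H U"
      "\<And>a b. a \<in> carrier H \<Longrightarrow> b \<in> carrier H \<Longrightarrow> (\<lambda>c. F a b c) \<in> linear_maps K H U"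
  shows "sweedler U h (\<lambda>a b. sweedler U a (\<lambda>c d. F c d b)) = sweedler U h (\<lambda>a b. sweedler U b (\<lambda>c d. F a c d))"
  by (rule tensor_lift_coassoc[OF _ comult_linear comult_coassoc]) (use assms in auto)

lemma sweedler_mult:
  assumes "module K U" "h \<in> carrier H" "k \<in> carrier H" "f \<in> bilinear_maps K H H U"
  shows "sweedler U (h \<bullet> k) f = sweedler U h (\<lambda>a b. sweedler U k (\<lambda>c d. f (a \<bullet> c) (b \<bullet> d)))"
proof -
  have "\<Delta> (h \<bullet> k) = \<Delta> h \<otimes>\<^bsub>tensor_prod K H H\<^esub> \<Delta> k"
    by (rule ring_hom_mult[OF comult_hom]) (use assms in auto)
  then show ?thesis using tensor_lift_mult[of K H H U f] assms by simp
qed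

lemma sweedler_one:
  assumes "module K U" "f \<in> bilinear_maps K H H U"
  shows "sweedler U \<one>\<^bsub>H\<^esub> f = f \<one>\<^bsub>H\<^esub> \<one>\<^bsub>H\<^esub>"
  using ring_hom_one[OF comult_hom] tensor_lift_pure[of K H H U f] assms by (simp add: tensor_prod_simps(5))

lemma sweedler_counit_left:
  assumes "module K U" "g \<in> linear_maps K H U" "h \<in> carrier H"
  shows "sweedler U h (\<lambda>a b. \<epsilon> a \<odot>\<^bsub>U\<^esub> g b) = g h"
proof -
  have "g (sweedler H h (\<lambda>a b. \<epsilon> a \<odot>\<^bsub>H\<^esub> b)) = sweedler U h (\<lambda>a b. g (\<epsilon> a \<odot>\<^bsub>H\<^esub> b))"
    by (rule linear_sweedler_comp) (use assms in auto)
  also have "\<dots> = sweedler U h (\<lambda>a b. \<epsilon> a \<odot>\<^bsub>U\<^esub> g b)"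
    by (rule sweedler_cong) (use assms linear_maps_closed[OF assms(2)] in \<open>auto simp: linear_maps_smult[OF
      assms(2)] module.smult_closed\<close>)
  finally show ?thesis using counit_l[OF assms(3)] by simp
qed

lemma sweedler_counit_right:
  assumes "module K U" "g \<in> linear_maps K H U" "h \<in> carrier H"
  shows "sweedler U h (\<lambda>a b. \<epsilon> b \<odot>\<^bsub>U\<^esub> g a) = g h"
proof -
  have "g (sweedler H h (\<lambda>a b. \<epsilon> b \<odot>\<^bsub>H\<^esub> a)) = sweedler U h (\<lambda>a b. g (\<epsilon> b \<odot>\<^bsub>H\<^esub> a))"
    by (rule linear_sweedler_comp) (use assms in auto)
  also have "\<dots> = sweedler U h (\<lambda>a b. \<epsilon> b \<odot>\<^bsub>U\<^esub> g a)"
    by (rule sweedler_cong) (use assms linear_maps_closed[OF assms(2)] in \<open>auto simp: linear_maps_smult[OF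
      assms(2)] module.smult_closed\<close>)
  finally show ?thesis using counit_r[OF assms(3)] by simp
qed

lemma sweedler_antipode_left:
  assumes "module K U" "g \<in> linear_maps K H U" "h \<in> carrier H"
  shows "sweedler U h (\<lambda>a b. g (S a \<bullet> b)) = \<epsilon> h \<odot>\<^bsub>U\<^esub> g \<one>\<^bsub>H\<^esub>"
proof -
  have "g (sweedler H h (\<lambda>a b. S a \<bullet> b)) = sweedler U h (\<lambda>a b. g (S a \<bullet> b))"
    by (rule linear_sweedler_comp) (use assms in auto)
  then show ?thesis using antipode_l[OF assms(3)] assms by (simp add: convolution_def linear_maps_smult[OF assms(2)])
qed

lemma sweedler_antipode_right:
  assumes "module K U" "g \<in> linear_maps K H U" "h \<in> carrier H"
  shows "sweedler U h (\<lambda>a b. g (a \<bullet> S b)) = \<epsilon> h \<odot>\<^bsub>U\<^esub> g \<one>\<^bsub>H\<^esub>"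
proof -
  have "g (sweedler H h (\<lambda>a b. a \<bullet> S b)) = sweedler U h (\<lambda>a b. g (a \<bullet> S b))"
    by (rule linear_sweedler_comp) (use assms in auto)
  then show ?thesis using antipode_r[OF assms(3)] assms by (simp add: convolution_def linear_maps_smult[OF assms(2)])
qed

lemma counit_mult: "h \<in> carrier H \<Longrightarrow> k \<in> carrier H \<Longrightarrow> \<epsilon> (h \<bullet> k) = \<epsilon> h \<otimes>\<^bsub>K\<^esub> \<epsilon> k"
  by (rule ring_hom_mult[OF counit_hom])

lemma counit_one: "\<epsilon> \<one>\<^bsub>H\<^esub> = \<one>\<^bsub>K\<^esub>"
  by (rule ring_hom_one[OF counit_hom])

lemma antipode_one: "S \<one>\<^bsub>H\<^esub> = \<one>\<^bsub>H\<^esub>"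
proof -
  have "sweedler H \<one>\<^bsub>H\<^esub> (\<lambda>a b. S a \<bullet> b) = S \<one>\<^bsub>H\<^esub> \<bullet> \<one>\<^bsub>H\<^esub>"
    by (rule sweedler_one) (auto intro!: linear_sweedler)
  then show ?thesis using antipode_l[of "\<one>\<^bsub>H\<^esub>"] by (simp add: convolution_def counit_one)
qed

text \<open>A left inverse \<open>f\<close> and a right inverse \<open>k\<close> of \<open>g\<close> in the convolution algebra agree:
\<open>f h = f(h\<^sub>1) g(h\<^sub>2) k(h\<^sub>3) = k h\<close>.\<close>

lemma convolution_inverse_unique:
  assumes B: "unital_algebra K B"
    and f: "f \<in> linear_maps K H B" and g: "g \<in> linear_maps K H B" and k: "k \<in> linear_maps K H B"
    and fg: "\<And>h. h \<in> carrier H \<Longrightarrow> sweedler B h (\<lambda>a b. f a \<otimes>\<^bsub>B\<^esub> g b) = \<epsilon> h \<odot>\<^bsub>B\<^esub> \<one>\<^bsub>B\<^esub>"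
    and gk: "\<And>h. h \<in> carrier H \<Longrightarrow> sweedler B h (\<lambda>a b. g a \<otimes>\<^bsub>B\<^esub> k b) = \<epsilon> h \<odot>\<^bsub>B\<^esub> \<one>\<^bsub>B\<^esub>"
    and h: "h \<in> carrier H"
  shows "f h = k h"
proof -
  interpret B: unital_algebra K B by fact
  note b[simp] = unital_algebraD(1,2)[OF B]
  note l = linear_sweedler linear_maps_comp[OF _ f] linear_maps_comp[OF _ g] linear_maps_comp[OF _ k]
  note c[simp] = linear_maps_closed[OF f] linear_maps_closed[OF g] linear_maps_closed[OF k] B.alg_closed
  have "k h = sweedler B h (\<lambda>a b. \<epsilon> a \<odot>\<^bsub>B\<^esub> k b)"
    by (rule sweedler_counit_left[symmetric]) (use h k in auto)
  also have "\<dots> = sweedler B h (\<lambda>a b. sweedler B a (\<lambda>c d. (f c \<otimes>\<^bsub>B\<^esub> g d) \<otimes>\<^bsub>B\<^esub> k b))"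
  proof (rule sweedler_cong)
    fix a b assume ab: "a \<in> carrier H" "b \<in> carrier H"
    have "sweedler B a (\<lambda>c d. (f c \<otimes>\<^bsub>B\<^esub> g d) \<otimes>\<^bsub>B\<^esub> k b) = sweedler B a (\<lambda>c d. f c \<otimes>\<^bsub>B\<^esub> g d) \<otimes>\<^bsub>B\<^esub> k b"
      by (rule linear_sweedler_comp[OF linear_mult_left[OF b(1) linear_id], symmetric]) (use ab in auto)
    then show "\<epsilon> a \<odot>\<^bsub>B\<^esub> k b = sweedler B a (\<lambda>c d. (f c \<otimes>\<^bsub>B\<^esub> g d) \<otimes>\<^bsub>B\<^esub> k b)"
      using ab by (simp add: fg B.alg_smult_l)
  qed (use h in auto)
  also have "\<dots> = sweedler B h (\<lambda>c b. sweedler B b (\<lambda>d b. (f c \<otimes>\<^bsub>B\<^esub> g d) \<otimes>\<^bsub>B\<^esub> k b))"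
    by (rule sweedler_coassoc) (use h in \<open>auto intro!: l\<close>)
  also have "\<dots> = sweedler B h (\<lambda>c b. \<epsilon> b \<odot>\<^bsub>B\<^esub> f c)"
  proof (rule sweedler_cong)
    fix a b assume ab: "a \<in> carrier H" "b \<in> carrier H"
    have "sweedler B b (\<lambda>d b. (f a \<otimes>\<^bsub>B\<^esub> g d) \<otimes>\<^bsub>B\<^esub> k b) = sweedler B b (\<lambda>d b. f a \<otimes>\<^bsub>B\<^esub> (g d \<otimes>\<^bsub>B\<^esub> k b))"
      by (rule sweedler_cong) (use ab in \<open>auto simp: B.m_assoc\<close>)
    also have "\<dots> = f a \<otimes>\<^bsub>B\<^esub> sweedler B b (\<lambda>d b. g d \<otimes>\<^bsub>B\<^esub> k b)"
      by (rule linear_sweedler_comp[OF linear_mult_right[OF b(1) linear_id], symmetric]) (use ab in auto)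
    finally show "sweedler B b (\<lambda>d b. (f a \<otimes>\<^bsub>B\<^esub> g d) \<otimes>\<^bsub>B\<^esub> k b) = \<epsilon> b \<odot>\<^bsub>B\<^esub> f a"
      using ab by (simp add: gk B.alg_smult_r)
  qed (use h in auto)
  also have "\<dots> = f h"
    by (rule sweedler_counit_right) (use h f in auto)
  finally show ?thesis by simp
qed

end

context hopf_algebra
begin

lemma linear_sweedler_mult_left:
  assumes "assoc_algebra K B" "h \<in> carrier H" "c \<in> carrier B"
    "\<And>a b. a \<in> carrier H \<Longrightarrow> b \<in> carrier H \<Longrightarrow> f a b \<in> carrier B"
  shows "sweedler B h f \<otimes>\<^bsub>B\<^esub> c = sweedler B h (\<lambda>a b. f a b \<otimes>\<^bsub>B\<^esub> c)"
  by (rule linear_sweedler_comp[OF linear_mult_left[OF assms(1) linear_id assms(3)]])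
    (use assms assoc_algebraD in auto)

lemma linear_sweedler_mult_right:
  assumes "assoc_algebra K B" "h \<in> carrier H" "c \<in> carrier B"
    "\<And>a b. a \<in> carrier H \<Longrightarrow> b \<in> carrier H \<Longrightarrow> f a b \<in> carrier B"
  shows "c \<otimes>\<^bsub>B\<^esub> sweedler B h f = sweedler B h (\<lambda>a b. c \<otimes>\<^bsub>B\<^esub> f a b)"
  by (rule linear_sweedler_comp[OF linear_mult_right[OF assms(1) linear_id assms(3)]])
    (use assms assoc_algebraD in auto)

text \<open>\<open>S(h\<^sub>1 k) h\<^sub>2 = S(h\<^sub>1 k\<^sub>1) h\<^sub>2 k\<^sub>2 S(k\<^sub>3)\<close>, where the first factors form \<open>S(x\<^sub>1) x\<^sub>2\<close> for \<open>x = h k\<^sub>1\<close> in \<open>H\<close> and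
collapse to \<open>\<epsilon>(h) \<epsilon>(k\<^sub>1)\<close>.  Read from right to left in the proof.\<close>

lemma sweedler_antipode_mult_left:
  assumes h: "h \<in> carrier H" and k: "k \<in> carrier H"
  shows "sweedler H h (\<lambda>a b. S (a \<bullet> k) \<bullet> b) = \<epsilon> h \<odot>\<^bsub>H\<^esub> S k"
proof -
  have "\<epsilon> h \<odot>\<^bsub>H\<^esub> S k = sweedler H k (\<lambda>p q. \<epsilon> p \<odot>\<^bsub>H\<^esub> (\<epsilon> h \<odot>\<^bsub>H\<^esub> S q))"
    by (rule sweedler_counit_left[symmetric]) (use h k in \<open>auto intro!: linear_sweedler\<close>)
  also have "\<dots> = sweedler H k (\<lambda>p q. sweedler H h (\<lambda>a b. sweedler H p (\<lambda>c d. S (a \<bullet> c) \<bullet> (b \<bullet> d) \<bullet> S q)))"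
  proof (rule sweedler_cong)
    fix p q assume pq: "p \<in> carrier H" "q \<in> carrier H"
    have "sweedler H h (\<lambda>a b. sweedler H p (\<lambda>c d. S (a \<bullet> c) \<bullet> (b \<bullet> d) \<bullet> S q))
      = sweedler H (h \<bullet> p) (\<lambda>u v. S u \<bullet> v \<bullet> S q)"
      by (rule sweedler_mult[symmetric]) (use h pq in \<open>auto intro!: linear_sweedler\<close>)
    also have "\<dots> = \<epsilon> (h \<bullet> p) \<odot>\<^bsub>H\<^esub> (\<one>\<^bsub>H\<^esub> \<bullet> S q)"
      by (rule sweedler_antipode_left[of H "\<lambda>x. x \<bullet> S q"]) (use h pq in \<open>auto intro!: linear_sweedler\<close>)
    finally show "\<epsilon> p \<odot>\<^bsub>H\<^esub> (\<epsilon> h \<odot>\<^bsub>H\<^esub> S q)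
      = sweedler H h (\<lambda>a b. sweedler H p (\<lambda>c d. S (a \<bullet> c) \<bullet> (b \<bullet> d) \<bullet> S q))"
      using h pq by (simp add: counit_mult smult_assoc1[symmetric] m_comm)
  qed (use h k in auto)
  also have "\<dots> = sweedler H h (\<lambda>a b. sweedler H k (\<lambda>p q. sweedler H p (\<lambda>c d. S (a \<bullet> c) \<bullet> (b \<bullet> d) \<bullet> S q)))"
    by (rule sweedler_swap) (use h k in auto)
  also have "\<dots> = sweedler H h (\<lambda>a b. sweedler H k (\<lambda>c p. sweedler H p (\<lambda>d q. S (a \<bullet> c) \<bullet> (b \<bullet> d) \<bullet> S q)))"
    by (intro sweedler_cong sweedler_coassoc) (use h k in \<open>auto intro!: linear_sweedler\<close>)
  also have "\<dots> = sweedler H h (\<lambda>a b. S (a \<bullet> k) \<bullet> b)"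
  proof (rule sweedler_cong)
    fix a b assume ab: "a \<in> carrier H" "b \<in> carrier H"
    have "sweedler H k (\<lambda>c p. sweedler H p (\<lambda>d q. S (a \<bullet> c) \<bullet> (b \<bullet> d) \<bullet> S q))
      = sweedler H k (\<lambda>c p. \<epsilon> p \<odot>\<^bsub>H\<^esub> (S (a \<bullet> c) \<bullet> b))"
    proof (rule sweedler_cong)
      fix c p assume cp: "c \<in> carrier H" "p \<in> carrier H"
      have "sweedler H p (\<lambda>d q. S (a \<bullet> c) \<bullet> (b \<bullet> d) \<bullet> S q) = sweedler H p (\<lambda>d q. S (a \<bullet> c) \<bullet> b \<bullet> (d \<bullet> S q))"
        by (rule sweedler_cong) (use ab cp in \<open>auto simp: m_assoc\<close>)
      also have "\<dots> = \<epsilon> p \<odot>\<^bsub>H\<^esub> (S (a \<bullet> c) \<bullet> b \<bullet> \<one>\<^bsub>H\<^esub>)"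
        by (rule sweedler_antipode_right[of H "\<lambda>x. S (a \<bullet> c) \<bullet> b \<bullet> x"]) (use ab cp in \<open>auto intro!: linear_sweedler\<close>)
      finally show "sweedler H p (\<lambda>d q. S (a \<bullet> c) \<bullet> (b \<bullet> d) \<bullet> S q) = \<epsilon> p \<odot>\<^bsub>H\<^esub> (S (a \<bullet> c) \<bullet> b)"
        using ab cp by simp
    qed (use ab k in auto)
    also have "\<dots> = S (a \<bullet> k) \<bullet> b"
      by (rule sweedler_counit_right) (use ab k in \<open>auto intro!: linear_sweedler\<close>)
    finally show "sweedler H k (\<lambda>c p. sweedler H p (\<lambda>d q. S (a \<bullet> c) \<bullet> (b \<bullet> d) \<bullet> S q)) = S (a \<bullet> k) \<bullet> b" .
  qed (use h k in auto)
  finally show ?thesis by simp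
qed

text \<open>\<open>S(h k) = S(h\<^sub>1 k) h\<^sub>2 S(h\<^sub>3)\<close>, and the previous lemma evaluates the first two factors.\<close>

lemma antipode_mult:
  assumes h: "h \<in> carrier H" and k: "k \<in> carrier H"
  shows "S (h \<bullet> k) = S k \<bullet> S h"
proof -
  have "S (h \<bullet> k) = sweedler H h (\<lambda>a x. \<epsilon> x \<odot>\<^bsub>H\<^esub> (S (a \<bullet> k) \<bullet> \<one>\<^bsub>H\<^esub>))"
    by (subst sweedler_counit_right) (use h k in \<open>auto intro!: linear_sweedler\<close>)
  \<comment> \<open>The factor \<open>1\<close> inserted above is \<open>\<epsilon>(x) 1 = x\<^sub>1 S(x\<^sub>2)\<close>.\<close>
  also have "\<dots> = sweedler H h (\<lambda>a x. sweedler H x (\<lambda>b c. S (a \<bullet> k) \<bullet> (b \<bullet> S c)))"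
    by (intro sweedler_cong sweedler_antipode_right[symmetric]) (use h k in \<open>auto intro!: linear_sweedler\<close>)
  also have "\<dots> = sweedler H h (\<lambda>x c. sweedler H x (\<lambda>a b. S (a \<bullet> k) \<bullet> (b \<bullet> S c)))"
    by (rule sweedler_coassoc[symmetric]) (use h k in \<open>auto intro!: linear_sweedler\<close>)
  also have "\<dots> = sweedler H h (\<lambda>x c. \<epsilon> x \<odot>\<^bsub>H\<^esub> (S k \<bullet> S c))"
  proof (rule sweedler_cong)
    fix x c assume xc: "x \<in> carrier H" "c \<in> carrier H"
    have "sweedler H x (\<lambda>a b. S (a \<bullet> k) \<bullet> (b \<bullet> S c)) = sweedler H x (\<lambda>a b. S (a \<bullet> k) \<bullet> b \<bullet> S c)"
      by (rule sweedler_cong) (use xc k in \<open>auto simp: m_assoc\<close>)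
    also have "\<dots> = (\<epsilon> x \<odot>\<^bsub>H\<^esub> S k) \<bullet> S c"
      unfolding sweedler_antipode_mult_left[OF xc(1) k, symmetric]
      by (rule linear_sweedler_mult_left[symmetric]) (use xc k in auto)
    finally show "sweedler H x (\<lambda>a b. S (a \<bullet> k) \<bullet> (b \<bullet> S c)) = \<epsilon> x \<odot>\<^bsub>H\<^esub> (S k \<bullet> S c)"
      using xc k by (simp add: alg_smult_l)
  qed (use h k in auto)
  also have "\<dots> = S k \<bullet> S h"
    by (rule sweedler_counit_left) (use h k in \<open>auto intro!: linear_sweedler\<close>)
  finally show ?thesis .
qed

text \<open>By coassociativity both sides are \<open>\<Sum> G h\<^sub>1 h\<^sub>2 h\<^sub>3 h\<^sub>4\<close>; on the right \<open>h\<^sub>2\<close> and \<open>h\<^sub>3\<close> come from one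
comultiplication, so that cocommutativity can exchange them.\<close>

lemma sweedler_four:
  assumes U: "module K U" and h: "h \<in> carrier H"
    and G: "\<And>b c d. b \<in> carrier H \<Longrightarrow> c \<in> carrier H \<Longrightarrow> d \<in> carrier H \<Longrightarrow> (\<lambda>a. G a b c d) \<in> linear_maps K H U"
      "\<And>a c d. a \<in> carrier H \<Longrightarrow> c \<in> carrier H \<Longrightarrow> d \<in> carrier H \<Longrightarrow> (\<lambda>b. G a b c d) \<in> linear_maps K H U"
      "\<And>a b d. a \<in> carrier H \<Longrightarrow> b \<in> carrier H \<Longrightarrow> d \<in> carrier H \<Longrightarrow> (\<lambda>c. G a b c d) \<in> linear_maps K H U"
      "\<And>a b c. a \<in> carrier H \<Longrightarrow> b \<in> carrier H \<Longrightarrow> c \<in> carrier H \<Longrightarrow> (\<lambda>d. G a b c d) \<in> linear_maps K H U"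
  shows "sweedler U h (\<lambda>x y. sweedler U x (\<lambda>a b. sweedler U y (\<lambda>c d. G a b c d)))
    = sweedler U h (\<lambda>a x. sweedler U x (\<lambda>y d. sweedler U y (\<lambda>b c. G a b c d)))"
proof -
  have Gc: "G a b c d \<in> carrier U" if "a \<in> carrier H" "b \<in> carrier H" "c \<in> carrier H" "d \<in> carrier H" for a b c d
    using linear_maps_closed[OF G(1)] that by auto
  have "sweedler U h (\<lambda>x y. sweedler U x (\<lambda>a b. sweedler U y (\<lambda>c d. G a b c d)))
    = sweedler U h (\<lambda>a x. sweedler U x (\<lambda>b y. sweedler U y (\<lambda>c d. G a b c d)))"
    by (rule sweedler_coassoc) (use U h in \<open>auto intro!: linear_sweedler G\<close>)
  also have "\<dots> = sweedler U h (\<lambda>a x. sweedler U x (\<lambda>y d. sweedler U y (\<lambda>b c. G a b c d)))"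
    by (intro sweedler_cong sweedler_coassoc[symmetric]) (use U h in \<open>auto intro!: G Gc sweedler_closed\<close>)
  finally show ?thesis .
qed

end

section \<open>The antipode of a cocommutative Hopf algebra\<close>

locale cocommutative_hopf_algebra = hopf_algebra K H \<Delta> \<epsilon> S
  for K :: "'k ring" and H :: "('k, 'h) module"
    and \<Delta> :: "'h \<Rightarrow> ('h \<times> 'h \<Rightarrow> 'k) set" and \<epsilon> :: "'h \<Rightarrow> 'k" and S :: "'h \<Rightarrow> 'h" +
  assumes cocommutative: "cocommutative K H \<Delta>"
begin

lemma sweedler_cocomm:
  assumes "module K U" "h \<in> carrier H" "f \<in> bilinear_maps K H H U"
  shows "sweedler U h f = sweedler U h (\<lambda>a b. f b a)"
proof -
  let ?T = "tensor_prod K H H"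
  have T: "module K ?T" by (rule module_tensor_prod) auto
  have "sweedler U h f = tensor_lift K U f (tensor_flip K H H (\<Delta> h))"
    using cocommutative assms(2) by (simp add: cocommutative_def)
  also have "\<dots> = sweedler U h (\<lambda>a b. tensor_lift K U f (pure_tensor K H H b a))"
    unfolding tensor_flip_def
    by (rule linear_sweedler_comp[OF linear_tensor_lift[OF _ _ assms(1,3)]])
      (use assms T in \<open>auto intro!: pure_tensor_closed\<close>)
  also have "\<dots> = sweedler U h (\<lambda>a b. f b a)"
    by (rule sweedler_cong) (use assms in \<open>auto simp: tensor_lift_pure bilinear_maps_closed[OF assms(3)]\<close>)
  finally show ?thesis .
qed

text \<open>\<open>sweedler_four\<close> brings \<open>h\<^sub>2\<close> and \<open>h\<^sub>3\<close> together, cocommutativity exchanges them, and \<open>sweedler_four\<close>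
restores the bracketing.\<close>

lemma sweedler_interchange:
  assumes U: "module K U" and h: "h \<in> carrier H"
    and G: "\<And>b c d. b \<in> carrier H \<Longrightarrow> c \<in> carrier H \<Longrightarrow> d \<in> carrier H \<Longrightarrow> (\<lambda>a. G a b c d) \<in> linear_maps K H U"
      "\<And>a c d. a \<in> carrier H \<Longrightarrow> c \<in> carrier H \<Longrightarrow> d \<in> carrier H \<Longrightarrow> (\<lambda>b. G a b c d) \<in> linear_maps K H U"
      "\<And>a b d. a \<in> carrier H \<Longrightarrow> b \<in> carrier H \<Longrightarrow> d \<in> carrier H \<Longrightarrow> (\<lambda>c. G a b c d) \<in> linear_maps K H U"
      "\<And>a b c. a \<in> carrier H \<Longrightarrow> b \<in> carrier H \<Longrightarrow> c \<in> carrier H \<Longrightarrow> (\<lambda>d. G a b c d) \<in> linear_maps K H U"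
  shows "sweedler U h (\<lambda>x y. sweedler U x (\<lambda>a b. sweedler U y (\<lambda>c d. G a b c d)))
    = sweedler U h (\<lambda>x y. sweedler U x (\<lambda>a b. sweedler U y (\<lambda>c d. G a c b d)))"
proof -
  have Gc: "G a b c d \<in> carrier U" if "a \<in> carrier H" "b \<in> carrier H" "c \<in> carrier H" "d \<in> carrier H" for a b c d
    using linear_maps_closed[OF G(1)] that by auto
  have "sweedler U h (\<lambda>x y. sweedler U x (\<lambda>a b. sweedler U y (\<lambda>c d. G a b c d)))
    = sweedler U h (\<lambda>a x. sweedler U x (\<lambda>y d. sweedler U y (\<lambda>b c. G a b c d)))"
    by (rule sweedler_four[OF U h G])
  also have "\<dots> = sweedler U h (\<lambda>a x. sweedler U x (\<lambda>y d. sweedler U y (\<lambda>b c. G a c b d)))"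
    by (intro sweedler_cong[OF U] sweedler_cocomm) (use U h in \<open>auto intro!: bilinear_mapsI G Gc sweedler_closed\<close>)
  also have "\<dots> = sweedler U h (\<lambda>x y. sweedler U x (\<lambda>a b. sweedler U y (\<lambda>c d. G a c b d)))"
    by (rule sweedler_four[OF U h, symmetric]) (rule G; assumption)+
  finally show ?thesis .
qed

text \<open>Both sides are convolution inverse to \<open>\<Delta>\<close> in the algebra \<open>H \<otimes> H\<close>.  For the right-hand side,
\<open>\<Delta>(h\<^sub>1) (S h\<^sub>2 \<otimes> S h\<^sub>3) = h\<^sub>1 S(h\<^sub>3) \<otimes> h\<^sub>2 S(h\<^sub>4)\<close>, which collapses after exchanging \<open>h\<^sub>2\<close> and \<open>h\<^sub>3\<close>.\<close>

lemma comult_antipode: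
  assumes h: "h \<in> carrier H"
  shows "\<Delta> (S h) = sweedler (tensor_prod K H H) h (\<lambda>a b. pure_tensor K H H (S a) (S b))"
proof -
  let ?T = "tensor_prod K H H" and ?p = "pure_tensor K H H"
  have uT: "unital_algebra K ?T" by (rule unital_algebra_tensor_prod) auto
  note T = unital_algebraD(1,2)[OF uT]
  note l = linear_sweedler
  note pc[intro!] = pure_tensor_closed[of K H H]
  interpret T: unital_algebra K ?T by (rule uT)
  have one: "\<Delta> \<one>\<^bsub>H\<^esub> = \<one>\<^bsub>?T\<^esub>" by (rule ring_hom_one[OF comult_hom])
  show ?thesis
  proof (rule convolution_inverse_unique[OF uT, of "\<lambda>h. \<Delta> (S h)" \<Delta> "\<lambda>h. sweedler ?T h (\<lambda>a b. ?p (S a) (S b))"])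
    show "(\<lambda>h. \<Delta> (S h)) \<in> linear_maps K H ?T" "(\<lambda>h. sweedler ?T h (\<lambda>a b. ?p (S a) (S b))) \<in> linear_maps K H ?T"
      using T by (auto intro!: l)
    show "\<Delta> \<in> linear_maps K H ?T" by (rule comult_linear)
    show "h \<in> carrier H" by fact
  next
    fix h assume h: "h \<in> carrier H"
    have "sweedler ?T h (\<lambda>a b. \<Delta> (S a) \<otimes>\<^bsub>?T\<^esub> \<Delta> b) = sweedler ?T h (\<lambda>a b. \<Delta> (S a \<bullet> b))"
      by (rule sweedler_cong) (use h T in \<open>auto simp: ring_hom_mult[OF comult_hom]\<close>)
    also have "\<dots> = \<epsilon> h \<odot>\<^bsub>?T\<^esub> \<one>\<^bsub>?T\<^esub>"
      using sweedler_antipode_left[OF T(2) comult_linear h] by (simp add: one)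
    finally show "sweedler ?T h (\<lambda>a b. \<Delta> (S a) \<otimes>\<^bsub>?T\<^esub> \<Delta> b) = \<epsilon> h \<odot>\<^bsub>?T\<^esub> \<one>\<^bsub>?T\<^esub>" .
    have "sweedler ?T h (\<lambda>a b. \<Delta> a \<otimes>\<^bsub>?T\<^esub> sweedler ?T b (\<lambda>a b. ?p (S a) (S b)))
      = sweedler ?T h (\<lambda>x y. sweedler ?T x (\<lambda>a b. sweedler ?T y (\<lambda>c d. ?p (a \<bullet> S c) (b \<bullet> S d))))"
    proof (rule sweedler_cong)
      fix x y assume xy: "x \<in> carrier H" "y \<in> carrier H"
      show "\<Delta> x \<otimes>\<^bsub>?T\<^esub> sweedler ?T y (\<lambda>a b. ?p (S a) (S b))
        = sweedler ?T x (\<lambda>a b. sweedler ?T y (\<lambda>c d. ?p (a \<bullet> S c) (b \<bullet> S d)))"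
        unfolding mult_tensor_prod
      proof (rule sweedler_cong)
        fix a b assume ab: "a \<in> carrier H" "b \<in> carrier H"
        let ?m = "\<lambda>c d. ?p (a \<bullet> c) (b \<bullet> d)"
        have m: "?m \<in> bilinear_maps K H H ?T" by (rule bilinear_mult_pure) (use ab in auto)
        have "tensor_lift K ?T ?m (sweedler ?T y (\<lambda>a b. ?p (S a) (S b)))
          = sweedler ?T y (\<lambda>c d. tensor_lift K ?T ?m (?p (S c) (S d)))"
          by (rule linear_sweedler_comp[OF linear_tensor_lift[OF _ _ T(2) m]]) (use xy T in auto)
        also have "\<dots> = sweedler ?T y (\<lambda>c d. ?m (S c) (S d))"
          by (rule sweedler_cong) (use ab xy T in \<open>auto simp: tensor_lift_pure[OF _ _ T(2) m]\<close>)
        finally show "tensor_lift K ?T ?m (sweedler ?T y (\<lambda>a b. ?p (S a) (S b))) = \<dots>" .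
      qed (use T xy in auto)
    qed (use T h in auto)
    also have "\<dots> = sweedler ?T h (\<lambda>x y. sweedler ?T x (\<lambda>a b. sweedler ?T y (\<lambda>c d. ?p (a \<bullet> S b) (c \<bullet> S d))))"
      by (rule sweedler_interchange) (use T h in \<open>auto intro!: l\<close>)
    also have "\<dots> = sweedler ?T h (\<lambda>x y. \<epsilon> x \<odot>\<^bsub>?T\<^esub> (\<epsilon> y \<odot>\<^bsub>?T\<^esub> ?p \<one>\<^bsub>H\<^esub> \<one>\<^bsub>H\<^esub>))"
    proof (rule sweedler_cong)
      fix x y assume xy: "x \<in> carrier H" "y \<in> carrier H"
      have "sweedler ?T x (\<lambda>a b. sweedler ?T y (\<lambda>c d. ?p (a \<bullet> S b) (c \<bullet> S d)))
        = sweedler ?T x (\<lambda>a b. \<epsilon> y \<odot>\<^bsub>?T\<^esub> ?p (a \<bullet> S b) \<one>\<^bsub>H\<^esub>)"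
        by (intro sweedler_cong sweedler_antipode_right) (use T xy in \<open>auto intro!: l\<close>)
      also have "\<dots> = \<epsilon> x \<odot>\<^bsub>?T\<^esub> (\<epsilon> y \<odot>\<^bsub>?T\<^esub> ?p \<one>\<^bsub>H\<^esub> \<one>\<^bsub>H\<^esub>)"
        by (rule sweedler_antipode_right[of ?T "\<lambda>u. \<epsilon> y \<odot>\<^bsub>?T\<^esub> ?p u \<one>\<^bsub>H\<^esub>"]) (use T xy in \<open>auto intro!: l\<close>)
      finally show "sweedler ?T x (\<lambda>a b. sweedler ?T y (\<lambda>c d. ?p (a \<bullet> S b) (c \<bullet> S d))) = \<dots>" .
    qed (use T h in auto)
    also have "\<dots> = \<epsilon> h \<odot>\<^bsub>?T\<^esub> ?p \<one>\<^bsub>H\<^esub> \<one>\<^bsub>H\<^esub>"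
      by (rule sweedler_counit_left) (use T h in \<open>auto intro!: l\<close>)
    finally show "sweedler ?T h (\<lambda>a b. \<Delta> a \<otimes>\<^bsub>?T\<^esub> sweedler ?T b (\<lambda>a b. ?p (S a) (S b))) = \<epsilon> h \<odot>\<^bsub>?T\<^esub> \<one>\<^bsub>?T\<^esub>"
      by (simp add: tensor_prod_simps(5))
  qed
qed

lemma sweedler_antipode:
  assumes "module K U" "h \<in> carrier H" "f \<in> bilinear_maps K H H U"
  shows "sweedler U (S h) f = sweedler U h (\<lambda>a b. f (S a) (S b))"
proof -
  have T: "module K (tensor_prod K H H)" by (rule module_tensor_prod) auto
  have "sweedler U (S h) f = sweedler U h (\<lambda>a b. tensor_lift K U f (pure_tensor K H H (S a) (S b)))"
    unfolding comult_antipode[OF assms(2)]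
    by (rule linear_sweedler_comp[OF linear_tensor_lift[OF _ _ assms(1,3)]])
      (use assms T in \<open>auto intro!: pure_tensor_closed\<close>)
  also have "\<dots> = sweedler U h (\<lambda>a b. f (S a) (S b))"
    by (rule sweedler_cong) (use assms in \<open>auto simp: tensor_lift_pure bilinear_maps_closed[OF assms(3)]\<close>)
  finally show ?thesis .
qed

text \<open>\<open>S \<circ> S\<close> and the identity are both convolution inverse to \<open>S\<close>: by antimultiplicativity and
cocommutativity \<open>S(S h\<^sub>1) S(h\<^sub>2) = S(h\<^sub>2 S(h\<^sub>1)) = S(h\<^sub>1 S(h\<^sub>2)) = \<epsilon>(h)\<close>.\<close>

lemma antipode_antipode:
  assumes h: "h \<in> carrier H"
  shows "S (S h) = h"
proof (rule convolution_inverse_unique[of H "\<lambda>h. S (S h)" S "\<lambda>h. h"])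
  fix h assume h: "h \<in> carrier H"
  have "sweedler H h (\<lambda>a b. S (S a) \<bullet> S b) = sweedler H h (\<lambda>a b. S (b \<bullet> S a))"
    by (rule sweedler_cong) (use h in \<open>auto simp: antipode_mult\<close>)
  also have "\<dots> = sweedler H h (\<lambda>a b. S (a \<bullet> S b))"
    by (rule sweedler_cocomm) (use h in \<open>auto intro!: linear_sweedler\<close>)
  also have "\<dots> = \<epsilon> h \<odot>\<^bsub>H\<^esub> S \<one>\<^bsub>H\<^esub>"
    by (rule sweedler_antipode_right[OF _ antipode_linear]) (use h in auto)
  finally show "sweedler H h (\<lambda>a b. S (S a) \<bullet> S b) = \<epsilon> h \<odot>\<^bsub>H\<^esub> \<one>\<^bsub>H\<^esub>"
    by (simp add: antipode_one)
  show "sweedler H h (\<lambda>a b. S a \<bullet> b) = \<epsilon> h \<odot>\<^bsub>H\<^esub> \<one>\<^bsub>H\<^esub>"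
    using antipode_l[OF h] by (simp add: convolution_def)
qed (use h antipode_linear in \<open>auto intro!: linear_sweedler\<close>)

end

section \<open>The partial Hopf algebra\<close>

context hopf_algebra
begin

abbreviation Q :: "('k, ('h list \<Rightarrow> 'k) set set) module" where "Q \<equiv> hpar K H \<Delta> S"

abbreviation \<pi> :: "'h \<Rightarrow> ('h list \<Rightarrow> 'k) set set" where "\<pi> \<equiv> hpar_class K H \<Delta> S"

abbreviation mult_Q (infixl "\<star>" 70) where "x \<star> y \<equiv> x \<otimes>\<^bsub>Q\<^esub> y"

abbreviation T :: "('k, ('h list \<Rightarrow> 'k) set) module" where "T \<equiv> tensor_algebra K H"

abbreviation \<iota> :: "'h \<Rightarrow> ('h list \<Rightarrow> 'k) set" where "\<iota> \<equiv> tensor_algebra_incl K H"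

abbreviation hpar_proj :: "('h list \<Rightarrow> 'k) set \<Rightarrow> ('h list \<Rightarrow> 'k) set set" where
  "hpar_proj x \<equiv> hpar_ideal K H \<Delta> S +>\<^bsub>T\<^esub> x"

lemma field_K: "field K" by (rule field_axioms)

lemma algebra_T [simp, intro!]: "unital_algebra K T" "assoc_algebra K T" "module K T"
  using tensor_algebra(1)[OF field_K algebra_H(3)] unital_algebraD by auto

lemma linear_incl: "f \<in> linear_maps K X H \<Longrightarrow> (\<lambda>x. \<iota> (f x)) \<in> linear_maps K X T"
  by (rule linear_maps_comp[OF _ tensor_algebra(2)[OF field_K algebra_H(3)]])

lemma incl_closed [simp, intro!]: "h \<in> carrier H \<Longrightarrow> \<iota> h \<in> carrier T"
  by (rule linear_maps_closed[OF tensor_algebra(2)[OF field_K algebra_H(3)]])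

lemma mult_T_closed [simp, intro!]: "x \<in> carrier T \<Longrightarrow> y \<in> carrier T \<Longrightarrow> x \<otimes>\<^bsub>T\<^esub> y \<in> carrier T"
  by (rule assoc_algebra.alg_closed[OF algebra_T(2)])

lemma hpar_relations_closed: "hpar_relations K H \<Delta> S \<subseteq> carrier T"
proof -
  interpret T: module K T by auto
  interpret T: unital_algebra K T by auto
  show ?thesis
    unfolding hpar_relations_def Let_def
    by (intro Un_least subsetI; elim CollectE exE conjE singletonE; hypsubst) (auto intro!: T.M.minus_closed)
qed

lemma hpar_ideal: "ideal (hpar_ideal K H \<Delta> S) T" "hpar_relations K H \<Delta> S \<subseteq> hpar_ideal K H \<Delta> S"
proof -
  interpret T: ring T by (rule unital_algebra_ring) auto
  show "ideal (hpar_ideal K H \<Delta> S) T" "hpar_relations K H \<Delta> S \<subseteq> hpar_ideal K H \<Delta> S"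
    unfolding hpar_ideal_def
    by (rule T.genideal_ideal[OF hpar_relations_closed], rule T.genideal_self[OF hpar_relations_closed])
qed

lemma algebra_Q [simp, intro!]: "unital_algebra K Q" "assoc_algebra K Q" "module K Q"
  using coset_algebra_hom(1)[OF algebra_T(1) hpar_ideal(1)] unital_algebraD by (auto simp: hpar_def)

lemma hpar_proj: "hpar_proj \<in> algebra_homs K T Q"
  using coset_algebra_hom(2)[OF algebra_T(1) hpar_ideal(1)] by (simp add: hpar_def)

lemma hpar_proj_relation:
  assumes "x \<ominus>\<^bsub>T\<^esub> y \<in> hpar_relations K H \<Delta> S" "x \<in> carrier T" "y \<in> carrier T"
  shows "hpar_proj x = hpar_proj y"
  using coset_eq_iff[OF algebra_T(3) ideal_submodule[OF algebra_T(1) hpar_ideal(1)] assms(2,3)]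
    assms(1) hpar_ideal(2) by auto

lemma hpar_class_eq: "\<pi> h = hpar_proj (\<iota> h)"
  by (simp add: hpar_class_def)

lemma linear_hpar_class: "f \<in> linear_maps K X H \<Longrightarrow> (\<lambda>x. \<pi> (f x)) \<in> linear_maps K X Q"
  unfolding hpar_class_eq by (rule linear_maps_comp[OF linear_incl algebra_homsD(1)[OF hpar_proj]])

lemma hpar_class_closed [simp, intro!]: "h \<in> carrier H \<Longrightarrow> \<pi> h \<in> carrier Q"
  using linear_maps_closed[OF linear_hpar_class[OF linear_id]] .

lemma mult_Q_closed [simp, intro!]: "x \<in> carrier Q \<Longrightarrow> y \<in> carrier Q \<Longrightarrow> x \<star> y \<in> carrier Q"
  by (rule assoc_algebra.alg_closed[OF algebra_Q(2)])

lemma hpar_class_one: "\<pi> \<one>\<^bsub>H\<^esub> = \<one>\<^bsub>Q\<^esub>"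
proof -
  interpret T: unital_algebra K T by auto
  have "hpar_proj (\<iota> \<one>\<^bsub>H\<^esub>) = hpar_proj \<one>\<^bsub>T\<^esub>"
    by (rule hpar_proj_relation) (auto simp: hpar_relations_def Let_def)
  then show ?thesis by (simp add: hpar_class_eq algebra_homsD(2)[OF hpar_proj])
qed

lemma hpar_proj_sweedler:
  assumes "h \<in> carrier H" "\<And>a b. a \<in> carrier H \<Longrightarrow> b \<in> carrier H \<Longrightarrow> f a b \<in> carrier T"
    "\<And>a b. a \<in> carrier H \<Longrightarrow> b \<in> carrier H \<Longrightarrow> hpar_proj (f a b) = g a b"
  shows "hpar_proj (sweedler T h f) = sweedler Q h g"
proof -
  note l = algebra_homsD(1)[OF hpar_proj]
  have "hpar_proj (sweedler T h f) = sweedler Q h (\<lambda>a b. hpar_proj (f a b))"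
    by (rule linear_sweedler_comp[OF l]) (use assms in auto)
  also have "\<dots> = sweedler Q h g"
    by (rule sweedler_cong) (use assms linear_maps_closed[OF l] in \<open>auto simp flip: assms(3)\<close>)
  finally show ?thesis .
qed

text \<open>The image in \<open>Q\<close> of the generator \<open>h \<otimes> k\<^sub>1 \<otimes> S(k\<^sub>2) - h k\<^sub>1 \<otimes> S(k\<^sub>2)\<close>.\<close>

lemma hpar_relation_left:
  assumes h: "h \<in> carrier H" and k: "k \<in> carrier H"
  shows "sweedler Q k (\<lambda>a b. \<pi> h \<star> \<pi> a \<star> \<pi> (S b)) = sweedler Q k (\<lambda>a b. \<pi> (h \<bullet> a) \<star> \<pi> (S b))"
proof -
  let ?x = "sweedler T k (\<lambda>a b. \<iota> h \<otimes>\<^bsub>T\<^esub> \<iota> a \<otimes>\<^bsub>T\<^esub> \<iota> (S b))"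
    and ?y = "sweedler T k (\<lambda>a b. \<iota> (h \<bullet> a) \<otimes>\<^bsub>T\<^esub> \<iota> (S b))"
  have "hpar_proj ?x = hpar_proj ?y"
    by (rule hpar_proj_relation) (use h k in \<open>auto simp: hpar_relations_def Let_def\<close>)
  moreover have "hpar_proj ?x = sweedler Q k (\<lambda>a b. \<pi> h \<star> \<pi> a \<star> \<pi> (S b))"
    "hpar_proj ?y = sweedler Q k (\<lambda>a b. \<pi> (h \<bullet> a) \<star> \<pi> (S b))"
    by (rule hpar_proj_sweedler; use h k in \<open>auto simp: hpar_class_eq algebra_homsD(3)[OF hpar_proj]\<close>)+
  ultimately show ?thesis by simp
qed

text \<open>The image in \<open>Q\<close> of the generator \<open>h\<^sub>1 \<otimes> S(h\<^sub>2) \<otimes> k - h\<^sub>1 \<otimes> S(h\<^sub>2) k\<close>.\<close>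

lemma hpar_relation_right:
  assumes h: "h \<in> carrier H" and k: "k \<in> carrier H"
  shows "sweedler Q h (\<lambda>a b. \<pi> a \<star> \<pi> (S b) \<star> \<pi> k) = sweedler Q h (\<lambda>a b. \<pi> a \<star> \<pi> (S b \<bullet> k))"
proof -
  let ?x = "sweedler T h (\<lambda>a b. \<iota> a \<otimes>\<^bsub>T\<^esub> \<iota> (S b) \<otimes>\<^bsub>T\<^esub> \<iota> k)"
    and ?y = "sweedler T h (\<lambda>a b. \<iota> a \<otimes>\<^bsub>T\<^esub> \<iota> (S b \<bullet> k))"
  have "hpar_proj ?x = hpar_proj ?y"
    by (rule hpar_proj_relation) (use h k in \<open>auto simp: hpar_relations_def Let_def\<close>)
  moreover have "hpar_proj ?x = sweedler Q h (\<lambda>a b. \<pi> a \<star> \<pi> (S b) \<star> \<pi> k)"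
    "hpar_proj ?y = sweedler Q h (\<lambda>a b. \<pi> a \<star> \<pi> (S b \<bullet> k))"
    by (rule hpar_proj_sweedler; use h k in \<open>auto simp: hpar_class_eq algebra_homsD(3)[OF hpar_proj]\<close>)+
  ultimately show ?thesis by simp
qed

text \<open>The universal property of \<open>Q\<close>: it classifies the linear maps that satisfy the relations of a partial
representation of \<open>H\<close>.\<close>

lemma hpar_lift:
  assumes B: "unital_algebra K B" and \<phi>: "\<phi> \<in> linear_maps K H B" and one: "\<phi> \<one>\<^bsub>H\<^esub> = \<one>\<^bsub>B\<^esub>"
    and rl: "\<And>h k. h \<in> carrier H \<Longrightarrow> k \<in> carrier H \<Longrightarrow>
      sweedler B k (\<lambda>a b. \<phi> h \<otimes>\<^bsub>B\<^esub> \<phi> a \<otimes>\<^bsub>B\<^esub> \<phi> (S b)) = sweedler B k (\<lambda>a b. \<phi> (h \<bullet> a) \<otimes>\<^bsub>B\<^esub> \<phi> (S b))"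
    and rr: "\<And>h k. h \<in> carrier H \<Longrightarrow> k \<in> carrier H \<Longrightarrow>
      sweedler B h (\<lambda>a b. \<phi> a \<otimes>\<^bsub>B\<^esub> \<phi> (S b) \<otimes>\<^bsub>B\<^esub> \<phi> k) = sweedler B h (\<lambda>a b. \<phi> a \<otimes>\<^bsub>B\<^esub> \<phi> (S b \<bullet> k))"
  obtains \<Phi> where "\<Phi> \<in> algebra_homs K Q B" "\<And>h. h \<in> carrier H \<Longrightarrow> \<Phi> (\<pi> h) = \<phi> h"
proof -
  interpret B: unital_algebra K B by fact
  interpret T: unital_algebra K T by auto
  obtain F where F: "F \<in> algebra_homs K T B" "\<And>h. h \<in> carrier H \<Longrightarrow> F (\<iota> h) = \<phi> h"
    by (rule tensor_algebra_lift[OF algebra_H(3) B \<phi>]) blast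
  note l = algebra_homsD(1)[OF F(1)]
  note m = algebra_homsD(3)[OF F(1)]
  note c = linear_maps_closed[OF \<phi>]
  have B': "module K B" by (rule unital_algebraD(2)[OF B])
  have Fs: "F (sweedler T h f) = sweedler B h g"
    if "h \<in> carrier H" "\<And>a b. a \<in> carrier H \<Longrightarrow> b \<in> carrier H \<Longrightarrow> f a b \<in> carrier T"
      "\<And>a b. a \<in> carrier H \<Longrightarrow> b \<in> carrier H \<Longrightarrow> F (f a b) = g a b" for h f g
  proof -
    have "F (sweedler T h f) = sweedler B h (\<lambda>a b. F (f a b))"
      by (rule linear_sweedler_comp[OF l]) (use that B' in auto)
    also have "\<dots> = sweedler B h g"
    proof (rule sweedler_cong[OF B' that(1,3)])
      fix a b assume "a \<in> carrier H" "b \<in> carrier H"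
      then show "g a b \<in> carrier B" using linear_maps_closed[OF l that(2)] that(3) by simp
    qed
    finally show ?thesis .
  qed
  have zero: "F r = \<zero>\<^bsub>B\<^esub>" if "r \<in> hpar_relations K H \<Delta> S" for r
  proof -
    have z: "F (x \<ominus>\<^bsub>T\<^esub> y) = \<zero>\<^bsub>B\<^esub>" if "F x = F y" "x \<in> carrier T" "y \<in> carrier T" for x y
      using that linear_maps_minus[OF algebra_T(3) B' l that(2,3)] linear_maps_closed[OF l that(3)]
      by (simp add: a_minus_def B.M.r_neg)
    consider (1) "r = \<iota> \<one>\<^bsub>H\<^esub> \<ominus>\<^bsub>T\<^esub> \<one>\<^bsub>T\<^esub>"
      | (2) h k where "h \<in> carrier H" "k \<in> carrier H"
        "r = sweedler T k (\<lambda>a b. \<iota> h \<otimes>\<^bsub>T\<^esub> \<iota> a \<otimes>\<^bsub>T\<^esub> \<iota> (S b)) \<ominus>\<^bsub>T\<^esub> sweedler T k (\<lambda>a b. \<iota> (h \<bullet> a) \<otimes>\<^bsub>T\<^esub> \<iota> (S b))"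
      | (3) h k where "h \<in> carrier H" "k \<in> carrier H"
        "r = sweedler T h (\<lambda>a b. \<iota> a \<otimes>\<^bsub>T\<^esub> \<iota> (S b) \<otimes>\<^bsub>T\<^esub> \<iota> k) \<ominus>\<^bsub>T\<^esub> sweedler T h (\<lambda>a b. \<iota> a \<otimes>\<^bsub>T\<^esub> \<iota> (S b \<bullet> k))"
      using \<open>r \<in> hpar_relations K H \<Delta> S\<close> unfolding hpar_relations_def Let_def by blast
    then show ?thesis
    proof cases
      case 1
      then show ?thesis using F(2) one algebra_homsD(2)[OF F(1)] by (auto intro!: z)
    next
      case 2
      have "F (sweedler T k (\<lambda>a b. \<iota> h \<otimes>\<^bsub>T\<^esub> \<iota> a \<otimes>\<^bsub>T\<^esub> \<iota> (S b))) = sweedler B k (\<lambda>a b. \<phi> h \<otimes>\<^bsub>B\<^esub> \<phi> a \<otimes>\<^bsub>B\<^esub> \<phi> (S b))"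
        "F (sweedler T k (\<lambda>a b. \<iota> (h \<bullet> a) \<otimes>\<^bsub>T\<^esub> \<iota> (S b))) = sweedler B k (\<lambda>a b. \<phi> (h \<bullet> a) \<otimes>\<^bsub>B\<^esub> \<phi> (S b))"
        by (rule Fs; use 2 in \<open>auto simp: m F(2)\<close>)+
      then show ?thesis unfolding 2(3) using rl[OF 2(1,2)] 2(1,2) by (intro z) auto
    next
      case 3
      have "F (sweedler T h (\<lambda>a b. \<iota> a \<otimes>\<^bsub>T\<^esub> \<iota> (S b) \<otimes>\<^bsub>T\<^esub> \<iota> k)) = sweedler B h (\<lambda>a b. \<phi> a \<otimes>\<^bsub>B\<^esub> \<phi> (S b) \<otimes>\<^bsub>B\<^esub> \<phi> k)"
        "F (sweedler T h (\<lambda>a b. \<iota> a \<otimes>\<^bsub>T\<^esub> \<iota> (S b \<bullet> k))) = sweedler B h (\<lambda>a b. \<phi> a \<otimes>\<^bsub>B\<^esub> \<phi> (S b \<bullet> k))"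
        by (rule Fs; use 3 in \<open>auto simp: m F(2)\<close>)+
      then show ?thesis unfolding 3(3) using rr[OF 3(1,2)] 3(1,2) by (intro z) auto
    qed
  qed
  show thesis
  proof (rule that)
    show "quot_lift F \<in> algebra_homs K Q B"
      unfolding hpar_def hpar_ideal_def
      by (rule quot_algebra_lift(1)[OF algebra_T(1) B F(1) hpar_relations_closed zero])
    show "quot_lift F (\<pi> h) = \<phi> h" if "h \<in> carrier H" for h
      unfolding hpar_class_def hpar_ideal_def
      using quot_algebra_lift(2)[OF algebra_T(1) B F(1) hpar_relations_closed zero incl_closed[OF that]] F(2)[OF that]
      by simp
  qed
qed

lemma hpar_induct_words:
  assumes x: "x \<in> carrier Q"
    and P: "\<And>w. w \<in> lists (carrier H) \<Longrightarrow> P (word_prod Q \<pi> w)"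
      "\<And>x y. x \<in> carrier Q \<Longrightarrow> y \<in> carrier Q \<Longrightarrow> P x \<Longrightarrow> P y \<Longrightarrow> P (x \<oplus>\<^bsub>Q\<^esub> y)"
      "\<And>c x. c \<in> carrier K \<Longrightarrow> x \<in> carrier Q \<Longrightarrow> P x \<Longrightarrow> P (c \<odot>\<^bsub>Q\<^esub> x)"
  shows "P x"
proof -
  note l = algebra_homsD(1)[OF hpar_proj]
  obtain y where y: "y \<in> carrier T" "x = hpar_proj y"
    using x unfolding hpar_def quot_module_carrier by blast
  have "P (hpar_proj y)"
    using y(1)
  proof (rule tensor_algebra_induct[OF field_K algebra_H(3)])
    fix w assume w: "w \<in> lists (carrier H)"
    have "hpar_proj (word_prod T \<iota> w) = word_prod Q \<pi> w"
      using algebra_hom_word_prod[OF algebra_T(1) hpar_proj _ w, of \<iota>] by (auto simp: hpar_class_def[abs_def])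
    then show "P (hpar_proj (word_prod T \<iota> w))" using P(1)[OF w] by simp
  qed (simp_all add: linear_maps_add[OF l] linear_maps_smult[OF l] P linear_maps_closed[OF l])
  then show ?thesis using y by simp
qed

lemma hpar_induct_left [consumes 1, case_names one mult add smult]:
  assumes x: "x \<in> carrier Q" and one: "P \<one>\<^bsub>Q\<^esub>"
    and m: "\<And>h x. h \<in> carrier H \<Longrightarrow> x \<in> carrier Q \<Longrightarrow> P x \<Longrightarrow> P (\<pi> h \<star> x)"
    and P: "\<And>x y. x \<in> carrier Q \<Longrightarrow> y \<in> carrier Q \<Longrightarrow> P x \<Longrightarrow> P y \<Longrightarrow> P (x \<oplus>\<^bsub>Q\<^esub> y)"
      "\<And>c x. c \<in> carrier K \<Longrightarrow> x \<in> carrier Q \<Longrightarrow> P x \<Longrightarrow> P (c \<odot>\<^bsub>Q\<^esub> x)"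
  shows "P x"
proof (rule hpar_induct_words[OF x _ P])
  fix w assume w: "w \<in> lists (carrier H)"
  then show "P (word_prod Q \<pi> w)"
  proof (induction)
    case (Cons h w)
    then show ?case using word_prod_closed[OF algebra_Q(1), of \<pi> "carrier H" w] by (auto intro!: m)
  qed (simp add: one)
qed

end

section \<open>A commutative subalgebra of the partial Hopf algebra\<close>

lemma tensor_lift_in_submodule:
  assumes "module K V" "module K W" "module K U" "submodule N K U" "t \<in> carrier (tensor_prod K V W)"
    and "\<And>a b. a \<in> carrier V \<Longrightarrow> b \<in> carrier W \<Longrightarrow> f a b \<in> N"
  shows "tensor_lift K U f t \<in> N"
proof -
  interpret U: module K U by fact
  note N = U.submoduleE[OF assms(4)]
  let ?x = "SOME x. x \<in> t" let ?A = "{s. ?x s \<noteq> \<zero>\<^bsub>K\<^esub>}"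
  have x: "\<And>s. ?x s \<in> carrier K" "finite ?A" "?A \<subseteq> carrier V \<times> carrier W"
    using tensor_rep(1)[OF assms(1,2,5)] by (auto simp: free_module_carrier)
  have "(\<Oplus>\<^bsub>U\<^esub>s\<in>B. ?x s \<odot>\<^bsub>U\<^esub> (\<lambda>(a, b). f a b) s) \<in> N" if "finite B" "B \<subseteq> carrier V \<times> carrier W" for B
    using that
  proof (induction B)
    case empty
    show ?case using subgroup.one_closed[OF submodule.axioms(1)[OF assms(4)]] by simp
  next
    case (insert s B)
    have c: "?x s \<odot>\<^bsub>U\<^esub> (\<lambda>(a, b). f a b) s \<in> N" if "s \<in> carrier V \<times> carrier W" for s
      using that x(1) assms(6) by (auto intro!: N(4))
    then have "(\<lambda>s. ?x s \<odot>\<^bsub>U\<^esub> (\<lambda>(a, b). f a b) s) \<in> insert s B \<rightarrow> carrier U"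
      using insert.prems N(1) by blast
    then have "(\<Oplus>\<^bsub>U\<^esub>s\<in>insert s B. ?x s \<odot>\<^bsub>U\<^esub> (\<lambda>(a, b). f a b) s)
      = ?x s \<odot>\<^bsub>U\<^esub> (\<lambda>(a, b). f a b) s \<oplus>\<^bsub>U\<^esub> (\<Oplus>\<^bsub>U\<^esub>s\<in>B. ?x s \<odot>\<^bsub>U\<^esub> (\<lambda>(a, b). f a b) s)"
      using insert.hyps by (intro U.finsum_insert) auto
    then show ?case using insert c N(5) by auto
  qed
  from this[OF x(2,3)] show ?thesis by (simp add: tensor_lift_def free_extend_def)
qed

context cocommutative_hopf_algebra
begin

interpretation Q: unital_algebra K Q by auto

text \<open>The element \<open>\<epsilon>\<^sub>h = [h\<^sub>1][S h\<^sub>2]\<close>; for a group element \<open>h\<close> it is the idempotent \<open>[h][h\<inverse>]\<close>.\<close>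

definition idem :: "'h \<Rightarrow> ('h list \<Rightarrow> 'k) set set" where
  "idem h = sweedler Q h (\<lambda>a b. \<pi> a \<star> \<pi> (S b))"

lemma idem_closed [simp, intro!]: "h \<in> carrier H \<Longrightarrow> idem h \<in> carrier Q"
  unfolding idem_def by auto

lemmas linear_hpar_class_rules = linear_sweedler linear_hpar_class

lemma linear_idem: "f \<in> linear_maps K X H \<Longrightarrow> (\<lambda>x. idem (f x)) \<in> linear_maps K X Q"
  unfolding idem_def by (rule linear_sweedler_arg) (auto intro!: linear_hpar_class_rules)

lemmas linear_hpar = linear_hpar_class_rules linear_idem

lemma idem_one: "idem \<one>\<^bsub>H\<^esub> = \<one>\<^bsub>Q\<^esub>"
proof -
  have "idem \<one>\<^bsub>H\<^esub> = \<pi> \<one>\<^bsub>H\<^esub> \<star> \<pi> (S \<one>\<^bsub>H\<^esub>)"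
    unfolding idem_def by (rule sweedler_one) (auto intro!: linear_hpar)
  then show ?thesis by (simp add: antipode_one hpar_class_one)
qed

lemma idem_antipode:
  assumes "h \<in> carrier H"
  shows "idem (S h) = sweedler Q h (\<lambda>a b. \<pi> (S a) \<star> \<pi> b)"
proof -
  have "idem (S h) = sweedler Q h (\<lambda>a b. \<pi> (S a) \<star> \<pi> (S (S b)))"
    unfolding idem_def by (rule sweedler_antipode) (use assms in \<open>auto intro!: linear_hpar\<close>)
  also have "\<dots> = sweedler Q h (\<lambda>a b. \<pi> (S a) \<star> \<pi> b)"
    by (rule sweedler_cong) (use assms in \<open>auto simp: antipode_antipode\<close>)
  finally show ?thesis .
qed

text \<open>The defining relations of \<open>Q\<close> in terms of \<open>\<epsilon>\<^sub>k\<close>: a class multiplied with \<open>\<epsilon>\<^sub>k\<close> can be absorbed.\<close>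

lemma hpar_class_idem_eq:
  assumes "h \<in> carrier H" "k \<in> carrier H"
  shows "\<pi> h \<star> idem k = sweedler Q k (\<lambda>a b. \<pi> (h \<bullet> a) \<star> \<pi> (S b))"
    and "idem k \<star> \<pi> h = sweedler Q k (\<lambda>a b. \<pi> a \<star> \<pi> (S b \<bullet> h))"
proof -
  have "\<pi> h \<star> idem k = sweedler Q k (\<lambda>a b. \<pi> h \<star> (\<pi> a \<star> \<pi> (S b)))"
    unfolding idem_def by (rule linear_sweedler_mult_right) (use assms in auto)
  also have "\<dots> = sweedler Q k (\<lambda>a b. \<pi> h \<star> \<pi> a \<star> \<pi> (S b))"
    by (rule sweedler_cong) (use assms in \<open>simp_all add: Q.m_assoc\<close>)
  finally show "\<pi> h \<star> idem k = sweedler Q k (\<lambda>a b. \<pi> (h \<bullet> a) \<star> \<pi> (S b))"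
    by (simp add: hpar_relation_left assms)
  have "idem k \<star> \<pi> h = sweedler Q k (\<lambda>a b. \<pi> a \<star> \<pi> (S b) \<star> \<pi> h)"
    unfolding idem_def by (rule linear_sweedler_mult_left) (use assms in auto)
  then show "idem k \<star> \<pi> h = sweedler Q k (\<lambda>a b. \<pi> a \<star> \<pi> (S b \<bullet> h))"
    by (simp add: hpar_relation_right assms)
qed

text \<open>Absorbing \<open>[h\<^sub>2]\<close> gives \<open>\<epsilon>\<^bsub>h\<^sub>1k\<^esub>[h\<^sub>2] = [h\<^sub>1k\<^sub>1][S(h\<^sub>2k\<^sub>2) h\<^sub>3] = [h\<^sub>1k\<^sub>1][S(k\<^sub>2) S(h\<^sub>2) h\<^sub>3] = [h k\<^sub>1][S(k\<^sub>2)]\<close>, and this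
is \<open>[h]\<epsilon>\<^sub>k\<close>.\<close>

lemma hpar_class_idem:
  assumes h: "h \<in> carrier H" and k: "k \<in> carrier H"
  shows "\<pi> h \<star> idem k = sweedler Q h (\<lambda>a b. idem (a \<bullet> k) \<star> \<pi> b)"
proof -
  have "sweedler Q h (\<lambda>a b. idem (a \<bullet> k) \<star> \<pi> b)
    = sweedler Q h (\<lambda>a b. sweedler Q a (\<lambda>p q. sweedler Q k (\<lambda>c d. \<pi> (p \<bullet> c) \<star> \<pi> (S d \<bullet> (S q \<bullet> b)))))"
  proof (rule sweedler_cong)
    fix a b assume ab: "a \<in> carrier H" "b \<in> carrier H"
    have "idem (a \<bullet> k) \<star> \<pi> b = sweedler Q (a \<bullet> k) (\<lambda>u v. \<pi> u \<star> \<pi> (S v \<bullet> b))"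
      by (rule hpar_class_idem_eq) (use ab k in auto)
    also have "\<dots> = sweedler Q a (\<lambda>p q. sweedler Q k (\<lambda>c d. \<pi> (p \<bullet> c) \<star> \<pi> (S (q \<bullet> d) \<bullet> b)))"
      by (rule sweedler_mult) (use ab k in \<open>auto intro!: linear_hpar\<close>)
    also have "\<dots> = sweedler Q a (\<lambda>p q. sweedler Q k (\<lambda>c d. \<pi> (p \<bullet> c) \<star> \<pi> (S d \<bullet> (S q \<bullet> b))))"
      by (intro sweedler_cong) (use ab k in \<open>auto simp: antipode_mult m_assoc\<close>)
    finally show "idem (a \<bullet> k) \<star> \<pi> b = \<dots>" .
  qed (use h k in auto)
  also have "\<dots> = sweedler Q h (\<lambda>p x. sweedler Q x (\<lambda>q b. sweedler Q k (\<lambda>c d. \<pi> (p \<bullet> c) \<star> \<pi> (S d \<bullet> (S q \<bullet> b)))))"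
    by (rule sweedler_coassoc) (use h k in \<open>auto intro!: linear_hpar\<close>)
  also have "\<dots> = sweedler Q h (\<lambda>p x. \<epsilon> x \<odot>\<^bsub>Q\<^esub> sweedler Q k (\<lambda>c d. \<pi> (p \<bullet> c) \<star> \<pi> (S d \<bullet> \<one>\<^bsub>H\<^esub>)))"
    by (intro sweedler_cong sweedler_antipode_left[of Q "\<lambda>y. sweedler Q k (\<lambda>c d. \<pi> (_ \<bullet> c) \<star> \<pi> (S d \<bullet> y))"])
      (use h k in \<open>auto intro!: linear_hpar\<close>)
  also have "\<dots> = sweedler Q k (\<lambda>c d. \<pi> (h \<bullet> c) \<star> \<pi> (S d \<bullet> \<one>\<^bsub>H\<^esub>))"
    by (rule sweedler_counit_right) (use h k in \<open>auto intro!: linear_hpar\<close>)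
  also have "\<dots> = sweedler Q k (\<lambda>c d. \<pi> (h \<bullet> c) \<star> \<pi> (S d))"
    by (rule sweedler_cong) (use h k in auto)
  also have "\<dots> = \<pi> h \<star> idem k"
    by (rule hpar_class_idem_eq(1)[symmetric]) (use h k in auto)
  finally show ?thesis by simp
qed

text \<open>Moving \<open>\<epsilon>\<^sub>k\<close> to the left through \<open>[S h\<^sub>2]\<close> and \<open>[h\<^sub>1]\<close> turns \<open>[h\<^sub>1][S h\<^sub>2]\<epsilon>\<^sub>k\<close> into
\<open>\<epsilon>\<^bsub>h\<^sub>1S(h\<^sub>3)k\<^esub>[h\<^sub>2][S h\<^sub>4]\<close>.  After \<open>h\<^sub>2\<close> and \<open>h\<^sub>3\<close> are exchanged, the subscript collapses to \<open>k\<close>.\<close>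

lemma idem_commute:
  assumes h: "h \<in> carrier H" and k: "k \<in> carrier H"
  shows "idem h \<star> idem k = idem k \<star> idem h"
proof -
  define G where "G c d p q = idem (c \<bullet> (S p \<bullet> k)) \<star> (\<pi> d \<star> \<pi> (S q))" for c d p q
  have "idem h \<star> idem k = sweedler Q h (\<lambda>a b. \<pi> a \<star> \<pi> (S b) \<star> idem k)"
    unfolding idem_def[of h] by (rule linear_sweedler_mult_left) (use h k in auto)
  also have "\<dots> = sweedler Q h (\<lambda>a b. sweedler Q a (\<lambda>c d. sweedler Q b (\<lambda>p q. G c d p q)))"
  proof (rule sweedler_cong)
    fix a b assume ab: "a \<in> carrier H" "b \<in> carrier H"
    have "\<pi> a \<star> \<pi> (S b) \<star> idem k = \<pi> a \<star> (\<pi> (S b) \<star> idem k)"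
      using ab k by (simp add: Q.m_assoc)
    also have "\<pi> (S b) \<star> idem k = sweedler Q (S b) (\<lambda>p q. idem (p \<bullet> k) \<star> \<pi> q)"
      by (rule hpar_class_idem) (use ab k in auto)
    also have "\<dots> = sweedler Q b (\<lambda>p q. idem (S p \<bullet> k) \<star> \<pi> (S q))"
      by (rule sweedler_antipode) (use ab k in \<open>auto intro!: linear_hpar\<close>)
    also have "\<pi> a \<star> \<dots> = sweedler Q b (\<lambda>p q. \<pi> a \<star> (idem (S p \<bullet> k) \<star> \<pi> (S q)))"
      by (rule linear_sweedler_mult_right) (use ab k in auto)
    also have "\<dots> = sweedler Q b (\<lambda>p q. sweedler Q a (\<lambda>c d. G c d p q))"
    proof (rule sweedler_cong)
      fix p q assume pq: "p \<in> carrier H" "q \<in> carrier H"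
      have "\<pi> a \<star> (idem (S p \<bullet> k) \<star> \<pi> (S q)) = (\<pi> a \<star> idem (S p \<bullet> k)) \<star> \<pi> (S q)"
        using ab pq k by (simp add: Q.m_assoc)
      also have "\<pi> a \<star> idem (S p \<bullet> k) = sweedler Q a (\<lambda>c d. idem (c \<bullet> (S p \<bullet> k)) \<star> \<pi> d)"
        by (rule hpar_class_idem) (use ab pq k in auto)
      also have "\<dots> \<star> \<pi> (S q) = sweedler Q a (\<lambda>c d. idem (c \<bullet> (S p \<bullet> k)) \<star> \<pi> d \<star> \<pi> (S q))"
        by (rule linear_sweedler_mult_left) (use ab pq k in auto)
      also have "\<dots> = sweedler Q a (\<lambda>c d. G c d p q)"
        by (rule sweedler_cong) (use ab pq k in \<open>auto simp: G_def Q.m_assoc\<close>)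
      finally show "\<pi> a \<star> (idem (S p \<bullet> k) \<star> \<pi> (S q)) = \<dots>" .
    qed (use ab k in \<open>auto simp: G_def\<close>)
    also have "\<dots> = sweedler Q a (\<lambda>c d. sweedler Q b (\<lambda>p q. G c d p q))"
      by (rule sweedler_swap) (use ab k in \<open>auto simp: G_def\<close>)
    finally show "\<pi> a \<star> \<pi> (S b) \<star> idem k = \<dots>" .
  qed (use h k in \<open>auto simp: G_def\<close>)
  also have "\<dots> = sweedler Q h (\<lambda>a b. sweedler Q a (\<lambda>c d. sweedler Q b (\<lambda>p q. G c p d q)))"
    by (rule sweedler_interchange) (use h k in \<open>auto simp: G_def intro!: linear_hpar\<close>)
  also have "\<dots> = sweedler Q h (\<lambda>a b. \<epsilon> a \<odot>\<^bsub>Q\<^esub> (idem k \<star> idem b))"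
  proof (rule sweedler_cong)
    fix a b assume ab: "a \<in> carrier H" "b \<in> carrier H"
    have "sweedler Q a (\<lambda>c d. sweedler Q b (\<lambda>p q. G c p d q))
      = sweedler Q a (\<lambda>c d. idem ((c \<bullet> S d) \<bullet> k) \<star> idem b)"
    proof (rule sweedler_cong)
      fix c d assume cd: "c \<in> carrier H" "d \<in> carrier H"
      show "sweedler Q b (\<lambda>p q. G c p d q) = idem ((c \<bullet> S d) \<bullet> k) \<star> idem b"
        unfolding G_def idem_def[of b]
        by (subst linear_sweedler_mult_right) (use ab cd k in \<open>auto simp: m_assoc\<close>)
    qed (use ab k in auto)
    also have "\<dots> = \<epsilon> a \<odot>\<^bsub>Q\<^esub> (idem (\<one>\<^bsub>H\<^esub> \<bullet> k) \<star> idem b)"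
      by (rule sweedler_antipode_right[of Q "\<lambda>x. idem (x \<bullet> k) \<star> idem b"]) (use ab k in \<open>auto intro!: linear_hpar\<close>)
    finally show "sweedler Q a (\<lambda>c d. sweedler Q b (\<lambda>p q. G c p d q)) = \<epsilon> a \<odot>\<^bsub>Q\<^esub> (idem k \<star> idem b)"
      using k by simp
  qed (use h k in auto)
  also have "\<dots> = idem k \<star> idem h"
    by (rule sweedler_counit_left) (use h k in \<open>auto intro!: linear_hpar\<close>)
  finally show ?thesis .
qed

text \<open>The case \<open>k = 1\<close> of \<open>hpar_class_idem\<close>: this is \<open>[h\<^sub>1][S h\<^sub>2][h\<^sub>3] = [h]\<close>, the analogue of
\<open>[g][g\<inverse>][g] = [g]\<close>.\<close>

lemma sweedler_idem_hpar_class: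
  assumes h: "h \<in> carrier H"
  shows "sweedler Q h (\<lambda>a b. idem a \<star> \<pi> b) = \<pi> h"
proof -
  have "\<pi> h = \<pi> h \<star> idem \<one>\<^bsub>H\<^esub>" using h by (simp add: idem_one)
  also have "\<dots> = sweedler Q h (\<lambda>a b. idem (a \<bullet> \<one>\<^bsub>H\<^esub>) \<star> \<pi> b)"
    by (rule hpar_class_idem) (use h in auto)
  also have "\<dots> = sweedler Q h (\<lambda>a b. idem a \<star> \<pi> b)"
    by (rule sweedler_cong) (use h in auto)
  finally show ?thesis by simp
qed

text \<open>The same identity with the last two factors combined into \<open>[S h\<^sub>2][h\<^sub>3] = \<epsilon>\<^bsub>S h\<^sub>2\<^esub>\<close>.\<close>

lemma sweedler_hpar_class_idem:
  assumes h: "h \<in> carrier H"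
  shows "sweedler Q h (\<lambda>a b. \<pi> a \<star> idem (S b)) = \<pi> h"
proof -
  have "sweedler Q h (\<lambda>a b. idem a \<star> \<pi> b)
    = sweedler Q h (\<lambda>a b. sweedler Q a (\<lambda>p q. \<pi> p \<star> (\<pi> (S q) \<star> \<pi> b)))"
  proof (rule sweedler_cong)
    fix a b assume ab: "a \<in> carrier H" "b \<in> carrier H"
    have "idem a \<star> \<pi> b = sweedler Q a (\<lambda>p q. \<pi> p \<star> \<pi> (S q) \<star> \<pi> b)"
      unfolding idem_def by (rule linear_sweedler_mult_left) (use ab in auto)
    also have "\<dots> = sweedler Q a (\<lambda>p q. \<pi> p \<star> (\<pi> (S q) \<star> \<pi> b))"
      by (rule sweedler_cong) (use ab in \<open>simp_all add: Q.m_assoc\<close>)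
    finally show "idem a \<star> \<pi> b = \<dots>" .
  qed (use h in auto)
  also have "\<dots> = sweedler Q h (\<lambda>p x. sweedler Q x (\<lambda>q b. \<pi> p \<star> (\<pi> (S q) \<star> \<pi> b)))"
    by (rule sweedler_coassoc) (use h in \<open>auto intro!: linear_hpar\<close>)
  also have "\<dots> = sweedler Q h (\<lambda>a b. \<pi> a \<star> idem (S b))"
    by (intro sweedler_cong) (use h in \<open>auto simp: idem_antipode linear_sweedler_mult_right\<close>)
  finally show ?thesis using sweedler_idem_hpar_class[OF h] by simp
qed

text \<open>The subalgebra generated by the \<open>\<epsilon>\<^sub>h\<close>.  Only left multiplication by generators is built in, so that induction
proceeds one factor at a time.\<close>

inductive_set idem_span :: "('h list \<Rightarrow> 'k) set set set" where
  one: "\<one>\<^bsub>Q\<^esub> \<in> idem_span"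
| mult: "h \<in> carrier H \<Longrightarrow> x \<in> idem_span \<Longrightarrow> idem h \<star> x \<in> idem_span"
| add: "x \<in> idem_span \<Longrightarrow> y \<in> idem_span \<Longrightarrow> x \<oplus>\<^bsub>Q\<^esub> y \<in> idem_span"
| smult: "c \<in> carrier K \<Longrightarrow> x \<in> idem_span \<Longrightarrow> c \<odot>\<^bsub>Q\<^esub> x \<in> idem_span"

lemma idem_span_closed [simp]: "x \<in> idem_span \<Longrightarrow> x \<in> carrier Q"
  by (induction rule: idem_span.induct) auto

lemma idem_span_submodule: "submodule idem_span K Q"
proof (rule Q.submoduleI)
  have "\<zero>\<^bsub>K\<^esub> \<in> carrier K" by simp
  from idem_span.smult[OF this idem_span.one] show "\<zero>\<^bsub>Q\<^esub> \<in> idem_span" by simp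
  show "\<ominus>\<^bsub>Q\<^esub> x \<in> idem_span" if "x \<in> idem_span" for x
    using idem_span.smult[OF _ that, of "\<ominus>\<^bsub>K\<^esub> \<one>\<^bsub>K\<^esub>"] that by (simp add: Q.smult_l_minus)
qed (auto intro: idem_span.intros)

lemma sweedler_idem_span:
  assumes "h \<in> carrier H" "\<And>a b. a \<in> carrier H \<Longrightarrow> b \<in> carrier H \<Longrightarrow> f a b \<in> idem_span"
  shows "sweedler Q h f \<in> idem_span"
  by (rule tensor_lift_in_submodule[OF _ _ _ idem_span_submodule]) (use assms in auto)

lemma idem_in_idem_span: "h \<in> carrier H \<Longrightarrow> idem h \<in> idem_span"
  using idem_span.mult[OF _ idem_span.one, of h] by simp

lemma idem_span_commute_idem:
  assumes "x \<in> idem_span" "h \<in> carrier H"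
  shows "idem h \<star> x = x \<star> idem h"
  using assms(1)
proof induction
  case (mult k x)
  have "idem h \<star> (idem k \<star> x) = (idem h \<star> idem k) \<star> x"
    using mult assms(2) by (simp add: Q.m_assoc)
  also have "\<dots> = idem k \<star> (idem h \<star> x)"
    using mult assms(2) by (simp add: Q.m_assoc idem_commute[of h k])
  finally show ?case using mult assms(2) by (simp add: Q.m_assoc)
qed (use assms(2) in \<open>simp_all add: Q.alg_l_distr Q.alg_r_distr Q.alg_smult_l Q.alg_smult_r\<close>)

lemma idem_span_commute:
  assumes "x \<in> idem_span" "y \<in> idem_span"
  shows "x \<star> y = y \<star> x"
  using assms(1)
proof induction
  case (mult k x)
  have "(idem k \<star> x) \<star> y = (idem k \<star> y) \<star> x"
    using mult assms(2) by (simp add: Q.m_assoc)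
  also have "\<dots> = y \<star> (idem k \<star> x)"
    using mult assms(2) by (simp add: Q.m_assoc idem_span_commute_idem)
  finally show ?case .
qed (use assms(2) in \<open>simp_all add: Q.alg_l_distr Q.alg_r_distr Q.alg_smult_l Q.alg_smult_r\<close>)

text \<open>By \<open>hpar_class_idem\<close>, \<open>[h\<^sub>1] \<epsilon>\<^sub>k x [S h\<^sub>2] = \<epsilon>\<^bsub>h\<^sub>1k\<^esub> [h\<^sub>2] x [S h\<^sub>3]\<close>, and the induction hypothesis applies
to \<open>h\<^sub>2\<close> and \<open>h\<^sub>3\<close>; therefore \<open>h\<close> must be arbitrary in the induction.\<close>

lemma idem_span_conjugate:
  assumes "x \<in> idem_span" "h \<in> carrier H"
  shows "sweedler Q h (\<lambda>a b. \<pi> a \<star> x \<star> \<pi> (S b)) \<in> idem_span"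
  using assms
proof (induction arbitrary: h)
  case one
  have "sweedler Q h (\<lambda>a b. \<pi> a \<star> \<one>\<^bsub>Q\<^esub> \<star> \<pi> (S b)) = idem h"
    unfolding idem_def by (rule sweedler_cong) (use one in auto)
  then show ?case using idem_in_idem_span[OF one] by simp
next
  case (mult k x)
  note kh = mult.hyps(1) mult.prems and x = idem_span_closed[OF mult.hyps(2)]
  have "sweedler Q h (\<lambda>a b. \<pi> a \<star> (idem k \<star> x) \<star> \<pi> (S b))
    = sweedler Q h (\<lambda>a b. sweedler Q a (\<lambda>p q. idem (p \<bullet> k) \<star> (\<pi> q \<star> x \<star> \<pi> (S b))))"
  proof (rule sweedler_cong)
    fix a b assume ab: "a \<in> carrier H" "b \<in> carrier H"
    have "\<pi> a \<star> (idem k \<star> x) \<star> \<pi> (S b) = (\<pi> a \<star> idem k) \<star> (x \<star> \<pi> (S b))"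
      using ab kh x by (simp add: Q.m_assoc)
    also have "\<dots> = sweedler Q a (\<lambda>p q. idem (p \<bullet> k) \<star> \<pi> q \<star> (x \<star> \<pi> (S b)))"
      unfolding hpar_class_idem[OF ab(1) kh(1)] by (rule linear_sweedler_mult_left) (use ab kh x in auto)
    also have "\<dots> = sweedler Q a (\<lambda>p q. idem (p \<bullet> k) \<star> (\<pi> q \<star> x \<star> \<pi> (S b)))"
      by (rule sweedler_cong) (use ab kh x in \<open>auto simp: Q.m_assoc\<close>)
    finally show "\<pi> a \<star> (idem k \<star> x) \<star> \<pi> (S b) = \<dots>" .
  qed (use kh x in auto)
  also have "\<dots> = sweedler Q h (\<lambda>p y. sweedler Q y (\<lambda>q b. idem (p \<bullet> k) \<star> (\<pi> q \<star> x \<star> \<pi> (S b))))"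
    by (rule sweedler_coassoc) (use kh x in \<open>auto intro!: linear_hpar\<close>)
  also have "\<dots> = sweedler Q h (\<lambda>p y. idem (p \<bullet> k) \<star> sweedler Q y (\<lambda>q b. \<pi> q \<star> x \<star> \<pi> (S b)))"
    by (intro sweedler_cong linear_sweedler_mult_right[symmetric]) (use kh x in auto)
  also have "\<dots> \<in> idem_span"
    by (intro sweedler_idem_span idem_span.mult mult.IH) (use kh in auto)
  finally show ?case .
next
  case (add x y)
  have "(\<lambda>x. sweedler Q h (\<lambda>a b. \<pi> a \<star> x \<star> \<pi> (S b))) \<in> linear_maps K Q Q"
    using add by (auto intro!: linear_hpar)
  from linear_maps_add[OF this, of x y] show ?case using add by (simp add: idem_span.add)
next
  case (smult c x)
  have "(\<lambda>x. sweedler Q h (\<lambda>a b. \<pi> a \<star> x \<star> \<pi> (S b))) \<in> linear_maps K Q Q"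
    using smult by (auto intro!: linear_hpar)
  from linear_maps_smult[OF this, of c x] show ?case using smult by (simp add: idem_span.smult)
qed

end

section \<open>Comultiplication and pseudo-antipode\<close>

definition opposite_algebra :: "('k, 'a) module \<Rightarrow> ('k, 'a) module" where
  "opposite_algebra A = A\<lparr>mult := (\<lambda>x y. y \<otimes>\<^bsub>A\<^esub> x)\<rparr>"

lemma opposite_algebra_simps [simp]:
  "carrier (opposite_algebra A) = carrier A" "add (opposite_algebra A) = add A"
  "zero (opposite_algebra A) = zero A" "one (opposite_algebra A) = one A"
  "smult (opposite_algebra A) = smult A" "x \<otimes>\<^bsub>opposite_algebra A\<^esub> y = y \<otimes>\<^bsub>A\<^esub> x"
  by (simp_all add: opposite_algebra_def)

lemma linear_maps_opposite_algebra: "linear_maps K V (opposite_algebra A) = linear_maps K V A"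
  by (simp add: linear_maps_def)

lemma tensor_lift_opposite_algebra: "tensor_lift K (opposite_algebra A) f t = tensor_lift K A f t"
  by (simp add: tensor_lift_def free_extend_def finsum_def)

lemma unital_algebra_opposite_algebra:
  assumes "unital_algebra K A"
  shows "unital_algebra K (opposite_algebra A)"
proof -
  interpret A: unital_algebra K A by fact
  have m: "module K (opposite_algebra A)"
    by (rule module_same_fields[OF A.module_axioms]) simp_all
  show ?thesis
  proof (rule unital_algebraI[OF unital_algebraD(3)[OF assms] m])
    show "mult (opposite_algebra A) \<in> bilinear_maps K (opposite_algebra A) (opposite_algebra A) (opposite_algebra A)"
      by (rule bilinear_mapsI; rule linear_mapsI)
        (simp_all add: A.alg_l_distr A.alg_r_distr A.alg_smult_l A.alg_smult_r)
  qed (simp_all add: A.m_assoc)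
qed

context cocommutative_hopf_algebra
begin

interpretation Q: unital_algebra K Q by auto

abbreviation QQ :: "('k, (('h list \<Rightarrow> 'k) set set \<times> ('h list \<Rightarrow> 'k) set set \<Rightarrow> 'k) set) module" where
  "QQ \<equiv> tensor_prod K Q Q"

abbreviation pureQ where "pureQ \<equiv> pure_tensor K Q Q"

lemma algebra_QQ [simp, intro!]: "unital_algebra K QQ" "assoc_algebra K QQ" "module K QQ"
  using unital_algebra_tensor_prod[OF algebra_Q(1) algebra_Q(1)] unital_algebraD by auto

lemma pureQ_closed [simp, intro!]: "x \<in> carrier Q \<Longrightarrow> y \<in> carrier Q \<Longrightarrow> pureQ x y \<in> carrier QQ"
  by (rule pure_tensor_closed) auto

lemma mult_QQ_closed [simp, intro!]: "x \<in> carrier QQ \<Longrightarrow> y \<in> carrier QQ \<Longrightarrow> x \<otimes>\<^bsub>QQ\<^esub> y \<in> carrier QQ"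
  by (rule assoc_algebra.alg_closed[OF algebra_QQ(2)])

lemma sweedler_pure_mult:
  assumes "h \<in> carrier H" "k \<in> carrier H"
    and "\<And>a b. a \<in> carrier H \<Longrightarrow> b \<in> carrier H \<Longrightarrow> f a b \<in> carrier Q"
      "\<And>a b. a \<in> carrier H \<Longrightarrow> b \<in> carrier H \<Longrightarrow> g a b \<in> carrier Q"
      "\<And>a b. a \<in> carrier H \<Longrightarrow> b \<in> carrier H \<Longrightarrow> f' a b \<in> carrier Q"
      "\<And>a b. a \<in> carrier H \<Longrightarrow> b \<in> carrier H \<Longrightarrow> g' a b \<in> carrier Q"
  shows "sweedler QQ h (\<lambda>a b. pureQ (f a b) (g a b)) \<otimes>\<^bsub>QQ\<^esub> sweedler QQ k (\<lambda>c d. pureQ (f' c d) (g' c d))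
    = sweedler QQ h (\<lambda>a b. sweedler QQ k (\<lambda>c d. pureQ (f a b \<star> f' c d) (g a b \<star> g' c d)))"
proof -
  have "sweedler QQ h (\<lambda>a b. pureQ (f a b) (g a b)) \<otimes>\<^bsub>QQ\<^esub> sweedler QQ k (\<lambda>c d. pureQ (f' c d) (g' c d))
    = sweedler QQ h (\<lambda>a b. pureQ (f a b) (g a b) \<otimes>\<^bsub>QQ\<^esub> sweedler QQ k (\<lambda>c d. pureQ (f' c d) (g' c d)))"
    by (rule linear_sweedler_mult_left) (auto simp: assms)
  also have "\<dots> = sweedler QQ h (\<lambda>a b. sweedler QQ k (\<lambda>c d. pureQ (f a b) (g a b) \<otimes>\<^bsub>QQ\<^esub> pureQ (f' c d) (g' c d)))"
    by (intro sweedler_cong linear_sweedler_mult_right) (auto simp: assms)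
  also have "\<dots> = sweedler QQ h (\<lambda>a b. sweedler QQ k (\<lambda>c d. pureQ (f a b \<star> f' c d) (g a b \<star> g' c d)))"
    by (intro sweedler_cong) (auto simp: assms mult_pure_tensor)
  finally show ?thesis .
qed

lemma linear_sweedler_pure:
  assumes "h \<in> carrier H" "x \<in> carrier Q" "\<And>a b. a \<in> carrier H \<Longrightarrow> b \<in> carrier H \<Longrightarrow> f a b \<in> carrier Q"
  shows "sweedler QQ h (\<lambda>a b. pureQ (f a b) x) = pureQ (sweedler Q h f) x"
    and "sweedler QQ h (\<lambda>a b. pureQ x (f a b)) = pureQ x (sweedler Q h f)"
proof -
  show "sweedler QQ h (\<lambda>a b. pureQ (f a b) x) = pureQ (sweedler Q h f) x"
    by (rule linear_sweedler_comp[OF linear_pure_left[OF _ _ linear_id], symmetric]) (use assms in auto)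
  show "sweedler QQ h (\<lambda>a b. pureQ x (f a b)) = pureQ x (sweedler Q h f)"
    by (rule linear_sweedler_comp[OF linear_pure_right[OF _ _ linear_id], symmetric]) (use assms in auto)
qed

text \<open>The left-hand side is \<open>f(k\<^sub>1) f'(k\<^sub>3) \<otimes> g(k\<^sub>2) g'(k\<^sub>4)\<close>; exchanging \<open>k\<^sub>2\<close> and \<open>k\<^sub>3\<close> lets the convolution
products of \<open>f\<close> with \<open>f'\<close> and of \<open>g\<close> with \<open>g'\<close> be formed separately.\<close>

lemma sweedler_mult_pure_convolution:
  assumes k: "k \<in> carrier H"
    and f: "f \<in> linear_maps K H Q" and g: "g \<in> linear_maps K H Q"
    and f': "f' \<in> linear_maps K H Q" and g': "g' \<in> linear_maps K H Q"
  shows "sweedler QQ k (\<lambda>x y. sweedler QQ x (\<lambda>a b. pureQ (f a) (g b)) \<otimes>\<^bsub>QQ\<^esub> sweedler QQ y (\<lambda>c d. pureQ (f' c) (g' d)))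
    = sweedler QQ k (\<lambda>x y. pureQ (sweedler Q x (\<lambda>a c. f a \<star> f' c)) (sweedler Q y (\<lambda>b d. g b \<star> g' d)))"
proof -
  note c[simp, intro!] = linear_maps_closed[OF f] linear_maps_closed[OF g] linear_maps_closed[OF f']
    linear_maps_closed[OF g']
  note l = linear_hpar linear_maps_comp[OF _ f] linear_maps_comp[OF _ g] linear_maps_comp[OF _ f']
    linear_maps_comp[OF _ g']
  have "sweedler QQ k (\<lambda>x y. sweedler QQ x (\<lambda>a b. pureQ (f a) (g b)) \<otimes>\<^bsub>QQ\<^esub> sweedler QQ y (\<lambda>c d. pureQ (f' c) (g' d)))
    = sweedler QQ k (\<lambda>x y. sweedler QQ x (\<lambda>a b. sweedler QQ y (\<lambda>c d. pureQ (f a \<star> f' c) (g b \<star> g' d))))"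
    by (intro sweedler_cong sweedler_pure_mult) (use k in auto)
  also have "\<dots> = sweedler QQ k (\<lambda>x y. sweedler QQ x (\<lambda>a b. sweedler QQ y (\<lambda>c d. pureQ (f a \<star> f' b) (g c \<star> g' d))))"
    by (rule sweedler_interchange[where G = "\<lambda>a b c d. pureQ (f a \<star> f' c) (g b \<star> g' d)"]) (use k in \<open>auto intro!: l\<close>)
  also have "\<dots> = sweedler QQ k (\<lambda>x y. sweedler QQ x (\<lambda>a b. pureQ (f a \<star> f' b) (sweedler Q y (\<lambda>c d. g c \<star> g' d))))"
    by (intro sweedler_cong linear_sweedler_pure(2)) (use k in auto)
  also have "\<dots> = sweedler QQ k (\<lambda>x y. pureQ (sweedler Q x (\<lambda>a c. f a \<star> f' c)) (sweedler Q y (\<lambda>b d. g b \<star> g' d)))"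
    by (intro sweedler_cong linear_sweedler_pure(1)) (use k in auto)
  finally show ?thesis .
qed

text \<open>The value \<open>[h\<^sub>1] \<otimes> [h\<^sub>2]\<close> prescribed for the comultiplication of \<open>Q\<close> at \<open>[h]\<close>.\<close>

definition comult_class :: "'h \<Rightarrow> (('h list \<Rightarrow> 'k) set set \<times> ('h list \<Rightarrow> 'k) set set \<Rightarrow> 'k) set" where
  "comult_class h = sweedler QQ h (\<lambda>a b. pureQ (\<pi> a) (\<pi> b))"

lemma comult_class_closed [simp, intro!]: "h \<in> carrier H \<Longrightarrow> comult_class h \<in> carrier QQ"
  unfolding comult_class_def by auto

lemma linear_comult_class: "f \<in> linear_maps K X H \<Longrightarrow> (\<lambda>x. comult_class (f x)) \<in> linear_maps K X QQ"
  unfolding comult_class_def by (rule linear_sweedler_arg) (auto intro!: linear_hpar)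

lemma comult_class_antipode:
  assumes "h \<in> carrier H"
  shows "comult_class (S h) = sweedler QQ h (\<lambda>a b. pureQ (\<pi> (S a)) (\<pi> (S b)))"
  unfolding comult_class_def by (rule sweedler_antipode) (use assms in \<open>auto intro!: linear_hpar\<close>)

lemma comult_class_mult:
  assumes "h \<in> carrier H" "k \<in> carrier H"
  shows "comult_class (h \<bullet> k) = sweedler QQ h (\<lambda>a b. sweedler QQ k (\<lambda>c d. pureQ (\<pi> (a \<bullet> c)) (\<pi> (b \<bullet> d))))"
  unfolding comult_class_def by (rule sweedler_mult) (use assms in \<open>auto intro!: linear_hpar\<close>)

lemma sweedler_comult_class:
  assumes "k \<in> carrier H"
  shows "sweedler QQ k (\<lambda>a b. comult_class a \<otimes>\<^bsub>QQ\<^esub> comult_class (S b))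
    = sweedler QQ k (\<lambda>x y. pureQ (idem x) (idem y))"
proof -
  have "sweedler QQ k (\<lambda>a b. comult_class a \<otimes>\<^bsub>QQ\<^esub> comult_class (S b))
    = sweedler QQ k (\<lambda>a b. sweedler QQ a (\<lambda>u v. pureQ (\<pi> u) (\<pi> v)) \<otimes>\<^bsub>QQ\<^esub> sweedler QQ b
      (\<lambda>s t. pureQ (\<pi> (S s)) (\<pi> (S t))))"
    by (rule sweedler_cong) (use assms in \<open>simp_all add: comult_class_antipode[symmetric]
      comult_class_def[symmetric]\<close>)
  also have "\<dots> = sweedler QQ k (\<lambda>x y. pureQ (idem x) (idem y))"
    unfolding idem_def by (rule sweedler_mult_pure_convolution) (use assms in \<open>auto intro!: linear_hpar\<close>)
  finally show ?thesis .
qed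

text \<open>By \<open>sweedler_comult_class\<close> the left-hand side is \<open>[h\<^sub>1]\<epsilon>\<^bsub>k\<^sub>1\<^esub> \<otimes> [h\<^sub>2]\<epsilon>\<^bsub>k\<^sub>2\<^esub>\<close>.  The relations of \<open>Q\<close> absorb \<open>[h\<^sub>1]\<close>
and \<open>[h\<^sub>2]\<close> in the two factors, and \<open>sweedler_mult_pure_convolution\<close> recombines them.\<close>

lemma comult_class_relation_left:
  assumes h: "h \<in> carrier H" and k: "k \<in> carrier H"
  shows "sweedler QQ k (\<lambda>a b. comult_class h \<otimes>\<^bsub>QQ\<^esub> comult_class a \<otimes>\<^bsub>QQ\<^esub> comult_class (S b))
    = sweedler QQ k (\<lambda>a b. comult_class (h \<bullet> a) \<otimes>\<^bsub>QQ\<^esub> comult_class (S b))"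
proof -
  have "sweedler QQ k (\<lambda>a b. comult_class h \<otimes>\<^bsub>QQ\<^esub> comult_class a \<otimes>\<^bsub>QQ\<^esub> comult_class (S b))
    = sweedler QQ k (\<lambda>a b. comult_class h \<otimes>\<^bsub>QQ\<^esub> (comult_class a \<otimes>\<^bsub>QQ\<^esub> comult_class (S b)))"
    by (rule sweedler_cong) (use h k in \<open>simp_all add: monoid.m_assoc[OF unital_algebraD(4)[OF algebra_QQ(1)]]\<close>)
  also have "\<dots> = comult_class h \<otimes>\<^bsub>QQ\<^esub> sweedler QQ k (\<lambda>x y. pureQ (idem x) (idem y))"
    unfolding sweedler_comult_class[OF k, symmetric]
    by (rule linear_sweedler_mult_right[symmetric]) (use h k in auto)
  also have "\<dots> = sweedler QQ h (\<lambda>p q. sweedler QQ k (\<lambda>x y. pureQ (\<pi> p \<star> idem x) (\<pi> q \<star> idem y)))"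
    unfolding comult_class_def by (rule sweedler_pure_mult) (use h k in auto)
  also have "\<dots> = sweedler QQ h (\<lambda>p q. sweedler QQ k (\<lambda>x y.
      pureQ (sweedler Q x (\<lambda>a b. \<pi> (p \<bullet> a) \<star> \<pi> (S b))) (sweedler Q y (\<lambda>a b. \<pi> (q \<bullet> a) \<star> \<pi> (S b)))))"
    by (intro sweedler_cong) (use h k in \<open>auto simp: hpar_class_idem_eq\<close>)
  also have "\<dots> = sweedler QQ h (\<lambda>p q. sweedler QQ k (\<lambda>a b.
      sweedler QQ a (\<lambda>u v. pureQ (\<pi> (p \<bullet> u)) (\<pi> (q \<bullet> v))) \<otimes>\<^bsub>QQ\<^esub> sweedler QQ b (\<lambda>s t. pureQ (\<pi> (S s)) (\<pi> (S t)))))"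
    by (intro sweedler_cong sweedler_mult_pure_convolution[symmetric]) (use h k in \<open>auto intro!: linear_hpar\<close>)
  also have "\<dots> = sweedler QQ k (\<lambda>a b. sweedler QQ h (\<lambda>p q.
      sweedler QQ a (\<lambda>u v. pureQ (\<pi> (p \<bullet> u)) (\<pi> (q \<bullet> v))) \<otimes>\<^bsub>QQ\<^esub> sweedler QQ b (\<lambda>s t. pureQ (\<pi> (S s)) (\<pi> (S t)))))"
    by (rule sweedler_swap) (use h k in auto)
  also have "\<dots> = sweedler QQ k (\<lambda>a b. comult_class (h \<bullet> a) \<otimes>\<^bsub>QQ\<^esub> comult_class (S b))"
  proof (rule sweedler_cong)
    fix a b assume ab: "a \<in> carrier H" "b \<in> carrier H"
    show "sweedler QQ h (\<lambda>p q. sweedler QQ a (\<lambda>u v. pureQ (\<pi> (p \<bullet> u)) (\<pi> (q \<bullet> v))) \<otimes>\<^bsub>QQ\<^esub> sweedler QQ b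
      (\<lambda>s t. pureQ (\<pi> (S s)) (\<pi> (S t))))
      = comult_class (h \<bullet> a) \<otimes>\<^bsub>QQ\<^esub> comult_class (S b)"
      unfolding comult_class_mult[OF h ab(1)] comult_class_antipode[OF ab(2)]
      by (rule linear_sweedler_mult_left[symmetric]) (use h ab in auto)
  qed (use h k in auto)
  finally show ?thesis .
qed

lemma comult_class_relation_right:
  assumes h: "h \<in> carrier H" and k: "k \<in> carrier H"
  shows "sweedler QQ h (\<lambda>a b. comult_class a \<otimes>\<^bsub>QQ\<^esub> comult_class (S b) \<otimes>\<^bsub>QQ\<^esub> comult_class k)
    = sweedler QQ h (\<lambda>a b. comult_class a \<otimes>\<^bsub>QQ\<^esub> comult_class (S b \<bullet> k))"
proof -
  have "sweedler QQ h (\<lambda>a b. comult_class a \<otimes>\<^bsub>QQ\<^esub> comult_class (S b) \<otimes>\<^bsub>QQ\<^esub> comult_class k)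
    = sweedler QQ h (\<lambda>x y. pureQ (idem x) (idem y)) \<otimes>\<^bsub>QQ\<^esub> comult_class k"
    unfolding sweedler_comult_class[OF h, symmetric]
    by (rule linear_sweedler_mult_left[symmetric]) (use h k in auto)
  also have "\<dots> = sweedler QQ h (\<lambda>x y. sweedler QQ k (\<lambda>p q. pureQ (idem x \<star> \<pi> p) (idem y \<star> \<pi> q)))"
    unfolding comult_class_def by (rule sweedler_pure_mult) (use h k in auto)
  also have "\<dots> = sweedler QQ k (\<lambda>p q. sweedler QQ h (\<lambda>x y. pureQ (idem x \<star> \<pi> p) (idem y \<star> \<pi> q)))"
    by (rule sweedler_swap) (use h k in auto)
  also have "\<dots> = sweedler QQ k (\<lambda>p q. sweedler QQ h (\<lambda>x y.
      pureQ (sweedler Q x (\<lambda>a b. \<pi> a \<star> \<pi> (S b \<bullet> p))) (sweedler Q y (\<lambda>a b. \<pi> a \<star> \<pi> (S b \<bullet> q)))))"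
    by (intro sweedler_cong) (use h k in \<open>auto simp: hpar_class_idem_eq\<close>)
  also have "\<dots> = sweedler QQ k (\<lambda>p q. sweedler QQ h (\<lambda>a b.
      sweedler QQ a (\<lambda>u v. pureQ (\<pi> u) (\<pi> v)) \<otimes>\<^bsub>QQ\<^esub> sweedler QQ b (\<lambda>s t. pureQ (\<pi> (S s \<bullet> p)) (\<pi> (S t \<bullet> q)))))"
    by (intro sweedler_cong sweedler_mult_pure_convolution[symmetric]) (use h k in \<open>auto intro!: linear_hpar\<close>)
  also have "\<dots> = sweedler QQ h (\<lambda>a b. sweedler QQ k (\<lambda>p q.
      sweedler QQ a (\<lambda>u v. pureQ (\<pi> u) (\<pi> v)) \<otimes>\<^bsub>QQ\<^esub> sweedler QQ b (\<lambda>s t. pureQ (\<pi> (S s \<bullet> p)) (\<pi> (S t \<bullet> q)))))"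
    by (rule sweedler_swap) (use h k in auto)
  also have "\<dots> = sweedler QQ h (\<lambda>a b. comult_class a \<otimes>\<^bsub>QQ\<^esub> comult_class (S b \<bullet> k))"
  proof (rule sweedler_cong)
    fix a b assume ab: "a \<in> carrier H" "b \<in> carrier H"
    have "comult_class (S b \<bullet> k) = sweedler QQ (S b) (\<lambda>s t. sweedler QQ k (\<lambda>p q. pureQ (\<pi> (s \<bullet> p)) (\<pi> (t \<bullet> q))))"
      by (rule comult_class_mult) (use ab k in auto)
    also have "\<dots> = sweedler QQ b (\<lambda>s t. sweedler QQ k (\<lambda>p q. pureQ (\<pi> (S s \<bullet> p)) (\<pi> (S t \<bullet> q))))"
      by (rule sweedler_antipode) (use ab k in \<open>auto intro!: linear_hpar\<close>)
    also have "\<dots> = sweedler QQ k (\<lambda>p q. sweedler QQ b (\<lambda>s t. pureQ (\<pi> (S s \<bullet> p)) (\<pi> (S t \<bullet> q))))"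
      by (rule sweedler_swap) (use ab k in auto)
    finally have m: "comult_class (S b \<bullet> k) = \<dots>" .
    show "sweedler QQ k (\<lambda>p q. sweedler QQ a (\<lambda>u v. pureQ (\<pi> u) (\<pi> v)) \<otimes>\<^bsub>QQ\<^esub> sweedler QQ b
      (\<lambda>s t. pureQ (\<pi> (S s \<bullet> p)) (\<pi> (S t \<bullet> q))))
      = comult_class a \<otimes>\<^bsub>QQ\<^esub> comult_class (S b \<bullet> k)"
      unfolding m comult_class_def[symmetric]
      by (rule linear_sweedler_mult_right[symmetric]) (use ab k in auto)
  qed (use h k in auto)
  finally show ?thesis .
qed

lemma comult_class_one: "comult_class \<one>\<^bsub>H\<^esub> = \<one>\<^bsub>QQ\<^esub>"
proof -
  have "comult_class \<one>\<^bsub>H\<^esub> = pureQ (\<pi> \<one>\<^bsub>H\<^esub>) (\<pi> \<one>\<^bsub>H\<^esub>)"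
    unfolding comult_class_def by (rule sweedler_one) (auto intro!: linear_hpar)
  then show ?thesis by (simp add: hpar_class_one tensor_prod_simps(5))
qed

lemma hpar_comult:
  obtains \<Delta>p where "\<Delta>p \<in> algebra_homs K Q QQ" "\<And>h. h \<in> carrier H \<Longrightarrow> \<Delta>p (\<pi> h) = comult_class h"
  by (rule hpar_lift[OF algebra_QQ(1) linear_comult_class[OF linear_id] comult_class_one
      comult_class_relation_left comult_class_relation_right]) (assumption | rule that)+

text \<open>Under \<open>h \<mapsto> [S h]\<close>, read in the opposite algebra, each of the two families of relations becomes the
other one, because \<open>S\<close> is antimultiplicative and involutive and \<open>\<Delta>\<close> is cocommutative.\<close>

lemma hpar_pseudo_antipode:
  obtains Sp where "Sp \<in> linear_maps K Q Q" "Sp \<one>\<^bsub>Q\<^esub> = \<one>\<^bsub>Q\<^esub>"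
    "\<And>x y. x \<in> carrier Q \<Longrightarrow> y \<in> carrier Q \<Longrightarrow> Sp (x \<star> y) = Sp y \<star> Sp x"
    "\<And>h. h \<in> carrier H \<Longrightarrow> Sp (\<pi> h) = \<pi> (S h)"
proof -
  let ?O = "opposite_algebra Q"
  have u: "unital_algebra K ?O" by (rule unital_algebra_opposite_algebra) auto
  have l: "(\<lambda>h. \<pi> (S h)) \<in> linear_maps K H ?O"
    unfolding linear_maps_opposite_algebra by (auto intro!: linear_hpar)
  have o: "\<pi> (S \<one>\<^bsub>H\<^esub>) = \<one>\<^bsub>?O\<^esub>" by (simp add: antipode_one hpar_class_one)
  obtain \<Phi> where \<Phi>: "\<Phi> \<in> algebra_homs K Q ?O" "\<And>h. h \<in> carrier H \<Longrightarrow> \<Phi> (\<pi> h) = \<pi> (S h)"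
  proof (rule hpar_lift[OF u l o, unfolded tensor_lift_opposite_algebra opposite_algebra_simps])
    fix h k assume h: "h \<in> carrier H" and k: "k \<in> carrier H"
    have "sweedler Q k (\<lambda>a b. \<pi> (S (S b)) \<star> (\<pi> (S a) \<star> \<pi> (S h)))
      = sweedler Q k (\<lambda>a b. \<pi> b \<star> \<pi> (S a) \<star> \<pi> (S h))"
      by (rule sweedler_cong) (use h k in \<open>auto simp: antipode_antipode Q.m_assoc\<close>)
    also have "\<dots> = sweedler Q k (\<lambda>a b. \<pi> a \<star> \<pi> (S b) \<star> \<pi> (S h))"
      by (rule sweedler_cocomm) (use h k in \<open>auto intro!: linear_hpar\<close>)
    also have "\<dots> = sweedler Q k (\<lambda>a b. \<pi> a \<star> \<pi> (S b \<bullet> S h))"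
      by (rule hpar_relation_right) (use h k in auto)
    also have "\<dots> = sweedler Q k (\<lambda>a b. \<pi> b \<star> \<pi> (S a \<bullet> S h))"
      by (rule sweedler_cocomm) (use h k in \<open>auto intro!: linear_hpar\<close>)
    also have "\<dots> = sweedler Q k (\<lambda>a b. \<pi> (S (S b)) \<star> \<pi> (S (h \<bullet> a)))"
      by (rule sweedler_cong) (use h k in \<open>auto simp: antipode_antipode antipode_mult\<close>)
    finally show "sweedler Q k (\<lambda>a b. \<pi> (S (S b)) \<star> (\<pi> (S a) \<star> \<pi> (S h))) = \<dots>" .
    have "sweedler Q h (\<lambda>a b. \<pi> (S k) \<star> (\<pi> (S (S b)) \<star> \<pi> (S a)))
      = sweedler Q h (\<lambda>a b. \<pi> (S k) \<star> \<pi> b \<star> \<pi> (S a))"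
      by (rule sweedler_cong) (use h k in \<open>auto simp: antipode_antipode Q.m_assoc\<close>)
    also have "\<dots> = sweedler Q h (\<lambda>a b. \<pi> (S k) \<star> \<pi> a \<star> \<pi> (S b))"
      by (rule sweedler_cocomm) (use h k in \<open>auto intro!: linear_hpar\<close>)
    also have "\<dots> = sweedler Q h (\<lambda>a b. \<pi> (S k \<bullet> a) \<star> \<pi> (S b))"
      by (rule hpar_relation_left) (use h k in auto)
    also have "\<dots> = sweedler Q h (\<lambda>a b. \<pi> (S k \<bullet> b) \<star> \<pi> (S a))"
      by (rule sweedler_cocomm) (use h k in \<open>auto intro!: linear_hpar\<close>)
    also have "\<dots> = sweedler Q h (\<lambda>a b. \<pi> (S (S b \<bullet> k)) \<star> \<pi> (S a))"
      by (rule sweedler_cong) (use h k in \<open>auto simp: antipode_antipode antipode_mult\<close>)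
    finally show "sweedler Q h (\<lambda>a b. \<pi> (S k) \<star> (\<pi> (S (S b)) \<star> \<pi> (S a))) = \<dots>" .
  qed blast
  show thesis
    by (rule that[of \<Phi>]) (use algebra_homsD[OF \<Phi>(1)] \<Phi>(2) in \<open>simp_all add: linear_maps_opposite_algebra\<close>)
qed

end

section \<open>The axioms of a quantum inverse semigroup\<close>

text \<open>The two maps supplied by \<open>hpar_comult\<close> and \<open>hpar_pseudo_antipode\<close>.\<close>

locale hpar_structure = cocommutative_hopf_algebra K H \<Delta> \<epsilon> S
  for K :: "'k ring" and H :: "('k, 'h) module"
    and \<Delta> :: "'h \<Rightarrow> ('h \<times> 'h \<Rightarrow> 'k) set" and \<epsilon> :: "'h \<Rightarrow> 'k" and S :: "'h \<Rightarrow> 'h" +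
  fixes \<Delta>p :: "('h list \<Rightarrow> 'k) set set \<Rightarrow> (('h list \<Rightarrow> 'k) set set \<times> ('h list \<Rightarrow> 'k) set set \<Rightarrow> 'k) set"
    and Sp :: "('h list \<Rightarrow> 'k) set set \<Rightarrow> ('h list \<Rightarrow> 'k) set set"
  assumes comultQ_hom: "\<Delta>p \<in> algebra_homs K Q QQ"
    and comultQ_class: "h \<in> carrier H \<Longrightarrow> \<Delta>p (\<pi> h) = comult_class h"
    and antipodeQ_linear: "Sp \<in> linear_maps K Q Q"
    and antipodeQ_one: "Sp \<one>\<^bsub>Q\<^esub> = \<one>\<^bsub>Q\<^esub>"
    and antipodeQ_mult: "\<lbrakk>x \<in> carrier Q; y \<in> carrier Q\<rbrakk> \<Longrightarrow> Sp (x \<star> y) = Sp y \<star> Sp x"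
    and antipodeQ_class: "h \<in> carrier H \<Longrightarrow> Sp (\<pi> h) = \<pi> (S h)"
begin

interpretation Q: unital_algebra K Q by auto

abbreviation sweedlerQ :: "('k, 'u) module \<Rightarrow> ('h list \<Rightarrow> 'k) set set
    \<Rightarrow> (('h list \<Rightarrow> 'k) set set \<Rightarrow> ('h list \<Rightarrow> 'k) set set \<Rightarrow> 'u) \<Rightarrow> 'u" where
  "sweedlerQ U x f \<equiv> tensor_lift K U f (\<Delta>p x)"

lemma comultQ_linear: "\<Delta>p \<in> linear_maps K Q QQ"
  by (rule algebra_homsD(1)[OF comultQ_hom])

lemma comultQ_closed [simp, intro!]: "x \<in> carrier Q \<Longrightarrow> \<Delta>p x \<in> carrier QQ"
  by (rule linear_maps_closed[OF comultQ_linear])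

lemma antipodeQ_closed [simp, intro!]: "x \<in> carrier Q \<Longrightarrow> Sp x \<in> carrier Q"
  by (rule linear_maps_closed[OF antipodeQ_linear])

lemma sweedlerQ_closed [intro!]:
  assumes "module K U" "x \<in> carrier Q" "\<And>a b. a \<in> carrier Q \<Longrightarrow> b \<in> carrier Q \<Longrightarrow> f a b \<in> carrier U"
  shows "sweedlerQ U x f \<in> carrier U"
  by (rule tensor_lift_closed[of K Q Q]) (use assms in auto)

lemma sweedlerQ_cong:
  assumes "module K U" "x \<in> carrier Q" "\<And>a b. a \<in> carrier Q \<Longrightarrow> b \<in> carrier Q \<Longrightarrow> f a b = g a b"
    "\<And>a b. a \<in> carrier Q \<Longrightarrow> b \<in> carrier Q \<Longrightarrow> g a b \<in> carrier U"
  shows "sweedlerQ U x f = sweedlerQ U x g"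
  by (rule tensor_lift_cong[of K Q Q, OF _ _ assms(1) _ assms(3,4)]) (use assms(2) in auto)

lemma linear_sweedlerQ_arg:
  assumes "g \<in> linear_maps K X Q" "module K U" "f \<in> bilinear_maps K Q Q U"
  shows "(\<lambda>x. sweedlerQ U (g x) f) \<in> linear_maps K X U"
  by (rule linear_tensor_lift_arg[OF linear_maps_comp[OF assms(1) comultQ_linear]]) (use assms in auto)

lemma linear_sweedlerQ_param:
  assumes "module K X" "module K U" "x \<in> carrier Q"
    "\<And>a b. a \<in> carrier Q \<Longrightarrow> b \<in> carrier Q \<Longrightarrow> (\<lambda>x. f x a b) \<in> linear_maps K X U"
  shows "(\<lambda>y. sweedlerQ U x (f y)) \<in> linear_maps K X U"
  by (rule linear_tensor_lift_param[of K X Q Q]) (use assms in auto)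

lemma linear_antipodeQ: "f \<in> linear_maps K X Q \<Longrightarrow> (\<lambda>x. Sp (f x)) \<in> linear_maps K X Q"
  by (rule linear_maps_comp[OF _ antipodeQ_linear])

lemmas linear_structure = linear_hpar linear_sweedlerQ_arg linear_sweedlerQ_param linear_antipodeQ

lemma sweedler_sweedlerQ_swap:
  assumes "module K U" "h \<in> carrier H" "x \<in> carrier Q"
    "\<And>a b c d. a \<in> carrier H \<Longrightarrow> b \<in> carrier H \<Longrightarrow> c \<in> carrier Q \<Longrightarrow> d \<in> carrier Q \<Longrightarrow> f a b c d \<in> carrier U"
  shows "sweedler U h (\<lambda>a b. sweedlerQ U x (\<lambda>c d. f a b c d)) = sweedlerQ U x (\<lambda>c d. sweedler U h (\<lambda>a b. f a b c d))"
  by (rule tensor_lift_swap[of K H H Q Q]) (use assms in auto)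

lemma linear_sweedlerQ_comp:
  assumes "g \<in> linear_maps K U U'" "module K U" "module K U'" "x \<in> carrier Q"
    "\<And>a b. a \<in> carrier Q \<Longrightarrow> b \<in> carrier Q \<Longrightarrow> f a b \<in> carrier U"
  shows "g (sweedlerQ U x f) = sweedlerQ U' x (\<lambda>a b. g (f a b))"
  by (rule linear_tensor_lift_comp[of K Q Q]) (use assms in auto)

lemma sweedlerQ_mult_left:
  assumes "x \<in> carrier Q" "c \<in> carrier Q" "\<And>a b. a \<in> carrier Q \<Longrightarrow> b \<in> carrier Q \<Longrightarrow> f a b \<in> carrier Q"
  shows "sweedlerQ Q x f \<star> c = sweedlerQ Q x (\<lambda>a b. f a b \<star> c)"
  by (rule linear_sweedlerQ_comp[OF linear_mult_left[OF algebra_Q(2) linear_id assms(2)]]) (use assms in auto)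

lemma sweedlerQ_mult_right:
  assumes "x \<in> carrier Q" "c \<in> carrier Q" "\<And>a b. a \<in> carrier Q \<Longrightarrow> b \<in> carrier Q \<Longrightarrow> f a b \<in> carrier Q"
  shows "c \<star> sweedlerQ Q x f = sweedlerQ Q x (\<lambda>a b. c \<star> f a b)"
  by (rule linear_sweedlerQ_comp[OF linear_mult_right[OF algebra_Q(2) linear_id assms(2)]]) (use assms in auto)

lemma sweedlerQ_one:
  assumes "module K U" "f \<in> bilinear_maps K Q Q U"
  shows "sweedlerQ U \<one>\<^bsub>Q\<^esub> f = f \<one>\<^bsub>Q\<^esub> \<one>\<^bsub>Q\<^esub>"
  using tensor_lift_pure[of K Q Q U f] assms algebra_homsD(2)[OF comultQ_hom] by (simp add: tensor_prod_simps(5))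

lemma sweedlerQ_class:
  assumes "module K U" "f \<in> bilinear_maps K Q Q U" "h \<in> carrier H"
  shows "sweedlerQ U (\<pi> h) f = sweedler U h (\<lambda>a b. f (\<pi> a) (\<pi> b))"
proof -
  have "sweedlerQ U (\<pi> h) f = sweedler U h (\<lambda>a b. tensor_lift K U f (pureQ (\<pi> a) (\<pi> b)))"
    unfolding comultQ_class[OF assms(3)] comult_class_def
    by (rule linear_sweedler_comp[OF linear_tensor_lift[OF _ _ assms(1,2)]]) (use assms in auto)
  also have "\<dots> = sweedler U h (\<lambda>a b. f (\<pi> a) (\<pi> b))"
    by (rule sweedler_cong) (use assms in \<open>auto simp: tensor_lift_pure bilinear_maps_closed[OF assms(2)]\<close>)
  finally show ?thesis .
qed

lemma sweedlerQ_mult: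
  assumes "module K U" "f \<in> bilinear_maps K Q Q U" "x \<in> carrier Q" "y \<in> carrier Q"
  shows "sweedlerQ U (x \<star> y) f = sweedlerQ U x (\<lambda>a b. sweedlerQ U y (\<lambda>c d. f (a \<star> c) (b \<star> d)))"
  using tensor_lift_mult[of K Q Q U f] assms algebra_homsD(3)[OF comultQ_hom] by simp

text \<open>The recursion by which properties of \<open>\<Delta>p\<close> are proved: \<open>\<Delta>p([h] x) = [h\<^sub>1] x\<^sub>1 \<otimes> [h\<^sub>2] x\<^sub>2\<close>.\<close>

lemma sweedlerQ_class_mult:
  assumes U: "module K U" and f: "f \<in> bilinear_maps K Q Q U" and h: "h \<in> carrier H" and x: "x \<in> carrier Q"
  shows "sweedlerQ U (\<pi> h \<star> x) f = sweedler U h (\<lambda>a b. sweedlerQ U x (\<lambda>c d. f (\<pi> a \<star> c) (\<pi> b \<star> d)))"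
proof -
  have "sweedlerQ U (\<pi> h \<star> x) f = sweedlerQ U (\<pi> h) (\<lambda>a b. sweedlerQ U x (\<lambda>c d. f (a \<star> c) (b \<star> d)))"
    by (rule sweedlerQ_mult) (use U f h x in auto)
  also have "\<dots> = sweedler U h (\<lambda>a b. sweedlerQ U x (\<lambda>c d. f (\<pi> a \<star> c) (\<pi> b \<star> d)))"
    by (rule sweedlerQ_class)
      (use U h x in \<open>auto intro!: linear_structure linear_maps_comp[OF _ bilinear_mapsD(1)[OF f]]
        linear_maps_comp[OF _ bilinear_mapsD(2)[OF f]]\<close>)
  finally show ?thesis .
qed

lemma sweedlerQ_mult_class:
  assumes U: "module K U" and f: "f \<in> bilinear_maps K Q Q U" and h: "h \<in> carrier H" and x: "x \<in> carrier Q"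
  shows "sweedlerQ U (x \<star> \<pi> h) f = sweedlerQ U x (\<lambda>c d. sweedler U h (\<lambda>a b. f (c \<star> \<pi> a) (d \<star> \<pi> b)))"
proof -
  have "sweedlerQ U (x \<star> \<pi> h) f = sweedlerQ U x (\<lambda>c d. sweedlerQ U (\<pi> h) (\<lambda>a b. f (c \<star> a) (d \<star> b)))"
    by (rule sweedlerQ_mult) (use U f h x in auto)
  also have "\<dots> = sweedlerQ U x (\<lambda>c d. sweedler U h (\<lambda>a b. f (c \<star> \<pi> a) (d \<star> \<pi> b)))"
    by (intro sweedlerQ_cong sweedlerQ_class)
      (use U h x bilinear_maps_closed[OF f] in \<open>auto intro!: linear_structure linear_maps_comp[OF _
        bilinear_mapsD(1)[OF f]] linear_maps_comp[OF _ bilinear_mapsD(2)[OF f]]\<close>)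
  finally show ?thesis .
qed

definition trilinear :: "('k, 'u) module \<Rightarrow> (('h list \<Rightarrow> 'k) set set \<Rightarrow> ('h list \<Rightarrow> 'k) set set \<Rightarrow> ('h list \<Rightarrow> 'k) set
  set \<Rightarrow> 'u) \<Rightarrow> bool" where
  "trilinear U F \<longleftrightarrow> (\<forall>x\<in>carrier Q. \<forall>y\<in>carrier Q. (\<lambda>a. F a x y) \<in> linear_maps K Q U \<and>
    (\<lambda>a. F x a y) \<in> linear_maps K Q U \<and> (\<lambda>a. F x y a) \<in> linear_maps K Q U)"

text \<open>Induction on \<open>x\<close>, for all trilinear \<open>F\<close> at once: for \<open>[h] x\<close> the factors \<open>[h\<^sub>1]\<close>, \<open>[h\<^sub>2]\<close>, \<open>[h\<^sub>3]\<close> are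
absorbed into \<open>F\<close> before the induction hypothesis is used, and coassociativity of \<open>H\<close> rebrackets them.\<close>

lemma sweedlerQ_coassoc:
  assumes U: "module K U" and F: "trilinear U F" and x: "x \<in> carrier Q"
  shows "sweedlerQ U x (\<lambda>a b. sweedlerQ U a (\<lambda>c d. F c d b)) = sweedlerQ U x (\<lambda>a b. sweedlerQ U b (\<lambda>c d. F a c d))"
proof -
  interpret U: module K U by (rule U)
  have tri: "(\<lambda>x. F (f x) b c) \<in> linear_maps K X U" "(\<lambda>x. F b (f x) c) \<in> linear_maps K X U" "(\<lambda>x. F b c (f x)) \<in>
    linear_maps K X U"
    if "trilinear U F" "f \<in> linear_maps K X Q" "b \<in> carrier Q" "c \<in> carrier Q" for F f b c and X :: "('k, 'x) module"
    using that by (auto simp: trilinear_def intro: linear_maps_comp)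
  have tric: "F a b c \<in> carrier U" if "trilinear U F" "a \<in> carrier Q" "b \<in> carrier Q" "c \<in> carrier Q" for F a b c
    using linear_maps_closed[OF tri(1)[OF that(1) linear_id that(3,4)] that(2)] .
  have bl: "(\<lambda>a b. sweedlerQ U a (\<lambda>c d. F c d b)) \<in> bilinear_maps K Q Q U"
    "(\<lambda>a b. sweedlerQ U b (\<lambda>c d. F a c d)) \<in> bilinear_maps K Q Q U" if "trilinear U F" for F
    using U by (auto intro!: linear_structure tri[OF that])
  show ?thesis using x F
  proof (induction arbitrary: F rule: hpar_induct_left)
    case one
    have "sweedlerQ U \<one>\<^bsub>Q\<^esub> (\<lambda>c d. F c d \<one>\<^bsub>Q\<^esub>) = F \<one>\<^bsub>Q\<^esub> \<one>\<^bsub>Q\<^esub> \<one>\<^bsub>Q\<^esub>"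
      by (rule sweedlerQ_one[OF U]) (auto intro!: linear_structure tri[OF one])
    moreover have "sweedlerQ U \<one>\<^bsub>Q\<^esub> (\<lambda>c d. F \<one>\<^bsub>Q\<^esub> c d) = F \<one>\<^bsub>Q\<^esub> \<one>\<^bsub>Q\<^esub> \<one>\<^bsub>Q\<^esub>"
      by (rule sweedlerQ_one[OF U]) (auto intro!: linear_structure tri[OF one])
    ultimately show ?case by (simp add: sweedlerQ_one[OF U bl(1)[OF one]] sweedlerQ_one[OF U bl(2)[OF one]])
  next
    case (mult h x)
    note h = mult.hyps(1) and x = mult.hyps(2) and F = mult.prems
    note c = tric[OF F]
    have "sweedlerQ U (\<pi> h \<star> x) (\<lambda>a b. sweedlerQ U a (\<lambda>c d. F c d b))
      = sweedler U h (\<lambda>a b. sweedlerQ U x (\<lambda>c d. sweedlerQ U (\<pi> a \<star> c) (\<lambda>u v. F u v (\<pi> b \<star> d))))"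
      by (rule sweedlerQ_class_mult[OF U bl(1)[OF F] h x])
    also have "\<dots> = sweedler U h (\<lambda>a b. sweedlerQ U x (\<lambda>c d. sweedler U a (\<lambda>p q. sweedlerQ U c (\<lambda>u v. F (\<pi> p
      \<star> u) (\<pi> q \<star> v) (\<pi> b \<star> d)))))"
      by (intro sweedler_cong sweedlerQ_cong sweedlerQ_class_mult)
        (use U h x in \<open>auto intro!: linear_structure tri[OF F] c\<close>)
    also have "\<dots> = sweedler U h (\<lambda>a b. sweedler U a (\<lambda>p q. sweedlerQ U x (\<lambda>c d. sweedlerQ U c (\<lambda>u v. F (\<pi> p
      \<star> u) (\<pi> q \<star> v) (\<pi> b \<star> d)))))"
      by (intro sweedler_cong sweedler_sweedlerQ_swap[symmetric]) (use U h x in \<open>auto intro!: c\<close>)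
    also have "\<dots> = sweedler U h (\<lambda>a b. sweedler U a (\<lambda>p q. sweedlerQ U x (\<lambda>c d. sweedlerQ U d (\<lambda>u v. F (\<pi> p
      \<star> c) (\<pi> q \<star> u) (\<pi> b \<star> v)))))"
    proof (intro sweedler_cong)
      fix a b p q assume *: "a \<in> carrier H" "b \<in> carrier H" "p \<in> carrier H" "q \<in> carrier H"
      have "trilinear U (\<lambda>u v w. F (\<pi> p \<star> u) (\<pi> q \<star> v) (\<pi> b \<star> w))"
        unfolding trilinear_def using * by (auto intro!: linear_structure tri[OF F])
      from mult.IH[OF this]
      show "sweedlerQ U x (\<lambda>c d. sweedlerQ U c (\<lambda>u v. F (\<pi> p \<star> u) (\<pi> q \<star> v) (\<pi> b \<star> d)))
        = sweedlerQ U x (\<lambda>c d. sweedlerQ U d (\<lambda>u v. F (\<pi> p \<star> c) (\<pi> q \<star> u) (\<pi> b \<star> v)))" .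
    qed (use U h x in \<open>auto intro!: c\<close>)
    also have "\<dots> = sweedler U h (\<lambda>a b. sweedler U b (\<lambda>p q. sweedlerQ U x (\<lambda>c d. sweedlerQ U d (\<lambda>u v. F (\<pi> a
      \<star> c) (\<pi> p \<star> u) (\<pi> q \<star> v)))))"
      by (rule sweedler_coassoc) (use U h x in \<open>auto intro!: linear_structure tri[OF F]\<close>)
    also have "\<dots> = sweedler U h (\<lambda>a b. sweedlerQ U x (\<lambda>c d. sweedler U b (\<lambda>p q. sweedlerQ U d (\<lambda>u v. F (\<pi> a
      \<star> c) (\<pi> p \<star> u) (\<pi> q \<star> v)))))"
      by (intro sweedler_cong sweedler_sweedlerQ_swap) (use U h x in \<open>auto intro!: c\<close>)
    also have "\<dots> = sweedler U h (\<lambda>a b. sweedlerQ U x (\<lambda>c d. sweedlerQ U (\<pi> b \<star> d) (\<lambda>u v. F (\<pi> a \<star> c) u v)))"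
      by (intro sweedler_cong sweedlerQ_cong sweedlerQ_class_mult[symmetric])
        (use U h x in \<open>auto intro!: linear_structure tri[OF F] c\<close>)
    also have "\<dots> = sweedlerQ U (\<pi> h \<star> x) (\<lambda>a b. sweedlerQ U b (\<lambda>c d. F a c d))"
      by (rule sweedlerQ_class_mult[OF U bl(2)[OF F] h x, symmetric])
    finally show ?case .
  next
    case (add x y)
    note l = linear_tensor_lift[OF algebra_Q(3) algebra_Q(3) U bl(1)[OF add.prems]] linear_tensor_lift[OF
      algebra_Q(3) algebra_Q(3) U bl(2)[OF add.prems]]
    show ?case
      using add.hyps add.IH[OF add.prems] by (simp add: linear_maps_add[OF comultQ_linear] linear_maps_add[OF
        l(1)] linear_maps_add[OF l(2)])
  next
    case (smult c x)
    note l = linear_tensor_lift[OF algebra_Q(3) algebra_Q(3) U bl(1)[OF smult.prems]] linear_tensor_lift[OF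
      algebra_Q(3) algebra_Q(3) U bl(2)[OF smult.prems]]
    show ?case
      using smult.hyps smult.IH[OF smult.prems] by (simp add: linear_maps_smult[OF comultQ_linear]
        linear_maps_smult[OF l(1)] linear_maps_smult[OF l(2)])
  qed
qed

lemma comultQ_coassociative: "coassociative K Q \<Delta>p"
  unfolding coassociative_def
proof
  fix x assume x: "x \<in> carrier Q"
  let ?T = "tensor_prod K Q QQ"
  have T: "module K ?T" by (rule module_tensor_prod) auto
  have "trilinear ?T (\<lambda>c d b. pure_tensor K Q QQ c (pureQ d b))"
    unfolding trilinear_def by (auto intro!: linear_structure)
  from sweedlerQ_coassoc[OF T this x]
  show "tensor_assoc K Q Q Q (tensor_map K QQ Q \<Delta>p (\<lambda>y. y) (\<Delta>p x)) = tensor_map K Q QQ (\<lambda>y. y) \<Delta>p (\<Delta>p x)"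
    unfolding coassociative_eq[OF algebra_Q(3) comultQ_linear x] .
qed

text \<open>The convolution products of the identity with \<open>Sp\<close> and of \<open>Sp\<close> with the identity; in an inverse
semigroup they are \<open>x x\<inverse>\<close> and \<open>x\<inverse> x\<close>.\<close>

definition range_idem :: "('h list \<Rightarrow> 'k) set set \<Rightarrow> ('h list \<Rightarrow> 'k) set set" where
  "range_idem x = sweedlerQ Q x (\<lambda>a b. a \<star> Sp b)"

definition source_idem :: "('h list \<Rightarrow> 'k) set set \<Rightarrow> ('h list \<Rightarrow> 'k) set set" where
  "source_idem x = sweedlerQ Q x (\<lambda>a b. Sp a \<star> b)"

lemma convolution_eq_idem:
  "convolution K Q \<Delta>p (\<lambda>x. x) Sp = range_idem" "convolution K Q \<Delta>p Sp (\<lambda>x. x) = source_idem"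
  by (simp_all add: convolution_def range_idem_def source_idem_def fun_eq_iff)

lemma range_source_closed [simp, intro!]:
  "x \<in> carrier Q \<Longrightarrow> range_idem x \<in> carrier Q"
  unfolding range_idem_def by auto

lemma linear_range_source: "f \<in> linear_maps K X Q \<Longrightarrow> (\<lambda>x. range_idem (f x)) \<in> linear_maps K X Q"
  unfolding range_idem_def by (rule linear_sweedlerQ_arg) (auto intro!: linear_structure)

lemma range_idem_one: "range_idem \<one>\<^bsub>Q\<^esub> = \<one>\<^bsub>Q\<^esub>"
proof -
  have "range_idem \<one>\<^bsub>Q\<^esub> = \<one>\<^bsub>Q\<^esub> \<star> Sp \<one>\<^bsub>Q\<^esub>"
    unfolding range_idem_def by (rule sweedlerQ_one) (auto intro!: linear_structure)
  then show ?thesis by (simp add: antipodeQ_one)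
qed

lemma range_idem_class_mult:
  assumes h: "h \<in> carrier H" and x: "x \<in> carrier Q"
  shows "range_idem (\<pi> h \<star> x) = sweedler Q h (\<lambda>a b. \<pi> a \<star> range_idem x \<star> \<pi> (S b))"
proof -
  have "range_idem (\<pi> h \<star> x) = sweedler Q h (\<lambda>a b. sweedlerQ Q x (\<lambda>c d. (\<pi> a \<star> c) \<star> Sp (\<pi> b \<star> d)))"
    unfolding range_idem_def by (rule sweedlerQ_class_mult) (use h x in \<open>auto intro!: linear_structure\<close>)
  also have "\<dots> = sweedler Q h (\<lambda>a b. \<pi> a \<star> range_idem x \<star> \<pi> (S b))"
  proof (rule sweedler_cong)
    fix a b assume ab: "a \<in> carrier H" "b \<in> carrier H"
    have "\<pi> a \<star> range_idem x \<star> \<pi> (S b) = sweedlerQ Q x (\<lambda>c d. \<pi> a \<star> (c \<star> Sp d)) \<star> \<pi> (S b)"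
      unfolding range_idem_def by (subst sweedlerQ_mult_right) (use ab x in auto)
    also have "\<dots> = sweedlerQ Q x (\<lambda>c d. \<pi> a \<star> (c \<star> Sp d) \<star> \<pi> (S b))"
      by (rule sweedlerQ_mult_left) (use ab x in auto)
    also have "\<dots> = sweedlerQ Q x (\<lambda>c d. (\<pi> a \<star> c) \<star> Sp (\<pi> b \<star> d))"
      by (rule sweedlerQ_cong) (use ab x in \<open>simp_all add: antipodeQ_mult antipodeQ_class Q.m_assoc\<close>)
    finally show "sweedlerQ Q x (\<lambda>c d. (\<pi> a \<star> c) \<star> Sp (\<pi> b \<star> d)) = \<pi> a \<star> range_idem x \<star> \<pi> (S b)" by simp
  qed (use h x in auto)
  finally show ?thesis .
qed

lemma range_idem_in_idem_span:
  assumes "x \<in> carrier Q"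
  shows "range_idem x \<in> idem_span"
  using assms
proof (induction rule: hpar_induct_left)
  case one
  then show ?case by (simp add: range_idem_one idem_span.one)
next
  case (mult h x)
  then show ?case by (simp add: range_idem_class_mult idem_span_conjugate)
next
  case (add x y)
  then show ?case by (simp add: linear_maps_add[OF linear_range_source[OF linear_id]] idem_span.add)
next
  case (smult c x)
  then show ?case by (simp add: linear_maps_smult[OF linear_range_source[OF linear_id]] idem_span.smult)
qed

text \<open>For \<open>[h] x\<close> the sum is \<open>[h\<^sub>1] e(x\<^sub>1) [S h\<^sub>2][h\<^sub>3] x\<^sub>2\<close> with \<open>e = range_idem\<close>.  Since \<open>e(x\<^sub>1)\<close> commutes with
\<open>[S h\<^sub>2][h\<^sub>3]\<close>, this is \<open>[h\<^sub>1][S h\<^sub>2][h\<^sub>3] e(x\<^sub>1) x\<^sub>2 = [h] x\<close>.\<close>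

lemma range_idem_convolution_id:
  assumes "x \<in> carrier Q"
  shows "sweedlerQ Q x (\<lambda>a b. range_idem a \<star> b) = x"
  using assms
proof (induction rule: hpar_induct_left)
  case one
  have "sweedlerQ Q \<one>\<^bsub>Q\<^esub> (\<lambda>a b. range_idem a \<star> b) = range_idem \<one>\<^bsub>Q\<^esub> \<star> \<one>\<^bsub>Q\<^esub>"
    by (rule sweedlerQ_one) (auto intro!: linear_structure linear_range_source)
  then show ?case by (simp add: range_idem_one)
next
  case (mult h x)
  note h = mult(1) and x = mult(2)
  let ?G = "\<lambda>p q b. sweedlerQ Q x (\<lambda>c d. \<pi> p \<star> range_idem c \<star> \<pi> (S q) \<star> (\<pi> b \<star> d))"
  have "sweedlerQ Q (\<pi> h \<star> x) (\<lambda>a b. range_idem a \<star> b)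
    = sweedler Q h (\<lambda>a b. sweedlerQ Q x (\<lambda>c d. range_idem (\<pi> a \<star> c) \<star> (\<pi> b \<star> d)))"
    by (rule sweedlerQ_class_mult) (use h x in \<open>auto intro!: linear_structure linear_range_source\<close>)
  also have "\<dots> = sweedler Q h (\<lambda>a b. sweedlerQ Q x (\<lambda>c d. sweedler Q a (\<lambda>p q. \<pi> p \<star> range_idem c \<star> \<pi> (S q)
    \<star> (\<pi> b \<star> d))))"
  proof (intro sweedler_cong sweedlerQ_cong)
    fix a b c d assume *: "a \<in> carrier H" "b \<in> carrier H" "c \<in> carrier Q" "d \<in> carrier Q"
    show "range_idem (\<pi> a \<star> c) \<star> (\<pi> b \<star> d)
      = sweedler Q a (\<lambda>p q. \<pi> p \<star> range_idem c \<star> \<pi> (S q) \<star> (\<pi> b \<star> d))"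
      unfolding range_idem_class_mult[OF *(1,3)] by (rule linear_sweedler_mult_left) (use * in auto)
  qed (use h x in auto)
  also have "\<dots> = sweedler Q h (\<lambda>a b. sweedler Q a (\<lambda>p q. ?G p q b))"
    by (intro sweedler_cong sweedler_sweedlerQ_swap[symmetric]) (use h x in auto)
  also have "\<dots> = sweedler Q h (\<lambda>p y. sweedler Q y (\<lambda>q b. ?G p q b))"
    by (rule sweedler_coassoc) (use h x in \<open>auto intro!: linear_structure\<close>)
  also have "\<dots> = sweedler Q h (\<lambda>p y. sweedlerQ Q x (\<lambda>c d. sweedler Q y (\<lambda>q b. \<pi> p \<star> range_idem c \<star> \<pi> (S q)
    \<star> (\<pi> b \<star> d))))"
    by (intro sweedler_cong sweedler_sweedlerQ_swap) (use h x in auto)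
  also have "\<dots> = sweedler Q h (\<lambda>p y. sweedlerQ Q x (\<lambda>c d. (\<pi> p \<star> idem (S y)) \<star> (range_idem c \<star> d)))"
  proof (intro sweedler_cong sweedlerQ_cong)
    fix p y c d assume *: "p \<in> carrier H" "y \<in> carrier H" "c \<in> carrier Q" "d \<in> carrier Q"
    have "sweedler Q y (\<lambda>q b. \<pi> p \<star> range_idem c \<star> \<pi> (S q) \<star> (\<pi> b \<star> d))
      = sweedler Q y (\<lambda>q b. \<pi> p \<star> range_idem c \<star> ((\<pi> (S q) \<star> \<pi> b) \<star> d))"
      by (rule sweedler_cong) (use * in \<open>simp_all add: Q.m_assoc\<close>)
    also have "\<dots> = \<pi> p \<star> range_idem c \<star> sweedler Q y (\<lambda>q b. (\<pi> (S q) \<star> \<pi> b) \<star> d)"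
      by (rule linear_sweedler_mult_right[symmetric]) (use * in auto)
    also have "sweedler Q y (\<lambda>q b. (\<pi> (S q) \<star> \<pi> b) \<star> d) = idem (S y) \<star> d"
      unfolding idem_antipode[OF *(2)] by (rule linear_sweedler_mult_left[symmetric]) (use * in auto)
    also have "\<pi> p \<star> range_idem c \<star> (idem (S y) \<star> d) = \<pi> p \<star> (range_idem c \<star> idem (S y)) \<star> d"
      using * by (simp add: Q.m_assoc)
    also have "range_idem c \<star> idem (S y) = idem (S y) \<star> range_idem c"
      using * by (intro idem_span_commute_idem[symmetric] range_idem_in_idem_span) auto
    also have "\<pi> p \<star> (idem (S y) \<star> range_idem c) \<star> d = (\<pi> p \<star> idem (S y)) \<star> (range_idem c \<star> d)"
      using * by (simp add: Q.m_assoc)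
    finally show "sweedler Q y (\<lambda>q b. \<pi> p \<star> range_idem c \<star> \<pi> (S q) \<star> (\<pi> b \<star> d)) = \<dots>" .
  qed (use h x in auto)
  also have "\<dots> = sweedler Q h (\<lambda>p y. (\<pi> p \<star> idem (S y)) \<star> x)"
  proof (rule sweedler_cong)
    fix p y assume *: "p \<in> carrier H" "y \<in> carrier H"
    have "sweedlerQ Q x (\<lambda>c d. (\<pi> p \<star> idem (S y)) \<star> (range_idem c \<star> d))
      = (\<pi> p \<star> idem (S y)) \<star> sweedlerQ Q x (\<lambda>c d. range_idem c \<star> d)"
      by (rule sweedlerQ_mult_right[symmetric]) (use * x in auto)
    then show "sweedlerQ Q x (\<lambda>c d. (\<pi> p \<star> idem (S y)) \<star> (range_idem c \<star> d)) = (\<pi> p \<star> idem (S y)) \<star> x"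
      using mult(3) by simp
  qed (use h x in auto)
  also have "\<dots> = sweedler Q h (\<lambda>p y. \<pi> p \<star> idem (S y)) \<star> x"
    by (rule linear_sweedler_mult_left[symmetric]) (use h x in auto)
  also have "\<dots> = \<pi> h \<star> x" by (simp add: sweedler_hpar_class_idem[OF h])
  finally show ?case .
next
  case (add x y)
  have "(\<lambda>x. sweedlerQ Q x (\<lambda>a b. range_idem a \<star> b)) \<in> linear_maps K Q Q"
    by (auto intro!: linear_structure linear_range_source)
  from linear_maps_add[OF this, of x y] show ?case using add by simp
next
  case (smult c x)
  have "(\<lambda>x. sweedlerQ Q x (\<lambda>a b. range_idem a \<star> b)) \<in> linear_maps K Q Q"
    by (auto intro!: linear_structure linear_range_source)
  from linear_maps_smult[OF this, of c x] show ?case using smult by simp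
qed

lemma antipodeQ_antipodeQ:
  assumes "x \<in> carrier Q"
  shows "Sp (Sp x) = x"
  using assms
proof (induction rule: hpar_induct_left)
  case (mult h x)
  then show ?case by (simp add: antipodeQ_mult antipodeQ_class antipode_antipode)
qed (simp_all add: antipodeQ_one linear_maps_add[OF antipodeQ_linear] linear_maps_smult[OF antipodeQ_linear])

text \<open>\<open>Sp\<close> is a morphism of coalgebras.  Both sides are linear in \<open>x\<close>; for \<open>[h] x\<close> the claim combines the one for
\<open>x\<close> with \<open>sweedler_antipode\<close>, because \<open>Sp ([h] x) = Sp x [S h]\<close>.\<close>

lemma sweedlerQ_antipodeQ:
  assumes U: "module K U" and x: "x \<in> carrier Q" and F: "F \<in> bilinear_maps K Q Q U"
  shows "sweedlerQ U (Sp x) F = sweedlerQ U x (\<lambda>a b. F (Sp a) (Sp b))"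
  using x F
proof (induction arbitrary: F rule: hpar_induct_left)
  case one
  have "sweedlerQ U \<one>\<^bsub>Q\<^esub> (\<lambda>a b. F (Sp a) (Sp b)) = F (Sp \<one>\<^bsub>Q\<^esub>) (Sp \<one>\<^bsub>Q\<^esub>)"
    by (rule sweedlerQ_one[OF U])
      (intro bilinear_mapsI linear_maps_comp[OF antipodeQ_linear bilinear_mapsD(1)[OF one]]
        linear_maps_comp[OF antipodeQ_linear bilinear_mapsD(2)[OF one]] antipodeQ_closed; assumption)
  then show ?case by (simp add: antipodeQ_one sweedlerQ_one[OF U one])
next
  case (mult h x)
  note h = mult.hyps(1) and x = mult.hyps(2) and F = mult.prems
  note c = bilinear_maps_closed[OF F]
  note l = linear_structure linear_maps_comp[OF _ bilinear_mapsD(1)[OF F]] linear_maps_comp[OF _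
    bilinear_mapsD(2)[OF F]]
  have "sweedlerQ U (Sp (\<pi> h \<star> x)) F = sweedlerQ U (Sp x \<star> \<pi> (S h)) F"
    using h x by (simp add: antipodeQ_mult antipodeQ_class)
  also have "\<dots> = sweedlerQ U (Sp x) (\<lambda>c d. sweedler U (S h) (\<lambda>a b. F (c \<star> \<pi> a) (d \<star> \<pi> b)))"
    by (rule sweedlerQ_mult_class[OF U F]) (use h x in auto)
  also have "\<dots> = sweedlerQ U x (\<lambda>c d. sweedler U (S h) (\<lambda>a b. F (Sp c \<star> \<pi> a) (Sp d \<star> \<pi> b)))"
    by (rule mult.IH) (use U h in \<open>auto intro!: l\<close>)
  also have "\<dots> = sweedlerQ U x (\<lambda>c d. sweedler U h (\<lambda>a b. F (Sp c \<star> \<pi> (S a)) (Sp d \<star> \<pi> (S b))))"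
    by (intro sweedlerQ_cong sweedler_antipode) (use U h x in \<open>auto intro!: l c\<close>)
  also have "\<dots> = sweedler U h (\<lambda>a b. sweedlerQ U x (\<lambda>c d. F (Sp c \<star> \<pi> (S a)) (Sp d \<star> \<pi> (S b))))"
    by (rule sweedler_sweedlerQ_swap[symmetric]) (use U h x in \<open>auto intro!: c\<close>)
  also have "\<dots> = sweedler U h (\<lambda>a b. sweedlerQ U x (\<lambda>c d. F (Sp (\<pi> a \<star> c)) (Sp (\<pi> b \<star> d))))"
    by (intro sweedler_cong sweedlerQ_cong) (use U h x in \<open>auto simp: antipodeQ_mult antipodeQ_class intro!: c\<close>)
  also have "\<dots> = sweedlerQ U (\<pi> h \<star> x) (\<lambda>a b. F (Sp a) (Sp b))"
    by (rule sweedlerQ_class_mult[symmetric, OF U]) (use U h x in \<open>auto intro!: l\<close>)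
  finally show ?case .
next
  case (add x y)
  note l = linear_structure linear_maps_comp[OF _ bilinear_mapsD(1)[OF add.prems]] linear_maps_comp[OF _
    bilinear_mapsD(2)[OF add.prems]]
  have "(\<lambda>x. sweedlerQ U (Sp x) F) \<in> linear_maps K Q U" "(\<lambda>x. sweedlerQ U x
    (\<lambda>a b. F (Sp a) (Sp b))) \<in> linear_maps K Q U"
    using U add.prems by (auto intro!: l)
  from this[THEN linear_maps_add, OF add.hyps] show ?case by (simp add: add.IH[OF add.prems])
next
  case (smult c x)
  note l = linear_structure linear_maps_comp[OF _ bilinear_mapsD(1)[OF smult.prems]] linear_maps_comp[OF _
    bilinear_mapsD(2)[OF smult.prems]]
  have "(\<lambda>x. sweedlerQ U (Sp x) F) \<in> linear_maps K Q U" "(\<lambda>x. sweedlerQ U x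
    (\<lambda>a b. F (Sp a) (Sp b))) \<in> linear_maps K Q U"
    using U smult.prems by (auto intro!: l)
  from this[THEN linear_maps_smult, OF smult.hyps] show ?case by (simp add: smult.IH[OF smult.prems])
qed

text \<open>\<open>Sp(x\<^sub>1) x\<^sub>2 = Sp(x\<^sub>1) Sp(Sp(x\<^sub>2))\<close>, and \<open>Sp(x\<^sub>1) \<otimes> Sp(x\<^sub>2)\<close> is \<open>\<Delta>p (Sp x)\<close>.\<close>

lemma source_idem_eq:
  assumes "x \<in> carrier Q"
  shows "source_idem x = range_idem (Sp x)"
proof -
  have "range_idem (Sp x) = sweedlerQ Q x (\<lambda>a b. Sp a \<star> Sp (Sp b))"
    unfolding range_idem_def by (rule sweedlerQ_antipodeQ) (use assms in \<open>auto intro!: linear_structure\<close>)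
  also have "\<dots> = source_idem x"
    unfolding source_idem_def by (rule sweedlerQ_cong) (use assms in \<open>simp_all add: antipodeQ_antipodeQ\<close>)
  finally show ?thesis by simp
qed

lemma source_idem_convolution_antipode:
  assumes "x \<in> carrier Q"
  shows "sweedlerQ Q x (\<lambda>a b. source_idem a \<star> Sp b) = Sp x"
proof -
  have "sweedlerQ Q x (\<lambda>a b. source_idem a \<star> Sp b) = sweedlerQ Q x (\<lambda>a b. range_idem (Sp a) \<star> Sp b)"
    by (rule sweedlerQ_cong) (use assms in \<open>simp_all add: source_idem_eq\<close>)
  also have "\<dots> = sweedlerQ Q (Sp x) (\<lambda>a b. range_idem a \<star> b)"
    by (rule sweedlerQ_antipodeQ[symmetric]) (use assms in \<open>auto intro!: linear_structure linear_range_source\<close>)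
  also have "\<dots> = Sp x" by (rule range_idem_convolution_id) (use assms in auto)
  finally show ?thesis .
qed

lemma unital_qisg_hpar: "unital_qisg K Q \<Delta>p Sp"
proof -
  have "qisg_axioms K Q \<Delta>p Sp"
  proof (rule qisg_axioms.intro)
    show "\<Delta>p \<in> linear_maps K Q QQ" by (rule comultQ_linear)
    show "\<Delta>p (x \<star> y) = \<Delta>p x \<otimes>\<^bsub>QQ\<^esub> \<Delta>p y" if "x \<in> carrier Q" "y \<in> carrier Q" for x y
      by (rule algebra_homsD(3)[OF comultQ_hom that])
    show "coassociative K Q \<Delta>p" by (rule comultQ_coassociative)
    show "Sp \<in> linear_maps K Q Q" by (rule antipodeQ_linear)
    show "Sp (x \<star> y) = Sp y \<star> Sp x" if "x \<in> carrier Q" "y \<in> carrier Q" for x y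
      by (rule antipodeQ_mult[OF that])
    show "convolution K Q \<Delta>p (convolution K Q \<Delta>p (\<lambda>y. y) Sp) (\<lambda>y. y) x = x" if "x \<in> carrier Q" for x
      unfolding convolution_eq_idem using range_idem_convolution_id[OF that] by (simp add: convolution_def)
    show "convolution K Q \<Delta>p (convolution K Q \<Delta>p Sp (\<lambda>y. y)) Sp x = Sp x" if "x \<in> carrier Q" for x
      unfolding convolution_eq_idem using source_idem_convolution_antipode[OF that] by (simp add: convolution_def)
    show "convolution K Q \<Delta>p (\<lambda>z. z) Sp x \<star> convolution K Q \<Delta>p Sp (\<lambda>z. z) y =
        convolution K Q \<Delta>p Sp (\<lambda>z. z) y \<star> convolution K Q \<Delta>p (\<lambda>z. z) Sp x"
      if "x \<in> carrier Q" "y \<in> carrier Q" for x y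
      unfolding convolution_eq_idem
      by (rule idem_span_commute[OF range_idem_in_idem_span[OF that(1)] range_idem_in_idem_span[OF
        antipodeQ_closed[OF that(2)], folded source_idem_eq[OF that(2)]]])
  qed
  then show ?thesis
    using antipodeQ_one by (simp add: unital_qisg_def qisg_def unital_qisg_axioms_def)
qed

end

theorem theorem3p12:
  fixes K :: "'k ring" and H :: "('k, 'h) module"
    and \<Delta> :: "'h \<Rightarrow> ('h \<times> 'h \<Rightarrow> 'k) set" and \<epsilon> :: "'h \<Rightarrow> 'k" and S :: "'h \<Rightarrow> 'h"
  assumes "field K" and "char_zero K"
    and "hopf_algebra K H \<Delta> \<epsilon> S"
    and "cocommutative K H \<Delta>"
  shows "\<exists>\<Delta>p Sp.
    unital_qisg K (hpar K H \<Delta> S) \<Delta>p Sp \<and>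
    (\<forall>h\<in>carrier H. \<Delta>p (hpar_class K H \<Delta> S h) =
       tensor_map K (hpar K H \<Delta> S) (hpar K H \<Delta> S) (hpar_class K H \<Delta> S) (hpar_class K H \<Delta> S) (\<Delta> h)) \<and>
    (\<forall>h\<in>carrier H. Sp (hpar_class K H \<Delta> S h) = hpar_class K H \<Delta> S (S h))"
proof -
  interpret cocommutative_hopf_algebra K H \<Delta> \<epsilon> S
    by (intro cocommutative_hopf_algebra.intro cocommutative_hopf_algebra_axioms.intro assms)
  obtain \<Delta>p where \<Delta>p: "\<Delta>p \<in> algebra_homs K Q QQ" "\<And>h. h \<in> carrier H \<Longrightarrow> \<Delta>p (\<pi> h) = comult_class h"
    by (rule hpar_comult) (rule that)
  obtain Sp where Sp: "Sp \<in> linear_maps K Q Q" "Sp \<one>\<^bsub>Q\<^esub> = \<one>\<^bsub>Q\<^esub>"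
    "\<And>x y. x \<in> carrier Q \<Longrightarrow> y \<in> carrier Q \<Longrightarrow> Sp (x \<otimes>\<^bsub>Q\<^esub> y) = Sp y \<otimes>\<^bsub>Q\<^esub> Sp x"
    "\<And>h. h \<in> carrier H \<Longrightarrow> Sp (\<pi> h) = \<pi> (S h)"
    by (rule hpar_pseudo_antipode) (rule that)
  interpret hpar_structure K H \<Delta> \<epsilon> S \<Delta>p Sp
    by unfold_locales (fact \<Delta>p Sp)+
  show ?thesis
    by (intro exI[of _ \<Delta>p] exI[of _ Sp] conjI ballI)
      (simp_all add: unital_qisg_hpar \<Delta>p(2) Sp(4) comult_class_def tensor_map_eq)
qed

end
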